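(* Suppose $R$ is a principal ideal domain and $c\in R$ is prime. If $(R,c)$ satisfies any one of the following three conditions, then $\widetilde{ss}_c=ss_c$ as knot invariants: 1. $(R,c)=(F[H],H)$ for some field $F$; 2. $c=2\neq0$ in $R$; 3. $2=0$ in $R$.
   Context: Links and diagrams are oriented. Khovanov complex: let $R$ be a commutative ring, $c\in R$; put $a=0$, $b=c$. Let $A=R[X]/(X^2-cX)$ with counit $\epsilon(1)=0,\epsilon(X)=1$ and comultiplication $\Delta(1)=X\otimes1+1\otimes X-c\,(1\otimes1)$, $\Delta(X)=X\otimes X$. Put $X_a=X$, $X_b=X-c$. $C_c(D)$ is the usual Khovanov cube complex of a link diagram $D$ built from $A$ in place of $\mathbb{Z}[X]/(X^2)$, and $H_c(D)$ is its homology. $ab$-coloring: separate $\mathbb{R}^2$ into regions by the Seifert circles of $D$, color the regions black/white in checkerboard fashion with the unbounded region white. Each Seifert circle, oriented as inherited from $D$, is colored $a$ if it sees a black region to its left, and $b$ otherwise. Each arc gets the color of its Seifert circle. Lee cycle: $\alpha(D)\in C_c(D)$ is the element in the orientation-preserving state with $X_a$ on each Seifert circle colored $a$ and $X_b$ on each Seifert circle colored $b$; it is a cycle. For a marked point $p$ on $D$, $\tilde C_c(D)\subset C_c(D)$ is the subcomplex whose tensor factor at the circle containing $p$ is restricted to multiples of $X_a$ if $p$ is colored $a$ and of $X_b$ if $p$ is colored $b$; $\tilde H_c(D)$ is its homology. $\alpha(D)$ lies in $\tilde C_c(D)$, and is denoted $\tilde\alpha(D)$ there. Invariants: for $z$ in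 an $R$-module $M$, $d_c(z)=\max\{k\ge0\mid z\in c^kM\}$. Let $\tilde d_c(D)$ be the $c$-divisibility of $[\tilde\alpha(D)]$ in $\tilde H_c(D)/\mathrm{Tor}$ and $d_c(D)$ the $c$-divisibility of $[\alpha(D)]$ in $H_c(D)/\mathrm{Tor}$, with $\mathrm{Tor}$ the $R$-torsion. With $w(D)$ the writhe and $r(D)$ the number of Seifert circles, $$\widetilde{ss}_c(K)=2\tilde d_c(D)+w(D)-r(D)+1,\qquad ss_c(K)=2d_c(D)+w(D)-r(D)+1$$ for any diagram $D$ of $K$; both are knot invariants. *)

theory Defs
  imports
    "HOL-Algebra.Ring_Divisibility"
    "HOL-Algebra.Algebraic_Closure_Type"
    "HOL-Computational_Algebra.Polynomial"
begin

section \<open>Oriented knot diagrams\<close>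

text \<open>
  A diagram is an oriented plane graph whose vertices are the crossings. Its edges are the arcs of
  the diagram between consecutive crossings; an edge that meets no crossing is a closed curve, so
  the crossingless diagram of the unknot has one edge and no crossing.

  A crossing is drawn with both strands pointing upwards. One strand runs from the lower left edge
  \<open>in_left\<close> to the upper right edge \<open>out_right\<close>, the other from the lower right edge \<open>in_right\<close> to
  the upper left edge \<open>out_left\<close>. The crossing is positive iff the first of these is the over-strand.
\<close>

record crossing =
  is_positive :: bool
  in_left :: nat
  in_right :: nat
  out_left :: nat
  out_right :: nat

datatype side = LeftSide | RightSide

text \<open>
  The unbounded face of the plane diagram is recorded by \<open>outer\<close>, an edge together with the side of
  it on which the unbounded face lies.
\<close>

record diagram =
  edges :: "nat set"
  crossings :: "crossing list"
  outer :: "nat \<times> side"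

abbreviation n_crossings :: "diagram \<Rightarrow> nat" where
  "n_crossings D \<equiv> length (crossings D)"

definition components :: "'a set \<Rightarrow> ('a \<times> 'a) set \<Rightarrow> 'a set set" where
  "components V r = V // (r \<union> r\<inverse>)\<^sup>*"

definition in_ends :: "diagram \<Rightarrow> nat list" where
  "in_ends D = concat (map (\<lambda>x. [in_left x, in_right x]) (crossings D))"

definition out_ends :: "diagram \<Rightarrow> nat list" where
  "out_ends D = concat (map (\<lambda>x. [out_left x, out_right x]) (crossings D))"

definition strand_rel :: "diagram \<Rightarrow> (nat \<times> nat) set" where
  "strand_rel D = (\<Union>x\<in>set (crossings D). {(in_left x, out_right x), (in_right x, out_left x)})"

text \<open>
  The four corners at a crossing, in the order west, east, south, north. Each corner joins the two
  sides of edges that bound it, and the faces are the resulting classes of sides.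
\<close>

definition corner_rel :: "diagram \<Rightarrow> ((nat \<times> side) \<times> (nat \<times> side)) set" where
  "corner_rel D = (\<Union>x\<in>set (crossings D).
     {((in_left x, LeftSide), (out_left x, LeftSide)),
      ((in_right x, RightSide), (out_right x, RightSide)),
      ((in_left x, RightSide), (in_right x, LeftSide)),
      ((out_left x, RightSide), (out_right x, LeftSide))})"

definition faces :: "diagram \<Rightarrow> (nat \<times> side) set set" where
  "faces D = components (edges D \<times> UNIV) (corner_rel D)"

text \<open>
  A one-component diagram is connected, so by Euler's formula (\<open>n\<close> vertices and \<open>2n\<close> edges) it is
  planar iff it has \<open>n + 2\<close> faces. This is also right for the crossingless circle.
\<close>

definition knot_diagram :: "diagram \<Rightarrow> bool" where
  "knot_diagram D \<longleftrightarrow>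
     finite (edges D) \<and>
     distinct (in_ends D) \<and> distinct (out_ends D) \<and>
     set (in_ends D) = set (out_ends D) \<and> set (in_ends D) \<subseteq> edges D \<and>
     card (components (edges D) (strand_rel D)) = 1 \<and>
     card (faces D) = n_crossings D + 2 \<and>
     fst (outer D) \<in> edges D"

definition writhe :: "diagram \<Rightarrow> int" where
  "writhe D = (\<Sum>x\<leftarrow>crossings D. if is_positive x then 1 else - 1)"

section \<open>States and the coloring of Seifert circles\<close>

text \<open>
  A vertex of the cube is given by the set \<open>v\<close> of (indices of) the crossings that are 1-resolved.
  The 0-resolution of a positive crossing and the 1-resolution of a negative crossing respect the
  orientation. A circle of a resolved diagram is identified with the set of edges it runs through.
\<close>

definition resolution :: "crossing \<Rightarrow> bool \<Rightarrow> (nat \<times> nat) set" where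
  "resolution x b =
     (if is_positive x \<noteq> b
      then {(in_left x, out_left x), (in_right x, out_right x)}
      else {(in_left x, in_right x), (out_left x, out_right x)})"

definition circles :: "diagram \<Rightarrow> nat set \<Rightarrow> nat set set" where
  "circles D v =
     components (edges D) (\<Union>i<n_crossings D. resolution (crossings D ! i) (i \<in> v))"

definition circle_of :: "diagram \<Rightarrow> nat set \<Rightarrow> nat \<Rightarrow> nat set" where
  "circle_of D v p = (THE \<gamma>. \<gamma> \<in> circles D v \<and> p \<in> \<gamma>)"

definition seifert_state :: "diagram \<Rightarrow> nat set" where
  "seifert_state D = {i. i < n_crossings D \<and> \<not> is_positive (crossings D ! i)}"

abbreviation seifert_circles :: "diagram \<Rightarrow> nat set set" where
  "seifert_circles D \<equiv> circles D (seifert_state D)"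

text \<open>
  The orientation-preserving resolution opens a channel between the south and the north corner of
  a crossing, so the regions cut out by the Seifert circles arise from the faces by merging along
  these channels. A coloring is given by the predicate \<open>f\<close> on sides of edges, to be read as
  the region on this side is black; it has to be constant on regions.
\<close>

definition channel_rel :: "diagram \<Rightarrow> ((nat \<times> side) \<times> (nat \<times> side)) set" where
  "channel_rel D =
     (\<Union>x\<in>set (crossings D). {((in_left x, RightSide), (out_left x, RightSide))})"

definition seifert_regions :: "diagram \<Rightarrow> (nat \<times> side) set set" where
  "seifert_regions D = components (edges D \<times> UNIV) (corner_rel D \<union> channel_rel D)"

definition checkerboard :: "diagram \<Rightarrow> (nat \<times> side \<Rightarrow> bool) \<Rightarrow> bool" where
  "checkerboard D f \<longleftrightarrow>
     (\<forall>A\<in>seifert_regions D. \<forall>s\<in>A. \<forall>t\<in>A. f s = f t) \<and>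
     (\<forall>e\<in>edges D. f (e, LeftSide) \<noteq> f (e, RightSide)) \<and>
     \<not> f (outer D)"

text \<open>On the sides of the edges of a knot diagram the checkerboard coloring exists and is unique.\<close>

definition black :: "diagram \<Rightarrow> nat \<times> side \<Rightarrow> bool" where
  "black D = (SOME f. checkerboard D f)"

text \<open>All edges of a Seifert circle have the same region to their left.\<close>

definition colored_a :: "diagram \<Rightarrow> nat set \<Rightarrow> bool" where
  "colored_a D \<gamma> \<longleftrightarrow> (\<exists>e\<in>\<gamma>. black D (e, LeftSide))"

section \<open>The Khovanov complex\<close>

text \<open>
  The module at the vertex \<open>v\<close> is the tensor power of the algebra \<open>A = R[X]/(X\<^sup>2 - c X)\<close> over the
  circles of \<open>v\<close>. It has a basis of elements \<open>(v, S)\<close>, where \<open>S\<close> is the set of circles labelled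
  \<open>X\<close>; all others are labelled \<open>1\<close>. A chain is its coefficient function.
\<close>

type_synonym 'r chain = "nat set \<times> nat set set \<Rightarrow> 'r"

definition generators :: "diagram \<Rightarrow> (nat set \<times> nat set set) set" where
  "generators D = {(v, S). v \<subseteq> {..<n_crossings D} \<and> S \<subseteq> circles D v}"

text \<open>
  As \<open>A\<close> is commutative and cocommutative, its structure constants depend only on the number \<open>k\<close>
  of factors \<open>X\<close> in the source and the number \<open>l\<close> of factors \<open>X\<close> in the target:
  \<open>1 \<cdot> 1 = 1\<close>, \<open>1 \<cdot> X = X\<close>, \<open>X \<cdot> X = c X\<close>, and
  \<open>\<Delta> 1 = X \<otimes> 1 + 1 \<otimes> X - c (1 \<otimes> 1)\<close>, \<open>\<Delta> X = X \<otimes> X\<close>.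
\<close>

definition mult_coeff :: "'r::comm_ring_1 \<Rightarrow> nat \<Rightarrow> nat \<Rightarrow> 'r" where
  "mult_coeff c k l =
     (if k \<le> 1 \<and> l = k then 1 else if k = 2 \<and> l = 1 then c else 0)"

definition comult_coeff :: "'r::comm_ring_1 \<Rightarrow> nat \<Rightarrow> nat \<Rightarrow> 'r" where
  "comult_coeff c k l =
     (if l = k + 1 then 1 else if k = 0 \<and> l = 0 then - c else 0)"

text \<open>
  Along an edge of the cube either two circles merge or one circle splits. The circles common to
  both states are exactly the ones not involved, and keep their labels.
\<close>

definition edge_coeff ::
    "'r::comm_ring_1 \<Rightarrow> diagram \<Rightarrow> nat set \<times> nat set set \<Rightarrow> nat set \<times> nat set set \<Rightarrow> 'r" where
  "edge_coeff c D = (\<lambda>(v, S) (w, T).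
     let U = circles D v \<inter> circles D w in
     if S \<inter> U \<noteq> T \<inter> U then 0
     else if card (circles D w) < card (circles D v)
     then mult_coeff c (card (S - U)) (card (T - U))
     else comult_coeff c (card (S - U)) (card (T - U)))"

definition differential :: "'r::comm_ring_1 \<Rightarrow> diagram \<Rightarrow> 'r chain \<Rightarrow> 'r chain" where
  "differential c D x = (\<lambda>(w, T).
     if (w, T) \<in> generators D
     then \<Sum>i\<in>w. (- 1) ^ card {j\<in>w. j < i} *
            (\<Sum>S\<in>Pow (circles D (w - {i})).
               edge_coeff c D (w - {i}, S) (w, T) * x (w - {i}, S))
     else 0)"

text \<open>The ring multiplication and unit of a record of type \<^typ>\<open>('r, 'm) module\<close> play no role.\<close>

definition chain_module :: "diagram \<Rightarrow> ('r::comm_ring_1, 'r chain) module" where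
  "chain_module D =
     \<lparr>carrier = {x. \<forall>g. g \<notin> generators D \<longrightarrow> x g = 0},
      monoid.mult = undefined, monoid.one = undefined,
      ring.zero = (\<lambda>_. 0), ring.add = (\<lambda>x y g. x g + y g),
      module.smult = (\<lambda>r x g. r * x g)\<rparr>"

definition lee_cycle :: "'r::comm_ring_1 \<Rightarrow> diagram \<Rightarrow> 'r chain" where
  "lee_cycle c D = (\<lambda>(v, S).
     if v = seifert_state D \<and> S \<subseteq> seifert_circles D
     then \<Prod>\<gamma>\<in>seifert_circles D.
            if \<gamma> \<in> S then 1 else if colored_a D \<gamma> then 0 else - c
     else 0)"

text \<open>Multiplication by \<open>X\<close> and by \<open>X - c\<close> in the tensor factor of the circle through \<open>p\<close>.\<close>

definition mult_Xa :: "'r::comm_ring_1 \<Rightarrow> diagram \<Rightarrow> nat \<Rightarrow> 'r chain \<Rightarrow> 'r chain" where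
  "mult_Xa c D p x = (\<lambda>(v, S).
     if (v, S) \<in> generators D \<and> circle_of D v p \<in> S
     then x (v, S - {circle_of D v p}) + c * x (v, S)
     else 0)"

definition mult_Xb :: "'r::comm_ring_1 \<Rightarrow> diagram \<Rightarrow> nat \<Rightarrow> 'r chain \<Rightarrow> 'r chain" where
  "mult_Xb c D p x = (\<lambda>g. mult_Xa c D p x g - c * x g)"

definition reduced_chain_module ::
    "'r::comm_ring_1 \<Rightarrow> diagram \<Rightarrow> nat \<Rightarrow> ('r, 'r chain) module" where
  "reduced_chain_module c D p =
     (chain_module D)\<lparr>carrier :=
        (if colored_a D (circle_of D (seifert_state D) p) then mult_Xa c D p else mult_Xb c D p)
          ` carrier (chain_module D)\<rparr>"

section \<open>Homology modulo torsion and divisibility\<close>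

definition quotient_module :: "('r, 'm) module \<Rightarrow> 'm set \<Rightarrow> ('r, 'm set) module" where
  "quotient_module M N =
     \<lparr>carrier = a_rcosets\<^bsub>M\<^esub> N,
      monoid.mult = undefined, monoid.one = undefined,
      ring.zero = N, ring.add = set_add M,
      module.smult = (\<lambda>r A. \<Union>x\<in>A. N +>\<^bsub>M\<^esub> (r \<odot>\<^bsub>M\<^esub> x))\<rparr>"

text \<open>The total homology of an ungraded complex.\<close>

definition homology :: "('r, 'm) module \<Rightarrow> ('m \<Rightarrow> 'm) \<Rightarrow> ('r, 'm set) module" where
  "homology M d =
     quotient_module (M\<lparr>carrier := {x \<in> carrier M. d x = \<zero>\<^bsub>M\<^esub>}\<rparr>) (d ` carrier M)"

definition homology_class :: "('r, 'm) module \<Rightarrow> ('m \<Rightarrow> 'm) \<Rightarrow> 'm \<Rightarrow> 'm set" where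
  "homology_class M d z = (d ` carrier M) +>\<^bsub>M\<^esub> z"

definition torsion :: "('r::zero, 'm) module \<Rightarrow> 'm set" where
  "torsion M = {x \<in> carrier M. \<exists>r. r \<noteq> 0 \<and> r \<odot>\<^bsub>M\<^esub> x = \<zero>\<^bsub>M\<^esub>}"

definition divisibility :: "'r::comm_ring_1 \<Rightarrow> ('r, 'm) module \<Rightarrow> 'm \<Rightarrow> nat" where
  "divisibility c M z = Max {k. z \<in> (\<lambda>x. c ^ k \<odot>\<^bsub>M\<^esub> x) ` carrier M}"

definition divisibility_mod_torsion ::
    "'r::comm_ring_1 \<Rightarrow> ('r, 'm) module \<Rightarrow> 'm \<Rightarrow> nat" where
  "divisibility_mod_torsion c M z =
     divisibility c (quotient_module M (torsion M)) (torsion M +>\<^bsub>M\<^esub> z)"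

definition d_lee :: "'r::comm_ring_1 \<Rightarrow> diagram \<Rightarrow> nat" where
  "d_lee c D =
     divisibility_mod_torsion c
       (homology (chain_module D) (differential c D))
       (homology_class (chain_module D) (differential c D) (lee_cycle c D))"

definition d_lee_reduced :: "'r::comm_ring_1 \<Rightarrow> diagram \<Rightarrow> nat \<Rightarrow> nat" where
  "d_lee_reduced c D p =
     divisibility_mod_torsion c
       (homology (reduced_chain_module c D p) (differential c D))
       (homology_class (reduced_chain_module c D p) (differential c D) (lee_cycle c D))"

text \<open>The invariants of the knot with diagram \<open>D\<close>; the edge \<open>p\<close> carries the marked point.\<close>

definition ss :: "'r::comm_ring_1 \<Rightarrow> diagram \<Rightarrow> int" where
  "ss c D = 2 * int (d_lee c D) + writhe D - int (card (seifert_circles D)) + 1"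

definition ss_reduced :: "'r::comm_ring_1 \<Rightarrow> diagram \<Rightarrow> nat \<Rightarrow> int" where
  "ss_reduced c D p =
     2 * int (d_lee_reduced c D p) + writhe D - int (card (seifert_circles D)) + 1"

end

theory Submission
  imports Defs
begin

text \<open>
  Write \<open>C\<close> for the complex, \<open>\<alpha>\<close> for the Lee cycle and \<open>Y\<close> for multiplication by \<open>X\<^sub>a\<close> or \<open>X\<^sub>b\<close>,
  according to the color of the marked point, so that the reduced complex is \<open>Y C\<close>. Both
  divisibilities are the largest \<open>k\<close> such that \<open>\<alpha>\<close> agrees modulo torsion with \<open>c\<^sup>k y\<close> for a cycle
  \<open>y\<close>, where \<open>y\<close> ranges over \<open>C\<close> or over \<open>Y C\<close>. So it suffices to turn a cycle \<open>y\<close> of \<open>C\<close> with this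
  property into one of \<open>Y C\<close> for the same \<open>k\<close>.

  The tool is the conjugation \<open>J\<close>, the involution \<open>X \<mapsto> c - X\<close> applied to all tensor factors. It respects
  multiplication but changes the sign of the comultiplication, hence it becomes a chain map after a
  sign that counts the splits on the way to a state is put in. It exchanges \<open>Y\<close> with the opposite projection up to sign, so
  \<open>Y J \<alpha> = 0\<close>, while \<open>Y \<alpha> = \<plusminus>c \<alpha>\<close>. If now \<open>\<epsilon> J y - y = c w\<close> for some constant \<open>\<epsilon>\<close>, applying
  \<open>Y (\<epsilon> J - 1)\<close> to \<open>\<alpha> \<approx> c\<^sup>k y\<close> gives \<open>\<mp>c \<alpha> \<approx> c\<^sup>k c Y w\<close>, and cancelling \<open>c\<close> modulo torsion leaves
  \<open>\<alpha> \<approx> c\<^sup>k (\<mp>Y w)\<close> in the reduced complex (\<open>divide_reduced\<close>).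

  So everything depends on whether \<open>J\<close> acts on \<open>y\<close> as a constant modulo \<open>c\<close>. Modulo \<open>c\<close> it sends \<open>X\<close> to
  \<open>-X\<close> and thus acts on generators by signs (\<open>conjugate_mod_c\<close>). If \<open>c\<close> divides \<open>2\<close>, which covers the
  last two of the three conditions, signs are invisible modulo \<open>c\<close>. If \<open>R = F[H]\<close> and \<open>c = H\<close>, the
  parity of the exponent of \<open>H\<close> combines with the signs of the generators to a \<open>\<int>/2\<close>-grading
  of the complex for which \<open>c\<close> has odd degree and \<open>\<alpha>\<close> is homogeneous. Then \<open>y\<close> can be replaced by its component of the
  appropriate parity, and on a homogeneous chain \<open>J\<close> is constant modulo \<open>c\<close> (\<open>homogenize\<close>,
  \<open>parity_component_conjugate\<close>).

  Two preparations make this precise. Planarity enters through Euler's formula, which provides the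
  checkerboard coloring (\<open>checkerboard_exists\<close>). From the coloring it follows that along every edge of
  the cube two circles merge or one splits (\<open>merge_or_split\<close>), and that \<open>\<alpha>\<close> is a cycle. All identities
  between operators on chains are checked after embedding \<open>A\<close> into \<open>R \<times> R\<close> by evaluating \<open>X\<close> at \<open>0\<close> and
  \<open>c\<close>. A chain becomes a function on the two-colorings of the circles of a state. There
  \<open>J\<close> exchanges the two colors up to sign, \<open>Y\<close> multiplies the values by scalars, and so does the differential
  while it carries them along the edges of the cube (\<open>coord_differential\<close>,
  \<open>coord_project\<close>, \<open>coord_conjugate\<close>).
\<close>

section \<open>Classes of a relation\<close>

definition conn :: "('a \<times> 'a) set \<Rightarrow> ('a \<times> 'a) set" where
  "conn r = (r \<union> r\<inverse>)\<^sup>*"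

lemma conn_refl [simp]: "(x, x) \<in> conn r"
  by (simp add: conn_def)

lemma conn_sym: "(x, y) \<in> conn r \<Longrightarrow> (y, x) \<in> conn r"
  unfolding conn_def by (meson sym_Un_converse sym_rtrancl symD)

lemma conn_sym_iff: "(x, y) \<in> conn r \<longleftrightarrow> (y, x) \<in> conn r"
  by (auto intro: conn_sym)

lemma conn_base: "(x, y) \<in> r \<Longrightarrow> (x, y) \<in> conn r"
  by (auto simp: conn_def)

lemma conn_trans: "(x, y) \<in> conn r \<Longrightarrow> (y, z) \<in> conn r \<Longrightarrow> (x, z) \<in> conn r"
  unfolding conn_def by (rule rtrancl_trans)

lemma conn_induct [consumes 1, case_names refl forward backward]:
  assumes "(x, y) \<in> conn r" and "P x"
    and "\<And>y z. (x, y) \<in> conn r \<Longrightarrow> (y, z) \<in> r \<Longrightarrow> P y \<Longrightarrow> P z"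
    and "\<And>y z. (x, y) \<in> conn r \<Longrightarrow> (z, y) \<in> r \<Longrightarrow> P y \<Longrightarrow> P z"
  shows "P y"
  using assms(1) unfolding conn_def
proof (induction rule: rtrancl_induct)
  case (step y z)
  then show ?case using assms(3,4)[of y z] by (auto simp: conn_def)
qed (rule assms(2))

lemma rtrancl_conn: "(x, y) \<in> r\<^sup>* \<Longrightarrow> (x, y) \<in> conn r"
  unfolding conn_def by (rule rtrancl_mono[THEN subsetD, rotated]) auto

lemma conn_invariant:
  assumes "(x, y) \<in> conn r" and "\<And>a b. (a, b) \<in> r \<Longrightarrow> f a = f b"
  shows "f x = f y"
  using assms(1) by (induction rule: conn_induct) (auto dest: assms(2))

lemma conn_closed:
  assumes "(x, y) \<in> conn r" and "x \<in> V" and "r \<subseteq> V \<times> V"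
  shows "y \<in> V"
  using assms(1,2) by (induction rule: conn_induct) (use assms(3) in auto)

lemma conn_class_eq: "conn r `` {x} = conn r `` {y} \<longleftrightarrow> (x, y) \<in> conn r"
proof
  assume "conn r `` {x} = conn r `` {y}"
  moreover have "y \<in> conn r `` {y}" by simp
  ultimately show "(x, y) \<in> conn r" by blast
next
  assume "(x, y) \<in> conn r"
  then show "conn r `` {x} = conn r `` {y}"
    by (auto intro: conn_trans conn_sym)
qed

lemma conn_subset:
  assumes "\<And>x y. (x, y) \<in> q \<Longrightarrow> (x, y) \<in> conn r"
  shows "conn q \<subseteq> conn r"
proof clarify
  fix x y assume "(x, y) \<in> conn q"
  then show "(x, y) \<in> conn r"
    proof (induction rule: conn_induct)
    case (forward y z)
    then show ?case by (meson assms conn_trans)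
  next
    case (backward y z)
    then show ?case by (meson assms conn_sym conn_trans)
  qed simp
qed

lemma mem_components: "\<gamma> \<in> components V r \<longleftrightarrow> (\<exists>x\<in>V. \<gamma> = conn r `` {x})"
  by (auto simp: components_def quotient_def conn_def)

lemma componentsI: "x \<in> V \<Longrightarrow> conn r `` {x} \<in> components V r"
  unfolding mem_components by (rule bexI, rule refl)

lemma componentsE:
  assumes "\<gamma> \<in> components V r"
  obtains x where "x \<in> V" "\<gamma> = conn r `` {x}"
  using assms unfolding mem_components by (elim bexE) (rule that)

lemma components_disjoint:
  assumes "\<gamma> \<in> components V r" "\<gamma>' \<in> components V r" "x \<in> \<gamma>" "x \<in> \<gamma>'"
  shows "\<gamma> = \<gamma>'"
proof -
  obtain u v where "\<gamma> = conn r `` {u}" "\<gamma>' = conn r `` {v}"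
    using assms(1,2) by (auto simp: mem_components)
  moreover from this have "(u, v) \<in> conn r"
    using assms(3,4) by (meson Image_singleton_iff conn_sym conn_trans)
  ultimately show ?thesis by (simp add: conn_class_eq)
qed

lemma components_cong: "conn r = conn q \<Longrightarrow> components V r = components V q"
  by (simp add: components_def conn_def)

text \<open>
  A relation that is functional in both directions consists of directed paths and cycles, so a
  class is a single path or cycle and contains at most one end.
\<close>

lemma conn_bifunctional:
  assumes "single_valued r" "single_valued (r\<inverse>)" "(x, y) \<in> conn r"
  shows "(x, y) \<in> r\<^sup>* \<or> (y, x) \<in> r\<^sup>*"
  using assms(3)
proof (induction rule: conn_induct)
  case (forward y z)
  from forward(3) show ?case
  proof
    assume "(y, x) \<in> r\<^sup>*"
    then show ?thesis
      using forward(2) assms(1) by (cases rule: converse_rtranclE) (auto dest: single_valuedD)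
  qed (use forward(2) in auto)
next
  case (backward y z)
  from backward(3) show ?case
  proof
    assume "(x, y) \<in> r\<^sup>*"
    then show ?thesis
      using backward(2) assms(2) by (cases rule: rtranclE) (auto dest: single_valuedD)
  qed (use backward(2) in \<open>auto intro: converse_rtrancl_into_rtrancl\<close>)
qed simp

lemma sinks_not_connected:
  assumes "single_valued r" "single_valued (r\<inverse>)"
    and "a \<notin> Domain r" "b \<notin> Domain r" "(a, b) \<in> conn r"
  shows "a = b"
  using conn_bifunctional[OF assms(1,2,5)] assms(3,4)
  by (auto elim: converse_rtranclE)

text \<open>
  Walking backwards from a sink has to stop at a source: otherwise the set of points walked
  through would be mapped injectively into itself by the predecessor map, and this map misses the
  sink.
\<close>

lemma sink_has_source:
  assumes fin: "finite V" and r: "r \<subseteq> V \<times> V"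
    and sv: "single_valued r"
    and a: "a \<in> V" "a \<notin> Domain r"
  shows "\<exists>s\<in>V. s \<notin> Range r \<and> (s, a) \<in> conn r"
proof (rule ccontr)
  assume none: "\<not> ?thesis"
  define P where "P = {x. (x, a) \<in> r\<^sup>*}"
  have PV: "P \<subseteq> V"
  proof
    fix x assume "x \<in> P"
    then have "(x, a) \<in> conn r" by (simp add: P_def rtrancl_conn)
    then show "x \<in> V" using conn_closed a(1) r conn_sym by metis
  qed
  then have finP: "finite P" using fin finite_subset by blast
  have "\<exists>y. (y, x) \<in> r" if "x \<in> P" for x
  proof -
    have "(x, a) \<in> conn r"
      using that by (simp add: P_def rtrancl_conn)
    then show ?thesis using none that PV by blast
  qed
  then obtain pre where pre: "\<And>x. x \<in> P \<Longrightarrow> (pre x, x) \<in> r" by metis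
  have "pre ` P \<subseteq> P"
    using pre by (auto simp: P_def intro: converse_rtrancl_into_rtrancl)
  moreover have "inj_on pre P"
    using pre sv by (metis inj_onI single_valuedD)
  ultimately have "pre ` P = P" using finP by (simp add: endo_inj_surj)
  moreover have "a \<in> P" by (simp add: P_def)
  ultimately have "a \<in> pre ` P" by simp
  then obtain x where "x \<in> P" "pre x = a" by (elim imageE) auto
  then show False using pre a(2) by blast
qed

lemma components_joined:
  assumes "a \<in> V" "b \<in> V"
  shows "components V (insert (a, b) r) =
    insert (conn r `` {a} \<union> conn r `` {b}) (components V r - {conn r `` {a}, conn r `` {b}})"
proof -
  let ?q = "insert (a, b) r"
  let ?ab = "conn r `` {a} \<union> conn r `` {b}"
  have le: "(u, v) \<in> conn r \<Longrightarrow> (u, v) \<in> conn ?q" for u v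
    using conn_subset[of r ?q] by (auto intro: conn_base)
  have ab: "(a, b) \<in> conn ?q" by (auto intro: conn_base)
  have mem_ab: "u \<in> ?ab \<longleftrightarrow> (a, u) \<in> conn r \<or> (b, u) \<in> conn r" for u by simp
  have stay: "u \<in> ?ab \<longleftrightarrow> v \<in> ?ab" and leave: "u \<notin> ?ab \<Longrightarrow> (u, v) \<in> conn r"
    if "(u, v) \<in> ?q" for u v
  proof -
    have "(u, v) = (a, b) \<or> (u, v) \<in> conn r"
      using that by (auto intro: conn_base)
    then show "u \<in> ?ab \<longleftrightarrow> v \<in> ?ab" "u \<notin> ?ab \<Longrightarrow> (u, v) \<in> conn r"
      unfolding mem_ab by (metis conn_refl conn_sym conn_trans prod.inject)+
  qed
  have inside: "conn ?q `` {u} = ?ab" if u: "u \<in> ?ab" for u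
  proof
    show "conn ?q `` {u} \<subseteq> ?ab"
    proof
      fix v assume "v \<in> conn ?q `` {u}"
      then have "(u, v) \<in> conn ?q" by blast
      from conn_invariant[OF this, of "\<lambda>z. z \<in> ?ab"] stay u
      show "v \<in> ?ab" by blast
    qed
    have "(a, u) \<in> conn ?q" using u le ab unfolding mem_ab by (blast intro: conn_trans)
    then have "(u, a) \<in> conn ?q" "(u, b) \<in> conn ?q" using ab by (meson conn_trans conn_sym)+
    then show "?ab \<subseteq> conn ?q `` {u}" using le by (blast intro: conn_trans)
  qed
  have outside: "conn ?q `` {u} = conn r `` {u}" if u: "u \<notin> ?ab" for u
  proof
    have "(u, v) \<in> conn r \<and> v \<notin> ?ab" if "(u, v) \<in> conn ?q" for v
      using that
    proof (induction rule: conn_induct)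
      case (forward y z)
      then show ?case using stay leave by (meson conn_trans)
    next
      case (backward y z)
      then show ?case using stay leave by (meson conn_trans conn_sym)
    qed (use u in auto)
    then show "conn ?q `` {u} \<subseteq> conn r `` {u}" by blast
  qed (use le in auto)
  have cls: "u \<in> ?ab \<longleftrightarrow> conn r `` {u} = conn r `` {a} \<or> conn r `` {u} = conn r `` {b}" for u
    unfolding conn_class_eq mem_ab by (simp add: conn_sym_iff)
  show ?thesis
  proof (intro equalityI subsetI)
    fix \<gamma> assume "\<gamma> \<in> components V ?q"
    then obtain u where "u \<in> V" "\<gamma> = conn ?q `` {u}" by (auto simp: mem_components)
    then show "\<gamma> \<in> insert ?ab (components V r - {conn r `` {a}, conn r `` {b}})"
      using inside[of u] outside[of u] cls[of u] by (cases "u \<in> ?ab") (auto simp: mem_components)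
  next
    fix \<gamma> assume "\<gamma> \<in> insert ?ab (components V r - {conn r `` {a}, conn r `` {b}})"
    then consider "\<gamma> = ?ab" | "\<gamma> \<in> components V r" "\<gamma> \<noteq> conn r `` {a}" "\<gamma> \<noteq> conn r `` {b}" by auto
    then show "\<gamma> \<in> components V ?q"
    proof cases
      case 1
      then show ?thesis using inside[of a] assms(1) by (auto simp: mem_components)
    next
      case 2
      then obtain u where "u \<in> V" "\<gamma> = conn r `` {u}" by (auto simp: mem_components)
      then show ?thesis using outside[of u] cls[of u] 2 by (auto simp: mem_components)
    qed
  qed
qed

section \<open>The checkerboard coloring\<close>

lemma Union_components_invariant:
  assumes "F \<subseteq> components V r" "(x, y) \<in> conn r"
  shows "x \<in> \<Union>F \<longleftrightarrow> y \<in> \<Union>F"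
proof -
  have "y \<in> \<Union>F" if xF: "x \<in> \<Union>F" and xy: "(x, y) \<in> conn r" for x y
  proof -
    obtain \<gamma> where \<gamma>: "\<gamma> \<in> F" "x \<in> \<gamma>" using xF by blast
    then have "\<gamma> \<in> components V r" using assms(1) by auto
    then obtain u where u: "\<gamma> = conn r `` {u}" by (rule componentsE)
    then have "y \<in> \<gamma>" using \<gamma>(2) conn_trans[of u x r y] xy by simp
    then show ?thesis using \<gamma>(1) by blast
  qed
  then show ?thesis using assms(2) conn_sym by metis
qed

lemma ends_in_edges:
  assumes "knot_diagram D" "x \<in> set (crossings D)"
  shows "in_left x \<in> edges D" "in_right x \<in> edges D"
    "out_left x \<in> edges D" "out_right x \<in> edges D"
proof -
  have "in_left x \<in> set (in_ends D)" "in_right x \<in> set (in_ends D)"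
    "out_left x \<in> set (out_ends D)" "out_right x \<in> set (out_ends D)"
    using assms(2) by (auto simp: in_ends_def out_ends_def)
  then show "in_left x \<in> edges D" "in_right x \<in> edges D"
    "out_left x \<in> edges D" "out_right x \<in> edges D"
    using assms(1) by (auto simp: knot_diagram_def)
qed

lemma strand_connected:
  assumes "knot_diagram D" "e \<in> edges D" "e' \<in> edges D"
  shows "(e, e') \<in> conn (strand_rel D)"
proof -
  have "card (components (edges D) (strand_rel D)) = 1"
    using assms(1) by (simp add: knot_diagram_def)
  then obtain A where "components (edges D) (strand_rel D) = {A}"
    by (auto simp: card_1_singleton_iff)
  moreover have "conn (strand_rel D) `` {e} \<in> components (edges D) (strand_rel D)"
    "conn (strand_rel D) `` {e'} \<in> components (edges D) (strand_rel D)"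
    using assms by (simp_all add: componentsI)
  ultimately have "conn (strand_rel D) `` {e} = conn (strand_rel D) `` {e'}" by auto
  then show ?thesis by (simp add: conn_class_eq)
qed

definition boundary :: "diagram \<Rightarrow> (nat \<times> side) set set \<Rightarrow> nat set" where
  "boundary D F = {e \<in> edges D. ((e, LeftSide) \<in> \<Union>F) \<noteq> ((e, RightSide) \<in> \<Union>F)}"

text \<open>
  The cycles modulo 2 of the diagram as a graph: an even number of the four ends at each crossing
  belongs to \<open>z\<close>.
\<close>

definition mod2_cycles :: "diagram \<Rightarrow> nat set set" where
  "mod2_cycles D = {z. z \<subseteq> edges D \<and> (\<forall>x\<in>set (crossings D).
     (in_left x \<in> z \<longleftrightarrow> out_right x \<in> z) \<longleftrightarrow> (in_right x \<in> z \<longleftrightarrow> out_left x \<in> z))}"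

lemma corners_invariant:
  assumes "F \<subseteq> faces D" "x \<in> set (crossings D)"
  shows "(in_left x, LeftSide) \<in> \<Union>F \<longleftrightarrow> (out_left x, LeftSide) \<in> \<Union>F"
    "(in_right x, RightSide) \<in> \<Union>F \<longleftrightarrow> (out_right x, RightSide) \<in> \<Union>F"
    "(in_left x, RightSide) \<in> \<Union>F \<longleftrightarrow> (in_right x, LeftSide) \<in> \<Union>F"
    "(out_left x, RightSide) \<in> \<Union>F \<longleftrightarrow> (out_right x, LeftSide) \<in> \<Union>F"
proof -
  have "s \<in> \<Union>F \<longleftrightarrow> t \<in> \<Union>F" if "(s, t) \<in> corner_rel D" for s t
    by (rule Union_components_invariant[OF assms(1)[unfolded faces_def] conn_base[OF that]])
  then show "(in_left x, LeftSide) \<in> \<Union>F \<longleftrightarrow> (out_left x, LeftSide) \<in> \<Union>F"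
    "(in_right x, RightSide) \<in> \<Union>F \<longleftrightarrow> (out_right x, RightSide) \<in> \<Union>F"
    "(in_left x, RightSide) \<in> \<Union>F \<longleftrightarrow> (in_right x, LeftSide) \<in> \<Union>F"
    "(out_left x, RightSide) \<in> \<Union>F \<longleftrightarrow> (out_right x, LeftSide) \<in> \<Union>F"
    using assms(2) unfolding corner_rel_def by blast+
qed

lemma boundary_in_cycles:
  assumes "knot_diagram D" "F \<subseteq> faces D"
  shows "boundary D F \<in> mod2_cycles D"
proof -
  have "(in_left x \<in> boundary D F \<longleftrightarrow> out_right x \<in> boundary D F) \<longleftrightarrow>
      (in_right x \<in> boundary D F \<longleftrightarrow> out_left x \<in> boundary D F)"
    if "x \<in> set (crossings D)" for x
    unfolding boundary_def mem_Collect_eq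
    using corners_invariant[OF assms(2) that] ends_in_edges[OF assms(1) that] by argo
  then show ?thesis by (auto simp: mod2_cycles_def boundary_def)
qed

text \<open>
  Following the knot, a cycle is determined by its value on one edge and by whether it jumps at each
  passage through a crossing. The cycle condition says that the jumps of the two strands at a crossing
  agree, so there is one free bit per crossing. Here it matters that there is only one component.
\<close>

lemma card_mod2_cycles:
  assumes "knot_diagram D"
  shows "card (mod2_cycles D) \<le> 2 * 2 ^ n_crossings D"
proof -
  let ?n = "n_crossings D"
  define e0 where "e0 = fst (outer D)"
  have e0: "e0 \<in> edges D" using assms by (simp add: e0_def knot_diagram_def)
  define \<rho> where "\<rho> z = (e0 \<in> z, {i. i < ?n \<and>
    (in_left (crossings D ! i) \<in> z) \<noteq> (out_right (crossings D ! i) \<in> z)})" for z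
  have "inj_on \<rho> (mod2_cycles D)"
  proof (rule inj_onI)
    fix z z' assume z: "z \<in> mod2_cycles D" "z' \<in> mod2_cycles D" "\<rho> z = \<rho> z'"
    have jump: "(in_left x \<in> z \<longleftrightarrow> out_right x \<in> z) \<longleftrightarrow> (in_left x \<in> z' \<longleftrightarrow> out_right x \<in> z')"
      if "x \<in> set (crossings D)" for x
      using that z(3) by (auto simp: \<rho>_def in_set_conv_nth)
    have "(e \<in> z) = (e \<in> z')" if "e \<in> edges D" for e
    proof -
      have "((e0 \<in> z) = (e0 \<in> z')) = ((e \<in> z) = (e \<in> z'))"
      proof (rule conn_invariant[OF strand_connected[OF assms e0 that]])
        fix a b assume "(a, b) \<in> strand_rel D"
        then obtain x where x: "x \<in> set (crossings D)"
          and ab: "(a, b) = (in_left x, out_right x) \<or> (a, b) = (in_right x, out_left x)"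
          by (auto simp: strand_rel_def)
        show "((a \<in> z) = (a \<in> z')) = ((b \<in> z) = (b \<in> z'))"
          using jump[OF x] z(1,2) x ab unfolding mod2_cycles_def by blast
      qed
      then show ?thesis using z(3) by (simp add: \<rho>_def)
    qed
    then show "z = z'" using z(1,2) by (auto simp: mod2_cycles_def)
  qed
  moreover have "\<rho> ` mod2_cycles D \<subseteq> UNIV \<times> Pow {..<?n}" by (auto simp: \<rho>_def)
  ultimately have "card (mod2_cycles D) \<le> card ((UNIV :: bool set) \<times> Pow {..<?n})"
    by (intro card_inj_on_le) auto
  then show ?thesis by (simp add: card_cartesian_product card_Pow)
qed

text \<open>
  Two sets of faces with the same boundary differ, as indicator functions, by a function that is
  constant across every edge, hence everywhere. Leaving out the face \<open>A\<close> fixes this constant.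
\<close>

lemma inj_on_boundary:
  assumes "knot_diagram D" "A \<in> faces D"
  shows "inj_on (boundary D) (Pow (faces D - {A}))"
proof (rule inj_onI)
  fix F F' assume F: "F \<in> Pow (faces D - {A})" "F' \<in> Pow (faces D - {A})"
    and eq: "boundary D F = boundary D F'"
  have FF: "F \<subseteq> faces D" "F' \<subseteq> faces D" using F by auto
  define h where "h s \<longleftrightarrow> (s \<in> \<Union>F \<longleftrightarrow> s \<in> \<Union>F')" for s
  have LR: "h (e, LeftSide) \<longleftrightarrow> h (e, RightSide)" if "e \<in> edges D" for e
    using eq that unfolding boundary_def h_def by blast
  have corner: "h (in_left x, LeftSide) \<longleftrightarrow> h (out_left x, LeftSide)"
    "h (in_right x, RightSide) \<longleftrightarrow> h (out_right x, RightSide)"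
    "h (in_left x, RightSide) \<longleftrightarrow> h (in_right x, LeftSide)" if "x \<in> set (crossings D)" for x
    unfolding h_def using corners_invariant[OF FF(1) that] corners_invariant[OF FF(2) that]
    by (simp_all only:)
  obtain e0 \<sigma>0 where A0: "e0 \<in> edges D" "A = conn (corner_rel D) `` {(e0, \<sigma>0)}"
    using assms(2) by (auto simp: faces_def mem_components)
  then have A: "(e0, \<sigma>0) \<in> A" "e0 \<in> edges D" by simp_all
  have "(e0, \<sigma>0) \<notin> \<Union>G" if "G \<subseteq> faces D - {A}" for G
    using that assms(2) components_disjoint[OF _ _ A(1)] unfolding faces_def by blast
  then have h0: "h (e0, \<sigma>0)" using F by (simp add: h_def)
  have h: "h (e, \<sigma>)" if "e \<in> edges D" for e \<sigma>
  proof -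
    have "h (e0, LeftSide) = h (e, LeftSide)"
    proof (rule conn_invariant[OF strand_connected[OF assms(1) A(2) that]])
      fix a b assume "(a, b) \<in> strand_rel D"
      then obtain x where x: "x \<in> set (crossings D)"
        and "(a, b) = (in_left x, out_right x) \<or> (a, b) = (in_right x, out_left x)"
        by (auto simp: strand_rel_def)
      then show "h (a, LeftSide) = h (b, LeftSide)"
        using corner[OF x] LR ends_in_edges[OF assms(1) x] by auto
    qed
    then show ?thesis using LR[OF that] LR[OF A(2)] h0 by (cases \<sigma>; cases \<sigma>0) auto
  qed
  have sub: "\<gamma> \<in> G'" if G: "\<gamma> \<in> G" "G \<subseteq> faces D" "G' \<subseteq> faces D"
    and GG': "\<And>e \<sigma>. e \<in> edges D \<Longrightarrow> (e, \<sigma>) \<in> \<Union>G \<Longrightarrow> (e, \<sigma>) \<in> \<Union>G'" for \<gamma> G G'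
  proof -
    have "\<gamma> \<in> faces D" using G(1,2) by auto
    then obtain e \<sigma> where "e \<in> edges D" "\<gamma> = conn (corner_rel D) `` {(e, \<sigma>)}"
      by (auto simp: faces_def mem_components)
    then have e: "(e, \<sigma>) \<in> \<gamma>" "e \<in> edges D" by simp_all
    then have "(e, \<sigma>) \<in> \<Union>G'" using GG' G(1) by blast
    then obtain \<gamma>' where \<gamma>': "\<gamma>' \<in> G'" "(e, \<sigma>) \<in> \<gamma>'" by blast
    then have "\<gamma> = \<gamma>'"
      using components_disjoint[OF _ _ e(1) \<gamma>'(2)] \<open>\<gamma> \<in> faces D\<close> G(3) unfolding faces_def by blast
    then show ?thesis using \<gamma>'(1) by simp
  qed
  have "(e, \<sigma>) \<in> \<Union>F \<longleftrightarrow> (e, \<sigma>) \<in> \<Union>F'" if "e \<in> edges D" for e \<sigma>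
    using h[OF that] unfolding h_def .
  then show "F = F'"
    using sub[OF _ FF] sub[OF _ FF(2,1)] by blast
qed

text \<open>
  This is the mod 2 homology of the sphere in the form of a count. With \<open>n\<close> crossings and \<open>n + 2\<close> faces
  there are \<open>2\<^bsup>n+1\<^esup>\<close> sets of faces avoiding a given one, with pairwise different boundaries, and at
  most \<open>2\<^bsup>n+1\<^esup>\<close> cycles. So each cycle is a boundary, in particular the set of all edges, which says that
  some set of faces lies on exactly one side of each edge. The resulting coloring of the faces also
  respects the channels of the Seifert resolution, since the south and the north corner are both
  adjacent to the west corner.
\<close>

lemma checkerboard_exists:
  assumes "knot_diagram D"
  shows "\<exists>f. checkerboard D f"
proof -
  let ?n = "n_crossings D"
  have card: "card (faces D) = ?n + 2" using assms by (simp add: knot_diagram_def)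
  then have fin: "finite (faces D)" and "faces D \<noteq> {}" by (auto intro: card_ge_0_finite)
  then obtain A where A: "A \<in> faces D" by blast
  have "boundary D ` Pow (faces D - {A}) = mod2_cycles D"
  proof (rule card_seteq)
    have "mod2_cycles D \<subseteq> Pow (edges D)" by (auto simp: mod2_cycles_def)
    then show "finite (mod2_cycles D)"
      using assms by (auto simp: knot_diagram_def intro: finite_subset)
    show "boundary D ` Pow (faces D - {A}) \<subseteq> mod2_cycles D"
      using boundary_in_cycles[OF assms] by auto
    have "card (boundary D ` Pow (faces D - {A})) = 2 * 2 ^ ?n"
      using card fin A by (simp add: card_image[OF inj_on_boundary[OF assms A]] card_Pow)
    then show "card (mod2_cycles D) \<le> card (boundary D ` Pow (faces D - {A}))"
      using card_mod2_cycles[OF assms] by simp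
  qed
  moreover have "edges D \<in> mod2_cycles D"
    using ends_in_edges[OF assms] by (simp add: mod2_cycles_def)
  ultimately have "edges D \<in> boundary D ` Pow (faces D - {A})" by simp
  then obtain F where F: "F \<subseteq> faces D" "boundary D F = edges D"
    by (elim imageE) auto
  define f where "f s \<longleftrightarrow> (s \<in> \<Union>F) \<noteq> (outer D \<in> \<Union>F)" for s
  have flip: "f (e, LeftSide) \<noteq> f (e, RightSide)" if "e \<in> edges D" for e
    using F(2) that by (auto simp: boundary_def f_def)
  have "f s = f t" if "(s, t) \<in> corner_rel D \<union> channel_rel D" for s t
    using that
  proof
    assume "(s, t) \<in> corner_rel D"
    then have "s \<in> \<Union>F \<longleftrightarrow> t \<in> \<Union>F"
      by (intro Union_components_invariant[OF F(1)[unfolded faces_def]] conn_base)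
    then show ?thesis by (simp add: f_def)
  next
    assume "(s, t) \<in> channel_rel D"
    then obtain x where x: "x \<in> set (crossings D)"
      and st: "s = (in_left x, RightSide)" "t = (out_left x, RightSide)"
      by (auto simp: channel_rel_def)
    show ?thesis
      using flip[OF ends_in_edges(1)[OF assms x]] flip[OF ends_in_edges(3)[OF assms x]]
        corners_invariant(1)[OF F(1) x] st by (auto simp: f_def)
  qed
  then have region: "f s = f t" if "(s, t) \<in> conn (corner_rel D \<union> channel_rel D)" for s t
    by (rule conn_invariant[OF that])
  have const: "f s = f t" if B: "B \<in> seifert_regions D" "s \<in> B" "t \<in> B" for B s t
  proof -
    obtain u where "B = conn (corner_rel D \<union> channel_rel D) `` {u}"
      using B(1) unfolding seifert_regions_def by (rule componentsE)
    then show ?thesis using region[of u s] region[of u t] B(2,3) by simp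
  qed
  have "\<not> f (outer D)" by (simp add: f_def)
  then have "checkerboard D f" unfolding checkerboard_def using const flip by blast
  then show ?thesis by blast
qed

abbreviation black_left :: "diagram \<Rightarrow> nat \<Rightarrow> bool" where
  "black_left D e \<equiv> black D (e, LeftSide)"

text \<open>
  The coloring is constant along a Seifert circle, and the two Seifert arcs at a crossing have opposite colors.
\<close>

lemma black_left_crossing:
  assumes "knot_diagram D" "x \<in> set (crossings D)"
  shows "black_left D (out_left x) = black_left D (in_left x)"
    "black_left D (in_right x) = (\<not> black_left D (in_left x))"
    "black_left D (out_right x) = (\<not> black_left D (in_left x))"
proof -
  have ch: "checkerboard D (black D)"
    unfolding black_def by (rule someI_ex[OF checkerboard_exists[OF assms(1)]])
  have eq: "black D (e, \<sigma>) = black D t"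
    if "e \<in> edges D" "((e, \<sigma>), t) \<in> corner_rel D \<union> channel_rel D" for e \<sigma> t
  proof -
    let ?A = "conn (corner_rel D \<union> channel_rel D) `` {(e, \<sigma>)}"
    have "?A \<in> seifert_regions D" using that(1) by (simp add: seifert_regions_def componentsI)
    moreover have "(e, \<sigma>) \<in> ?A" "t \<in> ?A" using conn_base[OF that(2)] by simp_all
    ultimately show ?thesis using ch unfolding checkerboard_def by metis
  qed
  note E = ends_in_edges[OF assms]
  have flip: "black D (e, RightSide) = (\<not> black_left D e)" if "e \<in> edges D" for e
    using ch that unfolding checkerboard_def by auto
  have "black_left D (in_left x) = black_left D (out_left x)"
    "black D (in_right x, RightSide) = black D (out_right x, RightSide)"
    "black D (in_left x, RightSide) = black_left D (in_right x)"
    using assms(2) by (intro eq E; force simp: corner_rel_def)+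
  then show "black_left D (out_left x) = black_left D (in_left x)"
    "black_left D (in_right x) = (\<not> black_left D (in_left x))"
    "black_left D (out_right x) = (\<not> black_left D (in_left x))"
    using flip E by auto
qed

section \<open>Adjacent states differ by one merge or split\<close>

lemma distinct_ends:
  assumes "distinct (concat (map (\<lambda>x. [f x, g x]) xs))" "i < length xs" "j < length xs"
  shows "f (xs ! i) \<noteq> g (xs ! j)"
    and "f (xs ! i) = f (xs ! j) \<Longrightarrow> i = j"
    and "g (xs ! i) = g (xs ! j) \<Longrightarrow> i = j"
proof -
  have "f (xs ! i) \<noteq> g (xs ! j) \<and> (f (xs ! i) = f (xs ! j) \<longrightarrow> i = j) \<and>
      (g (xs ! i) = g (xs ! j) \<longrightarrow> i = j)"
    using assms
  proof (induction xs arbitrary: i j)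
    case (Cons x xs)
    have nin: "f x \<noteq> f (xs ! k)" "g x \<noteq> g (xs ! k)" "f x \<noteq> g (xs ! k)" "f (xs ! k) \<noteq> g x"
      if "k < length xs" for k
      using Cons.prems(1) nth_mem[OF that] by fastforce+
    have "f x \<noteq> g x" using Cons.prems(1) by simp
    then show ?case
      using Cons.prems nin[THEN not_sym, of "i - 1"] nin[of "i - 1"] nin[of "j - 1"] Cons.IH[of "i - 1" "j - 1"]
        nin(1,2)[THEN not_sym, of "j - 1"]
      by (cases i; cases j) auto
  qed simp
  then show "f (xs ! i) \<noteq> g (xs ! j)"
    "f (xs ! i) = f (xs ! j) \<Longrightarrow> i = j" "g (xs ! i) = g (xs ! j) \<Longrightarrow> i = j" by auto
qed

definition merges_to :: "'a set set \<Rightarrow> 'a set set \<Rightarrow> bool" where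
  "merges_to P P' \<longleftrightarrow>
     (\<exists>\<gamma>1\<in>P. \<exists>\<gamma>2\<in>P. \<gamma>1 \<noteq> \<gamma>2 \<and> P' = insert (\<gamma>1 \<union> \<gamma>2) (P - {\<gamma>1, \<gamma>2}))"

text \<open>
  Restricting to a set \<open>I\<close> of crossings leaves the other crossings unresolved; their ends are then the
  ends of open arcs.
\<close>

definition resolutions :: "diagram \<Rightarrow> nat set \<Rightarrow> nat set \<Rightarrow> (nat \<times> nat) set" where
  "resolutions D I v = (\<Union>i\<in>I. resolution (crossings D ! i) (i \<in> v))"

lemma circles_conv: "circles D v = components (edges D) (resolutions D {..<n_crossings D} v)"
  by (simp add: circles_def resolutions_def)

text \<open>
  Orient every edge so that black lies on its left. Around a crossing the oriented edges alternately
  point towards it and away from it, so both resolutions join an incoming to an outgoing edge.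
\<close>

definition directed_resolution :: "diagram \<Rightarrow> crossing \<Rightarrow> bool \<Rightarrow> (nat \<times> nat) set" where
  "directed_resolution D x b =
     (if is_positive x \<noteq> b
      then if black_left D (in_left x)
        then {(in_left x, out_left x), (out_right x, in_right x)}
        else {(out_left x, in_left x), (in_right x, out_right x)}
      else if black_left D (in_left x)
        then {(in_left x, in_right x), (out_right x, out_left x)}
        else {(in_right x, in_left x), (out_left x, out_right x)})"

lemma directed_resolution_sym:
  "directed_resolution D x b \<union> (directed_resolution D x b)\<inverse> = resolution x b \<union> (resolution x b)\<inverse>"
  by (auto simp: directed_resolution_def resolution_def)

definition incoming :: "diagram \<Rightarrow> crossing \<Rightarrow> nat set" where
  "incoming D x = (if black_left D (in_left x) then {in_left x, out_right x} else {out_left x, in_right x})"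

definition outgoing :: "diagram \<Rightarrow> crossing \<Rightarrow> nat set" where
  "outgoing D x = (if black_left D (in_left x) then {out_left x, in_right x} else {in_left x, out_right x})"

context
  fixes D :: diagram
  assumes knot: "knot_diagram D"
begin

lemma in_ends_distinct:
  assumes "i < n_crossings D" "j < n_crossings D"
  shows "in_left (crossings D ! i) \<noteq> in_right (crossings D ! j)"
    "in_left (crossings D ! i) = in_left (crossings D ! j) \<Longrightarrow> i = j"
    "in_right (crossings D ! i) = in_right (crossings D ! j) \<Longrightarrow> i = j"
    "out_left (crossings D ! i) \<noteq> out_right (crossings D ! j)"
    "out_left (crossings D ! i) = out_left (crossings D ! j) \<Longrightarrow> i = j"
    "out_right (crossings D ! i) = out_right (crossings D ! j) \<Longrightarrow> i = j"
proof -
  have "distinct (concat (map (\<lambda>x. [in_left x, in_right x]) (crossings D)))"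
    "distinct (concat (map (\<lambda>x. [out_left x, out_right x]) (crossings D)))"
    using knot by (simp_all add: knot_diagram_def in_ends_def out_ends_def)
  note this[THEN distinct_ends(1), OF assms] this[THEN distinct_ends(2), OF assms]
    this[THEN distinct_ends(3), OF assms]
  then show "in_left (crossings D ! i) \<noteq> in_right (crossings D ! j)"
    "in_left (crossings D ! i) = in_left (crossings D ! j) \<Longrightarrow> i = j"
    "in_right (crossings D ! i) = in_right (crossings D ! j) \<Longrightarrow> i = j"
    "out_left (crossings D ! i) \<noteq> out_right (crossings D ! j)"
    "out_left (crossings D ! i) = out_left (crossings D ! j) \<Longrightarrow> i = j"
    "out_right (crossings D ! i) = out_right (crossings D ! j) \<Longrightarrow> i = j" by blast+
qed

lemma incoming_unique:
  assumes "i < n_crossings D" "j < n_crossings D"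
    and "e \<in> incoming D (crossings D ! i)" "e \<in> incoming D (crossings D ! j)"
  shows "i = j"
  using assms(3,4) in_ends_distinct[OF assms(1,2)] in_ends_distinct[OF assms(2,1)]
    black_left_crossing[OF knot nth_mem[OF assms(1)]]
    black_left_crossing[OF knot nth_mem[OF assms(2)]]
  unfolding incoming_def by (auto split: if_splits)

lemma outgoing_unique:
  assumes "i < n_crossings D" "j < n_crossings D"
    and "e \<in> outgoing D (crossings D ! i)" "e \<in> outgoing D (crossings D ! j)"
  shows "i = j"
  using assms(3,4) in_ends_distinct[OF assms(1,2)] in_ends_distinct[OF assms(2,1)]
    black_left_crossing[OF knot nth_mem[OF assms(1)]]
    black_left_crossing[OF knot nth_mem[OF assms(2)]]
  unfolding outgoing_def by (auto split: if_splits)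

lemma directed_resolution_props:
  assumes "i < n_crossings D"
  defines "x \<equiv> crossings D ! i"
  shows "Domain (directed_resolution D x b) = incoming D x"
    "Range (directed_resolution D x b) = outgoing D x"
    "single_valued (directed_resolution D x b)"
    "single_valued ((directed_resolution D x b)\<inverse>)"
proof -
  note bl = black_left_crossing[OF knot nth_mem[OF assms(1)], folded x_def]
  note ne = in_ends_distinct[OF assms(1,1), folded x_def]
  have neq: "in_left x \<noteq> out_right x" "in_right x \<noteq> out_left x" using bl by metis+
  show "Domain (directed_resolution D x b) = incoming D x"
    "Range (directed_resolution D x b) = outgoing D x"
    by (auto simp: directed_resolution_def incoming_def outgoing_def)
  show "single_valued (directed_resolution D x b)"
    "single_valued ((directed_resolution D x b)\<inverse>)"
    using ne(1,4) neq by (auto simp: directed_resolution_def single_valued_def split: if_splits)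
qed

lemma set_in_ends_conv:
  "set (in_ends D) = (\<Union>i<n_crossings D. {in_left (crossings D ! i), in_right (crossings D ! i)})"
  "set (out_ends D) = (\<Union>i<n_crossings D. {out_left (crossings D ! i), out_right (crossings D ! i)})"
proof -
  have "set (crossings D) = (!) (crossings D) ` {..<n_crossings D}"
    by (auto simp: set_conv_nth)
  then show "set (in_ends D) = (\<Union>i<n_crossings D. {in_left (crossings D ! i), in_right (crossings D ! i)})"
    "set (out_ends D) = (\<Union>i<n_crossings D. {out_left (crossings D ! i), out_right (crossings D ! i)})"
    by (simp_all add: in_ends_def out_ends_def)
qed

lemma ends_eq: "set (in_ends D) = set (out_ends D)"
  using knot by (simp add: knot_diagram_def)

lemma outgoing_exists:
  assumes "e \<in> set (in_ends D)"
  shows "\<exists>i<n_crossings D. e \<in> outgoing D (crossings D ! i)"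
proof (cases "black_left D e")
  case True
  have "e \<in> set (out_ends D)" using assms ends_eq by simp
  then obtain i where "i < n_crossings D" "e \<in> {out_left (crossings D ! i), out_right (crossings D ! i)}"
    unfolding set_in_ends_conv by blast
  then show ?thesis
    using True black_left_crossing[OF knot nth_mem] unfolding outgoing_def by (intro exI[of _ i]) auto
next
  case False
  obtain i where "i < n_crossings D" "e \<in> {in_left (crossings D ! i), in_right (crossings D ! i)}"
    using assms unfolding set_in_ends_conv by blast
  then show ?thesis
    using False black_left_crossing[OF knot nth_mem] unfolding outgoing_def by (intro exI[of _ i]) auto
qed

text \<open>
  Remove the crossing \<open>k\<close>. What remains of the circles are closed circles and two arcs. Since no
  arc can have both its ends at incoming edges of \<open>k\<close>, the arcs pair the four ends at \<open>k\<close> in one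
  of two ways, and they are different arcs.
\<close>

lemma arcs_pair_ends:
  fixes v :: "nat set"
  assumes k: "k < n_crossings D"
  defines "x \<equiv> crossings D ! k"
    and "r \<equiv> resolutions D ({..<n_crossings D} - {k}) v"
  shows "(in_left x, out_left x) \<in> conn r \<and> (in_right x, out_right x) \<in> conn r \<and>
      (in_left x, in_right x) \<notin> conn r \<or>
    (in_left x, in_right x) \<in> conn r \<and> (out_left x, out_right x) \<in> conn r \<and>
      (in_left x, out_left x) \<notin> conn r"
proof -
  let ?I = "{..<n_crossings D} - {k}" and ?V = "set (in_ends D)"
  define q where "q = (\<Union>i\<in>?I. directed_resolution D (crossings D ! i) (i \<in> v))"
  have "q \<union> q\<inverse> = (\<Union>i\<in>?I. directed_resolution D (crossings D ! i) (i \<in> v) \<union>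
      (directed_resolution D (crossings D ! i) (i \<in> v))\<inverse>)" by (auto simp: q_def)
  also have "\<dots> = r \<union> r\<inverse>" unfolding directed_resolution_sym by (auto simp: r_def resolutions_def)
  finally have conn_eq: "conn r = conn q" by (simp add: conn_def)
  have sv: "single_valued q"
    unfolding single_valued_def
  proof (intro allI impI)
    fix e f f' assume "(e, f) \<in> q" "(e, f') \<in> q"
    then obtain i j where ij: "i < n_crossings D" "j < n_crossings D"
      and ef: "(e, f) \<in> directed_resolution D (crossings D ! i) (i \<in> v)"
      and ef': "(e, f') \<in> directed_resolution D (crossings D ! j) (j \<in> v)"
      unfolding q_def by blast
    have "i = j"
      using incoming_unique[OF ij, of e] directed_resolution_props(1)[OF ij(1)]
        directed_resolution_props(1)[OF ij(2)] ef ef' by blast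
    then show "f = f'" using directed_resolution_props(3)[OF ij(1)] ef ef' by (auto dest: single_valuedD)
  qed
  have svc: "single_valued (q\<inverse>)"
    unfolding single_valued_def
  proof (intro allI impI)
    fix e f f' assume "(e, f) \<in> q\<inverse>" "(e, f') \<in> q\<inverse>"
    then obtain i j where ij: "i < n_crossings D" "j < n_crossings D"
      and ef: "(f, e) \<in> directed_resolution D (crossings D ! i) (i \<in> v)"
      and ef': "(f', e) \<in> directed_resolution D (crossings D ! j) (j \<in> v)"
      unfolding q_def by blast
    have "i = j"
      using outgoing_unique[OF ij, of e] directed_resolution_props(2)[OF ij(1)]
        directed_resolution_props(2)[OF ij(2)] ef ef' by blast
    then show "f = f'" using directed_resolution_props(4)[OF ij(1)] ef ef' by (auto dest: single_valuedD)
  qed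
  have ends: "{in_left y, in_right y, out_left y, out_right y} \<subseteq> ?V"
    if "i < n_crossings D" "y = crossings D ! i" for i y
    using that set_in_ends_conv ends_eq by blast
  have qV: "q \<subseteq> ?V \<times> ?V"
  proof -
    have "directed_resolution D y b \<subseteq> ?V \<times> ?V" if "i < n_crossings D" "y = crossings D ! i" for i y b
      using ends[OF that] by (auto simp: directed_resolution_def)
    then show ?thesis unfolding q_def by blast
  qed
  have sink: "a \<notin> Domain q" if "a \<in> incoming D x" for a
  proof
    assume "a \<in> Domain q"
    then obtain i where i: "i \<in> ?I" "a \<in> Domain (directed_resolution D (crossings D ! i) (i \<in> v))"
      unfolding q_def by blast
    then have "a \<in> incoming D (crossings D ! i)" using directed_resolution_props(1)[of i] by simp
    then show False using incoming_unique[OF k, of i a] that i(1) by (simp add: x_def)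
  qed
  have arc: "\<exists>s\<in>outgoing D x. (s, a) \<in> conn q" if a: "a \<in> incoming D x" for a
  proof -
    have "a \<in> ?V" using a ends[OF k x_def[THEN meta_eq_to_obj_eq]] unfolding incoming_def by (auto split: if_splits)
    then obtain s where s: "s \<in> ?V" "s \<notin> Range q" "(s, a) \<in> conn q"
      using sink_has_source[OF _ qV sv _ sink[OF a]] by auto
    obtain i where i: "i < n_crossings D" "s \<in> outgoing D (crossings D ! i)"
      using outgoing_exists[OF s(1)] by blast
    have "i = k"
    proof (rule ccontr)
      assume "i \<noteq> k"
      moreover have "s \<in> Range (directed_resolution D (crossings D ! i) (i \<in> v))"
        using directed_resolution_props(2)[OF i(1)] i(2) by simp
      ultimately have "s \<in> Range q" using i(1) unfolding q_def by blast
      then show False using s(2) by simp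
    qed
    then show ?thesis using i(2) s(3) x_def by blast
  qed
  note bl = black_left_crossing[OF knot nth_mem[OF k], folded x_def]
  show ?thesis
  proof (cases "black_left D (in_left x)")
    case True
    then have io: "incoming D x = {in_left x, out_right x}" "outgoing D x = {out_left x, in_right x}"
      by (simp_all add: incoming_def outgoing_def)
    have ne: "in_left x \<noteq> out_right x" using bl by metis
    have 1: "(in_left x, out_right x) \<notin> conn q"
      using sinks_not_connected[OF sv svc sink sink, of "in_left x" "out_right x"] io ne by auto
    have 2: "(out_left x, in_left x) \<in> conn q \<or> (in_right x, in_left x) \<in> conn q"
      "(out_left x, out_right x) \<in> conn q \<or> (in_right x, out_right x) \<in> conn q"
      using arc io by auto
    show ?thesis unfolding conn_eq using 1 2 by (meson conn_sym conn_trans)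
  next
    case False
    then have io: "incoming D x = {out_left x, in_right x}" "outgoing D x = {in_left x, out_right x}"
      by (simp_all add: incoming_def outgoing_def)
    have ne: "out_left x \<noteq> in_right x" using bl by metis
    have 1: "(out_left x, in_right x) \<notin> conn q"
      using sinks_not_connected[OF sv svc sink sink, of "out_left x" "in_right x"] io ne by auto
    have 2: "(in_left x, out_left x) \<in> conn q \<or> (out_right x, out_left x) \<in> conn q"
      "(in_left x, in_right x) \<in> conn q \<or> (out_right x, in_right x) \<in> conn q"
      using arc io by auto
    show ?thesis unfolding conn_eq using 1 2 by (meson conn_sym conn_trans)
  qed
qed

end

lemma components_absorb:
  assumes "q \<subseteq> conn r"
  shows "components V (q \<union> r) = components V r"
proof (rule components_cong, rule equalityI)
  show "conn (q \<union> r) \<subseteq> conn r" by (rule conn_subset) (use assms in \<open>auto intro: conn_base\<close>)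
  show "conn r \<subseteq> conn (q \<union> r)" by (rule conn_subset) (auto intro: conn_base)
qed

text \<open>Two pairs of points in the same two distinct classes join these classes only once.\<close>

lemma merges_to_joined:
  assumes ac: "(a, b) \<in> conn r" "(c, d) \<in> conn r" and "(a, c) \<notin> conn r" and V: "a \<in> V" "c \<in> V"
  shows "merges_to (components V ({(a, b), (c, d)} \<union> r)) (components V ({(a, c), (b, d)} \<union> r))"
proof -
  have 1: "components V ({(a, b), (c, d)} \<union> r) = components V r"
    by (rule components_absorb) (use ac in auto)
  have "components V ({(a, c), (b, d)} \<union> r) = components V ({(b, d)} \<union> insert (a, c) r)"
    by (simp add: insert_commute)
  also have "\<dots> = components V (insert (a, c) r)"
  proof (rule components_absorb)
    have "(a, b) \<in> conn (insert (a, c) r)" "(c, d) \<in> conn (insert (a, c) r)"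
      using ac conn_subset[of r "insert (a, c) r"] by (auto intro: conn_base)
    moreover have "(a, c) \<in> conn (insert (a, c) r)" by (rule conn_base) simp
    ultimately have "(b, d) \<in> conn (insert (a, c) r)" by (meson conn_sym conn_trans)
    then show "{(b, d)} \<subseteq> conn (insert (a, c) r)" by simp
  qed
  finally have 2: "components V ({(a, c), (b, d)} \<union> r) =
      insert (conn r `` {a} \<union> conn r `` {c}) (components V r - {conn r `` {a}, conn r `` {c}})"
    by (simp add: components_joined[OF V])
  have "conn r `` {a} \<noteq> conn r `` {c}" using assms(3) by (simp add: conn_class_eq)
  then show ?thesis
    unfolding 1 2 merges_to_def
    by (intro bexI[where x = "conn r `` {a}"] bexI[where x = "conn r `` {c}"] conjI refl componentsI V)
qed

text \<open>
  The two resolutions at \<open>k\<close> either reproduce the pairing of the ends by the arcs outside \<open>k\<close>, and close the two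
  arcs up separately, or connect the two arcs to one circle. The coloring excludes the third
  possibility of a non-orientable surface, in which one circle turns into one circle.
\<close>

lemma merge_or_split:
  assumes knot: "knot_diagram D" and k: "k < n_crossings D" "k \<notin> v"
  shows "merges_to (circles D v) (circles D (insert k v)) \<or>
    merges_to (circles D (insert k v)) (circles D v)"
proof -
  let ?x = "crossings D ! k"
  define r where "r = resolutions D ({..<n_crossings D} - {k}) v"
  have r': "r = resolutions D ({..<n_crossings D} - {k}) (insert k v)"
    by (auto simp: r_def resolutions_def)
  have "resolutions D {..<n_crossings D} u = resolution ?x (k \<in> u) \<union> resolutions D ({..<n_crossings D} - {k}) u" for u
    using UN_insert[of "\<lambda>i. resolution (crossings D ! i) (i \<in> u)" k "{..<n_crossings D} - {k}"] k(1)
    unfolding resolutions_def by (simp add: insert_absorb)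
  then have v: "circles D v = components (edges D) (resolution ?x False \<union> r)"
    and w: "circles D (insert k v) = components (edges D) (resolution ?x True \<union> r)"
    using k(2) by (simp_all add: circles_conv r_def[symmetric] r'[symmetric])
  note E = ends_in_edges[OF knot nth_mem[OF k(1)]]
  define Pv where "Pv = components (edges D) ({(in_left ?x, out_left ?x), (in_right ?x, out_right ?x)} \<union> r)"
  define Ph where "Ph = components (edges D) ({(in_left ?x, in_right ?x), (out_left ?x, out_right ?x)} \<union> r)"
  have "merges_to Pv Ph \<or> merges_to Ph Pv"
    using arcs_pair_ends[OF knot k(1), of v, folded r_def]
      merges_to_joined[of "in_left ?x" "out_left ?x" r "in_right ?x" "out_right ?x" "edges D"]
      merges_to_joined[of "in_left ?x" "in_right ?x" r "out_left ?x" "out_right ?x" "edges D"] E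
    unfolding Pv_def Ph_def by blast
  moreover have "circles D v = Pv \<and> circles D (insert k v) = Ph \<or> circles D v = Ph \<and> circles D (insert k v) = Pv"
    unfolding v w Pv_def Ph_def resolution_def by (cases "is_positive ?x") simp_all
  ultimately show ?thesis by metis
qed

section \<open>Chains as functions on two-colorings\<close>

lemma components_image: "components V r = (\<lambda>x. conn r `` {x}) ` V"
  by (auto simp: mem_components)

definition is_partition :: "'a set set \<Rightarrow> bool" where
  "is_partition P \<longleftrightarrow> finite P \<and> {} \<notin> P \<and> (\<forall>\<gamma>\<in>P. \<forall>\<gamma>'\<in>P. \<gamma> \<noteq> \<gamma>' \<longrightarrow> \<gamma> \<inter> \<gamma>' = {})"

lemma is_partition_circles:
  assumes "knot_diagram D"
  shows "is_partition (circles D v)"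
proof -
  have "finite (circles D v)"
    using assms unfolding circles_def components_image by (simp add: knot_diagram_def)
  moreover have "{} \<notin> circles D v"
  proof
    assume "{} \<in> circles D v"
    then obtain x where "{} = conn (resolutions D {..<n_crossings D} v) `` {x}"
      unfolding circles_conv by (rule componentsE)
    then have "x \<in> {}" by (metis Image_singleton_iff conn_refl)
    then show False by simp
  qed
  moreover have "\<gamma> \<inter> \<gamma>' = {}" if "\<gamma> \<in> circles D v" "\<gamma>' \<in> circles D v" "\<gamma> \<noteq> \<gamma>'" for \<gamma> \<gamma>'
    using that components_disjoint[of \<gamma> _ _ \<gamma>'] unfolding circles_conv by blast
  ultimately show ?thesis by (simp add: is_partition_def)
qed

lemma merges_to_parts:
  assumes "merges_to P P'" "is_partition P"
  obtains \<gamma>1 \<gamma>2 where "\<gamma>1 \<noteq> \<gamma>2" "P = insert \<gamma>1 (insert \<gamma>2 (P \<inter> P'))" "P' = insert (\<gamma>1 \<union> \<gamma>2) (P \<inter> P')"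
    "\<gamma>1 \<notin> P'" "\<gamma>2 \<notin> P'" "\<gamma>1 \<union> \<gamma>2 \<notin> P" "\<gamma>1 \<noteq> {}" "\<gamma>2 \<noteq> {}"
    "card P = card P' + 1"
proof -
  obtain \<gamma>1 \<gamma>2 where g: "\<gamma>1 \<in> P" "\<gamma>2 \<in> P" "\<gamma>1 \<noteq> \<gamma>2" "P' = insert (\<gamma>1 \<union> \<gamma>2) (P - {\<gamma>1, \<gamma>2})"
    using assms(1) unfolding merges_to_def by blast
  have ne: "\<gamma>1 \<noteq> {}" "\<gamma>2 \<noteq> {}" "\<gamma>1 \<inter> \<gamma>2 = {}" "finite P"
    using assms(2) g(1-3) unfolding is_partition_def by metis+
  have disj: "\<gamma> = \<gamma>'" if "\<gamma> \<in> P" "\<gamma>' \<in> P" "\<gamma> \<inter> \<gamma>' \<noteq> {}" for \<gamma> \<gamma>'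
    using assms(2) that unfolding is_partition_def by metis
  have nin: "\<gamma>1 \<union> \<gamma>2 \<notin> P"
  proof
    assume "\<gamma>1 \<union> \<gamma>2 \<in> P"
    moreover have "(\<gamma>1 \<union> \<gamma>2) \<inter> \<gamma>1 \<noteq> {}" "(\<gamma>1 \<union> \<gamma>2) \<inter> \<gamma>2 \<noteq> {}" using ne by auto
    ultimately have "\<gamma>1 \<union> \<gamma>2 = \<gamma>1" "\<gamma>1 \<union> \<gamma>2 = \<gamma>2"
      using disj g(1,2) by metis+
    then show False using g(3) by simp
  qed
  have U: "P \<inter> P' = P - {\<gamma>1, \<gamma>2}" using g(4) nin by auto
  have "\<gamma>1 \<noteq> \<gamma>1 \<union> \<gamma>2" "\<gamma>2 \<noteq> \<gamma>1 \<union> \<gamma>2" using nin g(1,2) by auto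
  then have n': "\<gamma>1 \<notin> P'" "\<gamma>2 \<notin> P'" using g(4) by auto
  have "card P = card (P - {\<gamma>1, \<gamma>2}) + 2"
    using g(1-3) ne(4) card_Diff_subset[of "{\<gamma>1, \<gamma>2}" P] card_mono[of P "{\<gamma>1, \<gamma>2}"] by simp
  moreover have "card P' = card (P - {\<gamma>1, \<gamma>2}) + 1"
    using g(4) nin ne(4) by simp
  ultimately have cd: "card P = card P' + 1" by simp
  show thesis
    by (rule that[of \<gamma>1 \<gamma>2]) (use g nin U n' ne cd in auto)
qed

lemma sum_Pow_fixed_part:
  fixes h :: "'a set \<Rightarrow> 'r::comm_ring_1"
  assumes "finite Q" "A \<subseteq> U"
  shows "(\<Sum>T\<in>Pow Q. if A = T \<inter> U then h T else 0) =
    (if A \<subseteq> Q then \<Sum>T\<in>Pow (Q - U). h (A \<union> T) else 0)"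
proof (cases "A \<subseteq> Q")
  case True
  have "(\<Sum>T\<in>Pow Q. if A = T \<inter> U then h T else 0) = (\<Sum>T\<in>{T \<in> Pow Q. A = T \<inter> U}. h T)"
    by (rule sum.inter_filter[symmetric]) (simp add: assms(1))
  also have "\<dots> = (\<Sum>T\<in>Pow (Q - U). h (A \<union> T))"
    by (rule sum.reindex_bij_witness[of _ "\<lambda>T. A \<union> T" "\<lambda>T. T - U"])
      (use True assms(2) in \<open>auto simp: Int_Diff_Un\<close>)
  finally show ?thesis using True by simp
next
  case False
  then have "(if A = T \<inter> U then h T else 0) = 0" if "T \<in> Pow Q" for T using that by auto
  then show ?thesis using False by (simp add: sum.neutral)
qed

lemma sum_Pow_insert:
  assumes "finite Q" "a \<notin> Q"
  shows "(\<Sum>T\<in>Pow (insert a Q). h T) = (\<Sum>T\<in>Pow Q. h T) + (\<Sum>T\<in>Pow Q. h (insert a T))"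
proof -
  have "inj_on (insert a) (Pow Q)" using assms(2) by (auto simp: inj_on_def)
  then have "(\<Sum>T\<in>insert a ` Pow Q. h T) = (\<Sum>T\<in>Pow Q. h (insert a T))"
    by (simp add: sum.reindex)
  moreover have "Pow Q \<inter> insert a ` Pow Q = {}" using assms(2) by auto
  ultimately show ?thesis
    using assms(1) by (simp add: Pow_insert sum.union_disjoint)
qed

abbreviation chains :: "diagram \<Rightarrow> 'r::comm_ring_1 chain set" where
  "chains D \<equiv> carrier (chain_module D)"

lemma chains_iff: "x \<in> chains D \<longleftrightarrow> (\<forall>g. g \<notin> generators D \<longrightarrow> x g = 0)"
  by (simp add: chain_module_def)

text \<open>
  Evaluating \<open>X\<close> at \<open>0\<close> and at \<open>c\<close> embeds \<open>A\<close> into \<open>R \<times> R\<close> because \<open>c\<close> is not a zero divisor. Applied to all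
  tensor factors at \<open>v\<close>, this turns a chain into a function on two-colorings of the circles of \<open>v\<close>. A
  two-coloring is given by a set \<open>K\<close> of edges that contains each circle or is disjoint from it; the
  circles inside \<open>K\<close> are those at which \<open>X\<close> is evaluated at \<open>c\<close>. Describing colorings by edges makes it
  possible to compare them between different states.
\<close>

locale knot_cube =
  fixes c :: "'r::idom" and D :: diagram
  assumes c_nz: "c \<noteq> 0" and knot: "knot_diagram D"
begin

abbreviation n where "n \<equiv> n_crossings D"

definition inside :: "nat set \<Rightarrow> nat set \<Rightarrow> nat set set" where
  "inside v K = {\<gamma> \<in> circles D v. \<gamma> \<subseteq> K}"

definition compatible :: "nat set \<Rightarrow> nat set \<Rightarrow> bool" where
  "compatible v K \<longleftrightarrow> (\<forall>\<gamma>\<in>circles D v. \<gamma> \<subseteq> K \<or> \<gamma> \<inter> K = {})"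

definition coord :: "'r chain \<Rightarrow> nat set \<Rightarrow> nat set \<Rightarrow> 'r" where
  "coord x v K = (\<Sum>S\<in>Pow (inside v K). c ^ card S * x (v, S))"

lemma partition [simp]: "is_partition (circles D v)"
  by (rule is_partition_circles[OF knot])

lemma finite_circles [simp]: "finite (circles D v)"
  using partition unfolding is_partition_def by blast

lemma finite_inside [simp]: "finite (inside v K)"
  by (simp add: inside_def)

lemma circle_nonempty: "\<gamma> \<in> circles D v \<Longrightarrow> \<gamma> \<noteq> {}"
  using partition unfolding is_partition_def by metis

lemma circle_disjoint: "\<gamma> \<in> circles D v \<Longrightarrow> \<gamma>' \<in> circles D v \<Longrightarrow> e \<in> \<gamma> \<Longrightarrow> e \<in> \<gamma>' \<Longrightarrow> \<gamma> = \<gamma>'"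
  using partition unfolding is_partition_def by blast

lemma inside_Union:
  assumes "S \<subseteq> circles D v"
  shows "inside v (\<Union>S) = S" "compatible v (\<Union>S)"
proof -
  have *: "\<gamma> \<in> S" if g: "\<gamma> \<in> circles D v" "\<gamma> \<inter> \<Union>S \<noteq> {}" for \<gamma>
  proof -
    obtain e \<gamma>' where "e \<in> \<gamma>" "e \<in> \<gamma>'" "\<gamma>' \<in> S" using g(2) by auto
    then show ?thesis using circle_disjoint[of \<gamma> v \<gamma>' e] g(1) assms by auto
  qed
  have "\<gamma> \<in> S" if "\<gamma> \<in> circles D v" "\<gamma> \<subseteq> \<Union>S" for \<gamma>
    using *[OF that(1)] circle_nonempty[OF that(1)] that(2) by (simp add: Int_absorb2)
  then show "inside v (\<Union>S) = S"
    using assms by (auto simp: inside_def)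
  show "compatible v (\<Union>S)"
    using * unfolding compatible_def by (metis Union_upper)
qed

text \<open>
  The matrix of the evaluation is triangular with powers of \<open>c\<close> on the diagonal: on the coloring by the
  circles of \<open>S\<close>, the coefficients at the subsets of \<open>S\<close> contribute, and that at \<open>S\<close> does so with \<open>c\<^bsup>|S|\<^esup>\<close>.
\<close>

lemma chain_eqI:
  assumes "x \<in> chains D" "y \<in> chains D"
    and eq: "\<And>v K. v \<subseteq> {..<n} \<Longrightarrow> compatible v K \<Longrightarrow> coord x v K = coord y v K"
  shows "x = y"
proof
  fix g
  have main: "x (v, S) = y (v, S)" if v: "v \<subseteq> {..<n}" and "S \<subseteq> circles D v" for v S
  proof -
    have "finite S" using that(2) finite_circles finite_subset by blast
    then show ?thesis using that(2)
    proof (induction S rule: finite_psubset_induct)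
      case (psubset S)
      have P: "finite (Pow S)" "S \<in> Pow S" using psubset.hyps by auto
      have "(\<Sum>S'\<in>Pow S. c ^ card S' * x (v, S')) = (\<Sum>S'\<in>Pow S. c ^ card S' * y (v, S'))"
        using eq[OF v inside_Union(2)[OF psubset.prems]] inside_Union(1)[OF psubset.prems]
        by (simp add: coord_def)
      moreover have "(\<Sum>S'\<in>Pow S - {S}. c ^ card S' * x (v, S')) = (\<Sum>S'\<in>Pow S - {S}. c ^ card S' * y (v, S'))"
        by (rule sum.cong) (use psubset in auto)
      ultimately have "c ^ card S * x (v, S) = c ^ card S * y (v, S)"
        by (simp add: sum.remove[OF P])
      then show ?case using c_nz by simp
    qed
  qed
  show "x g = y g"
  proof (cases "g \<in> generators D")
    case True
    then show ?thesis using main by (cases g) (auto simp: generators_def)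
  next
    case False
    then show ?thesis using assms(1,2) unfolding chains_iff by metis
  qed
qed

text \<open>
  The scalar by which the edge map from \<open>v\<close> to \<open>w\<close> acts on the coloring \<open>K\<close>. The product is
  evaluated pointwise, which gives \<open>1\<close>. The element \<open>\<Delta> 1 = X \<otimes> 1 + 1 \<otimes> X - c (1 \<otimes> 1)\<close> takes the value \<open>c\<close> if
  both factors are evaluated at \<open>c\<close>, \<open>-c\<close> if both are evaluated at \<open>0\<close>, and \<open>0\<close> in the mixed cases. In the
  mixed cases \<open>K\<close> is not a coloring of the circles of \<open>v\<close>.
\<close>

definition weight :: "nat set \<Rightarrow> nat set \<Rightarrow> nat set \<Rightarrow> 'r" where
  "weight v w K =
     (if card (circles D w) < card (circles D v) then 1
      else if \<forall>\<gamma>\<in>circles D w - circles D v. \<gamma> \<subseteq> K then c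
      else if \<forall>\<gamma>\<in>circles D w - circles D v. \<gamma> \<inter> K = {} then - c
      else 0)"

text \<open>
  The common circles keep their labels, so only the labels of the new circles remain to be summed over.
\<close>

lemma sum_edge_coeff_new_circles:
  fixes v w :: "nat set"
  assumes "S \<subseteq> circles D v"
  defines "U \<equiv> circles D v \<inter> circles D w"
  shows "(\<Sum>T\<in>Pow (inside w K). c ^ card T * edge_coeff c D (v, S) (w, T)) =
    (if S \<inter> U \<subseteq> inside w K
     then c ^ card (S \<inter> U) * (\<Sum>T\<in>Pow (inside w K - U). c ^ card T *
       (if card (circles D w) < card (circles D v) then mult_coeff c (card (S - U)) (card T)
        else comult_coeff c (card (S - U)) (card T)))
     else 0)"
proof -
  let ?m = "\<lambda>k. if card (circles D w) < card (circles D v) then mult_coeff c (card (S - U)) k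
        else comult_coeff c (card (S - U)) k"
  let ?h = "\<lambda>T. c ^ card T * ?m (card (T - U))"
  have "(\<Sum>T\<in>Pow (inside w K). c ^ card T * edge_coeff c D (v, S) (w, T)) =
      (\<Sum>T\<in>Pow (inside w K). if S \<inter> U = T \<inter> U then ?h T else 0)"
    by (rule sum.cong) (auto simp: edge_coeff_def Let_def U_def)
  also have "\<dots> = (if S \<inter> U \<subseteq> inside w K then \<Sum>T\<in>Pow (inside w K - U). ?h (S \<inter> U \<union> T) else 0)"
    by (rule sum_Pow_fixed_part) auto
  also have "(\<Sum>T\<in>Pow (inside w K - U). ?h (S \<inter> U \<union> T)) =
      (\<Sum>T\<in>Pow (inside w K - U). c ^ card (S \<inter> U) * (c ^ card T * ?m (card T)))"
  proof (rule sum.cong)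
    fix T assume T: "T \<in> Pow (inside w K - U)"
    have "finite S" using assms(1) finite_circles finite_subset by blast
    moreover have "finite T" using T finite_inside finite_subset by blast
    ultimately have "card (S \<inter> U \<union> T) = card (S \<inter> U) + card T"
      using T by (intro card_Un_disjoint) auto
    moreover have "S \<inter> U \<union> T - U = T" using T by auto
    ultimately show "?h (S \<inter> U \<union> T) = c ^ card (S \<inter> U) * (c ^ card T * ?m (card T))"
      by (simp add: power_add mult.assoc)
  qed simp
  finally show ?thesis by (simp add: sum_distrib_left)
qed

lemma sum_mult_coeff:
  fixes \<delta> :: "'a set"
  assumes "E \<and> k = 0 \<or> \<not> E \<and> (k = 1 \<or> k = 2)"
  shows "(if A then c ^ a * (\<Sum>T\<in>Pow (if B then {\<delta>} else {}). c ^ card T * mult_coeff c k (card T)) else 0) =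
    (if A \<and> (E \<or> B) then c ^ (a + k) else 0)"
  using assms by (cases A; cases B; cases E) (auto simp: mult_coeff_def Pow_insert power_add power2_eq_square)

lemma sum_comult_coeff:
  fixes \<delta>1 \<delta>2 :: "'a set"
  assumes "\<delta>1 \<noteq> \<delta>2" and "E \<and> k = 0 \<or> \<not> E \<and> k = 1"
  shows "(if A then c ^ a * (\<Sum>T\<in>Pow ((if B1 then {\<delta>1} else {}) \<union> (if B2 then {\<delta>2} else {})).
      c ^ card T * comult_coeff c k (card T)) else 0) =
    (if B1 \<and> B2 then c else if \<not> B1 \<and> \<not> B2 then - c else 0) * (if A \<and> (E \<or> B1 \<and> B2) then c ^ (a + k) else 0)"
proof -
  have P: "Pow {\<delta>1, \<delta>2} = {{}, {\<delta>1}, {\<delta>2}, {\<delta>1, \<delta>2}}" by (auto simp: Pow_insert)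
  have "{\<delta>1} \<noteq> {\<delta>2}" "{\<delta>1} \<noteq> {\<delta>1, \<delta>2}" "{\<delta>2} \<noteq> {\<delta>1, \<delta>2}" "card {\<delta>1, \<delta>2} = 2"
    using assms(1) by auto
  then have "(\<Sum>T\<in>Pow {\<delta>1, \<delta>2}. h (card T)) = h 0 + (h 1 + (h 1 + h 2))" for h :: "nat \<Rightarrow> 'r"
    unfolding P by (simp add: numeral_2_eq_2)
  then have "(\<Sum>T\<in>Pow ((if B1 then {\<delta>1} else {}) \<union> (if B2 then {\<delta>2} else {})). h (card T)) =
      h 0 + (if B1 then h 1 else 0) + (if B2 then h 1 else 0) + (if B1 \<and> B2 then h 2 else 0)"
    for h :: "nat \<Rightarrow> 'r"
    by (cases B1; cases B2) (simp_all add: Pow_insert insert_commute[of \<delta>2 \<delta>1] add.assoc del: Pow_insert, simp_all add: Pow_insert)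
  from this[of "\<lambda>l. c ^ l * comult_coeff c k l"]
  show ?thesis using assms(2)
    by (cases A; cases B1; cases B2; cases E) (simp_all add: comult_coeff_def power2_eq_square)
qed

lemma sum_edge_coeff:
  assumes S: "S \<subseteq> circles D v"
    and mos: "merges_to (circles D v) (circles D w) \<or> merges_to (circles D w) (circles D v)"
    and K: "compatible w K"
  shows "(\<Sum>T\<in>Pow (inside w K). c ^ card T * edge_coeff c D (v, S) (w, T)) =
    weight v w K * (if S \<subseteq> inside v K then c ^ card S else 0)"
  using mos
proof
  assume m: "merges_to (circles D v) (circles D w)"
  let ?U = "circles D v \<inter> circles D w"
  obtain \<gamma>1 \<gamma>2 where g: "\<gamma>1 \<noteq> \<gamma>2" "circles D v = insert \<gamma>1 (insert \<gamma>2 ?U)"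
    "circles D w = insert (\<gamma>1 \<union> \<gamma>2) ?U" "\<gamma>1 \<notin> circles D w" "\<gamma>2 \<notin> circles D w"
    "\<gamma>1 \<union> \<gamma>2 \<notin> circles D v" "\<gamma>1 \<noteq> {}" "\<gamma>2 \<noteq> {}" "card (circles D v) = card (circles D w) + 1"
    using merges_to_parts[OF m partition] by metis
  have less: "card (circles D w) < card (circles D v)" using g(9) by simp
  let ?k = "card (S - ?U)"
  have SU: "S - ?U \<subseteq> {\<gamma>1, \<gamma>2}" using S g(2)[THEN equalityD1] by blast
  have new: "\<gamma>1 \<union> \<gamma>2 \<in> circles D w" by (subst g(3)) simp
  then have kK: "\<gamma>1 \<union> \<gamma>2 \<subseteq> K \<or> (\<gamma>1 \<union> \<gamma>2) \<inter> K = {}" using K unfolding compatible_def by metis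
  have Q: "inside w K - ?U = (if \<gamma>1 \<union> \<gamma>2 \<subseteq> K then {\<gamma>1 \<union> \<gamma>2} else {})"
  proof -
    have "circles D w - ?U = {\<gamma>1 \<union> \<gamma>2}" using new g(3,6) by (metis Diff_insert_absorb IntD1 insert_Diff_if Diff_cancel)
    then show ?thesis unfolding inside_def by auto
  qed
  have SK: "S \<subseteq> inside v K \<longleftrightarrow> S \<inter> ?U \<subseteq> inside w K \<and> (S - ?U = {} \<or> \<gamma>1 \<union> \<gamma>2 \<subseteq> K)"
  proof -
    have "S \<subseteq> inside v K \<longleftrightarrow> S \<inter> ?U \<subseteq> inside w K \<and> (\<forall>\<gamma>\<in>S - ?U. \<gamma> \<subseteq> K)"
      using S unfolding inside_def by blast
    also have "(\<forall>\<gamma>\<in>S - ?U. \<gamma> \<subseteq> K) \<longleftrightarrow> (S - ?U = {} \<or> \<gamma>1 \<union> \<gamma>2 \<subseteq> K)"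
      using SU kK g(7,8) by blast
    finally show ?thesis .
  qed
  have "finite S" using S finite_circles finite_subset by blast
  then have cS: "card S = card (S \<inter> ?U) + ?k"
    by (metis Diff_Int_distrib2 card_Int_Diff)
  have "S - ?U = {} \<or> S - ?U = {\<gamma>1} \<or> S - ?U = {\<gamma>2} \<or> S - ?U = {\<gamma>1, \<gamma>2}"
    using SU by blast
  moreover have "card {\<gamma>1, \<gamma>2} = 2" using g(1) by simp
  ultimately have k: "S - ?U = {} \<and> ?k = 0 \<or> S - ?U \<noteq> {} \<and> (?k = 1 \<or> ?k = 2)"
    by (metis card.empty card_1_singleton_iff insert_not_empty One_nat_def)
  show ?thesis
    unfolding sum_edge_coeff_new_circles[OF S] SK cS Q weight_def if_P[OF less] sum_mult_coeff[OF k] by simp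
next
  assume m: "merges_to (circles D w) (circles D v)"
  let ?U = "circles D v \<inter> circles D w"
  have U: "circles D w \<inter> circles D v = ?U" by blast
  obtain \<gamma>1 \<gamma>2 where g: "\<gamma>1 \<noteq> \<gamma>2" "circles D w = insert \<gamma>1 (insert \<gamma>2 ?U)"
    "circles D v = insert (\<gamma>1 \<union> \<gamma>2) ?U" "\<gamma>1 \<notin> circles D v" "\<gamma>2 \<notin> circles D v"
    "\<gamma>1 \<union> \<gamma>2 \<notin> circles D w" "\<gamma>1 \<noteq> {}" "\<gamma>2 \<noteq> {}" "card (circles D w) = card (circles D v) + 1"
    using merges_to_parts[OF m partition] unfolding U by metis
  have less: "\<not> card (circles D w) < card (circles D v)" using g(9) by simp
  let ?k = "card (S - ?U)"
  have SU: "S - ?U \<subseteq> {\<gamma>1 \<union> \<gamma>2}" using S g(3)[THEN equalityD1] by blast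
  have mem: "\<gamma>1 \<in> circles D w" "\<gamma>2 \<in> circles D w" by (subst g(2); simp)+
  then have kK: "\<gamma>1 \<subseteq> K \<or> \<gamma>1 \<inter> K = {}" "\<gamma>2 \<subseteq> K \<or> \<gamma>2 \<inter> K = {}"
    using K unfolding compatible_def by metis+
  have kK': "\<not> (\<gamma>1 \<subseteq> K \<and> \<gamma>1 \<inter> K = {})" "\<not> (\<gamma>2 \<subseteq> K \<and> \<gamma>2 \<inter> K = {})" using g(7,8) by blast+
  have new: "circles D w - circles D v = {\<gamma>1, \<gamma>2}"
    using mem g(4,5) g(2)[THEN equalityD1] by blast
  have Q: "inside w K - ?U = (if \<gamma>1 \<subseteq> K then {\<gamma>1} else {}) \<union> (if \<gamma>2 \<subseteq> K then {\<gamma>2} else {})"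
    using new unfolding inside_def by auto
  have SK: "S \<subseteq> inside v K \<longleftrightarrow> S \<inter> ?U \<subseteq> inside w K \<and> (S - ?U = {} \<or> \<gamma>1 \<subseteq> K \<and> \<gamma>2 \<subseteq> K)"
  proof -
    have "S \<subseteq> inside v K \<longleftrightarrow> S \<inter> ?U \<subseteq> inside w K \<and> (\<forall>\<gamma>\<in>S - ?U. \<gamma> \<subseteq> K)"
      using S unfolding inside_def by blast
    also have "(\<forall>\<gamma>\<in>S - ?U. \<gamma> \<subseteq> K) \<longleftrightarrow> (S - ?U = {} \<or> \<gamma>1 \<subseteq> K \<and> \<gamma>2 \<subseteq> K)"
      using SU by blast
    finally show ?thesis .
  qed
  have "finite S" using S finite_circles finite_subset by blast
  then have cS: "card S = card (S \<inter> ?U) + ?k"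
    by (metis Diff_Int_distrib2 card_Int_Diff)
  have "S - ?U = {} \<or> S - ?U = {\<gamma>1 \<union> \<gamma>2}"
    using SU by blast
  then have k: "S - ?U = {} \<and> ?k = 0 \<or> S - ?U \<noteq> {} \<and> ?k = 1"
    by (metis card.empty card_1_singleton_iff insert_not_empty One_nat_def)
  have W: "weight v w K = (if \<gamma>1 \<subseteq> K \<and> \<gamma>2 \<subseteq> K then c else if \<not> \<gamma>1 \<subseteq> K \<and> \<not> \<gamma>2 \<subseteq> K then - c else 0)"
    unfolding weight_def new using less kK kK' by auto
  show ?thesis
    unfolding sum_edge_coeff_new_circles[OF S] SK cS Q W if_not_P[OF less] sum_comult_coeff[OF g(1) k] by simp
qed

lemma adjacent_states:
  assumes "w \<subseteq> {..<n}" "i \<in> w"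
  shows "merges_to (circles D (w - {i})) (circles D w) \<or> merges_to (circles D w) (circles D (w - {i}))"
  using merge_or_split[OF knot, of i "w - {i}"] assms by (auto simp: insert_absorb)

lemma coord_differential:
  assumes w: "w \<subseteq> {..<n}" and K: "compatible w K"
  shows "coord (differential c D x) w K =
    (\<Sum>i\<in>w. (- 1) ^ card {j\<in>w. j < i} * (weight (w - {i}) w K * coord x (w - {i}) K))"
proof -
  let ?s = "\<lambda>i. (- 1 :: 'r) ^ card {j\<in>w. j < i}"
  have gen: "(w, T) \<in> generators D" if "T \<in> Pow (inside w K)" for T
    using that w by (auto simp: generators_def inside_def)
  have "coord (differential c D x) w K = (\<Sum>T\<in>Pow (inside w K). \<Sum>i\<in>w. ?s i *
      (\<Sum>S\<in>Pow (circles D (w - {i})). x (w - {i}, S) * (c ^ card T * edge_coeff c D (w - {i}, S) (w, T))))"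
    unfolding coord_def
    by (intro sum.cong refl) (simp add: differential_def gen sum_distrib_left mult_ac)
  also have "\<dots> = (\<Sum>i\<in>w. ?s i * (\<Sum>S\<in>Pow (circles D (w - {i})). x (w - {i}, S) *
      (\<Sum>T\<in>Pow (inside w K). c ^ card T * edge_coeff c D (w - {i}, S) (w, T))))"
    unfolding sum_distrib_left by (subst sum.swap) (intro sum.cong refl sum.swap)
  also have "\<dots> = (\<Sum>i\<in>w. ?s i * (weight (w - {i}) w K * coord x (w - {i}) K))"
  proof (intro sum.cong refl arg_cong2[where f = "(*)"])
    fix i assume i: "i \<in> w"
    let ?v = "w - {i}"
    have "(\<Sum>S\<in>Pow (circles D ?v). x (?v, S) * (\<Sum>T\<in>Pow (inside w K). c ^ card T * edge_coeff c D (?v, S) (w, T))) =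
        (\<Sum>S\<in>Pow (circles D ?v). weight ?v w K * (if S \<in> Pow (inside ?v K) then c ^ card S * x (?v, S) else 0))"
      by (intro sum.cong refl) (use sum_edge_coeff[OF _ adjacent_states[OF w i] K] in auto)
    also have "\<dots> = weight ?v w K * (\<Sum>S\<in>Pow (circles D ?v) \<inter> Pow (inside ?v K). c ^ card S * x (?v, S))"
      by (simp add: sum_distrib_left[symmetric] sum.inter_restrict)
    also have "Pow (circles D ?v) \<inter> Pow (inside ?v K) = Pow (inside ?v K)"
      by (auto simp: inside_def)
    finally show "(\<Sum>S\<in>Pow (circles D ?v). x (?v, S) * (\<Sum>T\<in>Pow (inside w K). c ^ card T * edge_coeff c D (?v, S) (w, T))) =
        weight ?v w K * coord x ?v K" by (simp add: coord_def)
  qed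
  finally show ?thesis .
qed

lemma weight_compatible:
  assumes "merges_to (circles D v) (circles D w) \<or> merges_to (circles D w) (circles D v)"
    and K: "compatible w K" and "weight v w K \<noteq> 0"
  shows "compatible v K"
  using assms(1)
proof
  assume m: "merges_to (circles D v) (circles D w)"
  obtain \<gamma>1 \<gamma>2 where eq: "circles D w = insert (\<gamma>1 \<union> \<gamma>2) (circles D v - {\<gamma>1, \<gamma>2})"
    using m unfolding merges_to_def by metis
  then have "\<gamma>1 \<union> \<gamma>2 \<subseteq> K \<or> (\<gamma>1 \<union> \<gamma>2) \<inter> K = {}" using K unfolding compatible_def by simp
  then have new: "\<gamma>1 \<subseteq> K \<or> \<gamma>1 \<inter> K = {}" "\<gamma>2 \<subseteq> K \<or> \<gamma>2 \<inter> K = {}" by auto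
  have "\<gamma> \<in> circles D w" if "\<gamma> \<in> circles D v" "\<gamma> \<noteq> \<gamma>1" "\<gamma> \<noteq> \<gamma>2" for \<gamma>
    using that eq by simp
  then show ?thesis using K new unfolding compatible_def by metis
next
  assume m: "merges_to (circles D w) (circles D v)"
  have "card (circles D w) = card (circles D v) + 1" using merges_to_parts[OF m partition] by metis
  then have "(\<forall>\<gamma>\<in>circles D w - circles D v. \<gamma> \<subseteq> K) \<or> (\<forall>\<gamma>\<in>circles D w - circles D v. \<gamma> \<inter> K = {})"
    using assms(3) unfolding weight_def by (auto split: if_splits)
  moreover obtain \<gamma>1 \<gamma>2 where g: "circles D w = insert \<gamma>1 (insert \<gamma>2 (circles D w \<inter> circles D v))"
      "circles D v = insert (\<gamma>1 \<union> \<gamma>2) (circles D w \<inter> circles D v)" "\<gamma>1 \<notin> circles D v" "\<gamma>2 \<notin> circles D v"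
    using merges_to_parts[OF m partition] by metis
  have "\<gamma>1 \<in> circles D w" "\<gamma>2 \<in> circles D w" by (subst g(1); simp)+
  have sub: "circles D v \<subseteq> insert (\<gamma>1 \<union> \<gamma>2) (circles D w)"
    by (subst g(2)) auto
  have "\<gamma>1 \<in> circles D w - circles D v" "\<gamma>2 \<in> circles D w - circles D v"
    using g(3,4) \<open>\<gamma>1 \<in> circles D w\<close> \<open>\<gamma>2 \<in> circles D w\<close> by auto
  ultimately have "\<gamma>1 \<union> \<gamma>2 \<subseteq> K \<or> (\<gamma>1 \<union> \<gamma>2) \<inter> K = {}"
    by (metis Int_Un_distrib2 Un_least sup_bot.right_neutral)
  then show ?thesis using K sub unfolding compatible_def by (metis insertE subsetD)
qed

end

section \<open>Linear operators on chains\<close>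

definition linear_map :: "(('g \<Rightarrow> 'r::comm_ring_1) \<Rightarrow> ('h \<Rightarrow> 'r)) \<Rightarrow> bool" where
  "linear_map f \<longleftrightarrow> (\<forall>r s x y. f (\<lambda>g. r * x g + s * y g) = (\<lambda>g. r * f x g + s * f y g))"

lemma linear_mapD: "linear_map f \<Longrightarrow> f (\<lambda>g. r * x g + s * y g) = (\<lambda>g. r * f x g + s * f y g)"
  by (simp add: linear_map_def)

lemma linear_map_scale: "linear_map f \<Longrightarrow> f (\<lambda>g. r * x g) = (\<lambda>g. r * f x g)"
  using linear_mapD[of f r x 0 x] by simp

lemma linear_map_zero: "linear_map f \<Longrightarrow> f (\<lambda>g. 0) = (\<lambda>g. 0)"
  using linear_mapD[of f 0 _ 0] by simp

lemma linear_differential: "linear_map (differential c D)"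
proof -
  have "(if (w, T) \<in> generators D then \<Sum>i\<in>w. (- 1) ^ card {j\<in>w. j < i} *
            (\<Sum>S\<in>Pow (circles D (w - {i})). edge_coeff c D (w - {i}, S) (w, T) * (r * x (w - {i}, S) + s * y (w - {i}, S)))
         else 0) =
       r * (if (w, T) \<in> generators D then \<Sum>i\<in>w. (- 1) ^ card {j\<in>w. j < i} *
            (\<Sum>S\<in>Pow (circles D (w - {i})). edge_coeff c D (w - {i}, S) (w, T) * x (w - {i}, S)) else 0) +
       s * (if (w, T) \<in> generators D then \<Sum>i\<in>w. (- 1) ^ card {j\<in>w. j < i} *
            (\<Sum>S\<in>Pow (circles D (w - {i})). edge_coeff c D (w - {i}, S) (w, T) * y (w - {i}, S)) else 0)"
    for r s and x y :: "'a chain" and w T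
    by (simp add: sum_distrib_left sum.distrib distrib_left mult.left_commute)
  then show ?thesis by (auto simp: linear_map_def differential_def fun_eq_iff split: prod.splits)
qed

lemma linear_mult_Xa: "linear_map (mult_Xa c D p)"
  by (auto simp: linear_map_def mult_Xa_def fun_eq_iff algebra_simps)

lemma linear_mult_Xb: "linear_map (mult_Xb c D p)"
  using linear_mult_Xa[of c D p]
  by (auto simp: linear_map_def mult_Xb_def fun_eq_iff algebra_simps)

lemma differential_in_chains: "differential c D x \<in> chains D"
  by (auto simp: chains_iff differential_def)

lemma mult_Xa_in_chains: "mult_Xa c D p x \<in> chains D"
  by (auto simp: chains_iff mult_Xa_def)

lemma mult_Xb_in_chains: "x \<in> chains D \<Longrightarrow> mult_Xb c D p x \<in> chains D"
  using mult_Xa_in_chains[of c D p x] by (simp add: chains_iff mult_Xb_def)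

lemma chains_combine: "x \<in> chains D \<Longrightarrow> y \<in> chains D \<Longrightarrow> (\<lambda>g. r * x g + s * y g) \<in> chains D"
  by (simp add: chains_iff)

lemma chains_scale: "x \<in> chains D \<Longrightarrow> (\<lambda>g. r * x g) \<in> chains D"
  by (simp add: chains_iff)

lemma sum_alternating_Pow:
  assumes "finite A"
  shows "(\<Sum>T\<in>Pow A. (- 1) ^ card T) = (if A = {} then 1 else 0 :: 'r::comm_ring_1)"
proof -
  have "(\<Sum>T\<in>Pow A. (- 1) ^ card T) = (\<Prod>x\<in>A. (- 1) + 1 :: 'r)"
    using prod_add[OF assms, of "\<lambda>_. - 1 :: 'r" "\<lambda>_. 1"] by simp
  then show ?thesis using assms by (simp add: power_0_left)
qed

context knot_cube
begin

lemma circle_of: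
  assumes "p \<in> edges D"
  shows "circle_of D v p \<in> circles D v" "p \<in> circle_of D v p"
proof -
  let ?\<gamma> = "conn (resolutions D {..<n} v) `` {p}"
  have "?\<gamma> \<in> circles D v" "p \<in> ?\<gamma>" using assms unfolding circles_conv by (simp_all add: componentsI)
  then have "\<exists>!\<gamma>. \<gamma> \<in> circles D v \<and> p \<in> \<gamma>"
    using circle_disjoint[of _ v ?\<gamma> p] by (intro ex1I[of _ ?\<gamma>] conjI) blast+
  from theI'[OF this] show "circle_of D v p \<in> circles D v" "p \<in> circle_of D v p"
    unfolding circle_of_def by auto
qed

lemma circle_of_inside:
  assumes "p \<in> edges D" "compatible v K"
  shows "circle_of D v p \<in> inside v K \<longleftrightarrow> p \<in> K"
  using circle_of[OF assms(1), of v] assms(2) unfolding inside_def compatible_def by blast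

lemma coord_scale: "coord (\<lambda>g. r * x g) v K = r * coord x v K"
  by (simp add: coord_def sum_distrib_left mult.left_commute)

lemma coord_diff: "coord (\<lambda>g. x g - y g) v K = coord x v K - coord y v K"
  by (simp add: coord_def sum_subtractf right_diff_distrib)

lemma coord_zero: "coord (\<lambda>g. 0) v K = 0"
  by (simp add: coord_def)

lemma coord_mult_Xa:
  assumes p: "p \<in> edges D" and v: "v \<subseteq> {..<n}" and K: "compatible v K"
  shows "coord (mult_Xa c D p x) v K = (if p \<in> K then c * coord x v K else 0)"
proof -
  let ?\<gamma> = "circle_of D v p" and ?Q = "inside v K"
  have gen: "(v, S) \<in> generators D" if "S \<subseteq> ?Q" for S
    using that v by (auto simp: generators_def inside_def)
  have "coord (mult_Xa c D p x) v K =
      (\<Sum>S\<in>Pow ?Q. c ^ card S * (if ?\<gamma> \<in> S then x (v, S - {?\<gamma>}) + c * x (v, S) else 0))"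
    unfolding coord_def by (intro sum.cong refl) (simp add: mult_Xa_def gen)
  also have "\<dots> = (if p \<in> K then c * coord x v K else 0)"
  proof (cases "p \<in> K")
    case False
    then have "?\<gamma> \<notin> ?Q" using circle_of_inside[OF p K] by simp
    then have "c ^ card S * (if ?\<gamma> \<in> S then x (v, S - {?\<gamma>}) + c * x (v, S) else 0) = 0" if "S \<in> Pow ?Q" for S
      using that by auto
    then show ?thesis using False by (simp add: sum.neutral)
  next
    case True
    then have g: "?\<gamma> \<in> ?Q" using circle_of_inside[OF p K] by simp
    define Q where "Q = ?Q - {?\<gamma>}"
    have Q: "?Q = insert ?\<gamma> Q" "?\<gamma> \<notin> Q" "finite Q" using g by (auto simp: Q_def)
    have nin: "?\<gamma> \<notin> S" "finite S" if "S \<in> Pow Q" for S using that Q(2,3) finite_subset by auto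
    have "coord x v K = (\<Sum>S\<in>Pow Q. c ^ card S * x (v, S)) + (\<Sum>S\<in>Pow Q. c * c ^ card S * x (v, insert ?\<gamma> S))"
      unfolding coord_def Q(1) sum_Pow_insert[OF Q(3,2)]
      by (intro arg_cong2[where f = "(+)"] sum.cong refl) (use nin in auto)
    moreover have "(\<Sum>S\<in>Pow ?Q. c ^ card S * (if ?\<gamma> \<in> S then x (v, S - {?\<gamma>}) + c * x (v, S) else 0)) =
       0 + (\<Sum>S\<in>Pow Q. c * c ^ card S * (x (v, S) + c * x (v, insert ?\<gamma> S)))"
      unfolding Q(1) sum_Pow_insert[OF Q(3,2)]
      by (intro arg_cong2[where f = "(+)"] sum.cong sum.neutral refl) (use nin in auto)
    ultimately show ?thesis using True
      by (simp add: sum.distrib distrib_left sum_distrib_left mult_ac)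
  qed
  finally show ?thesis .
qed

lemma coord_mult_Xb:
  assumes p: "p \<in> edges D" and v: "v \<subseteq> {..<n}" and K: "compatible v K"
  shows "coord (mult_Xb c D p x) v K = (if p \<in> K then 0 else - c * coord x v K)"
  unfolding mult_Xb_def coord_diff coord_scale coord_mult_Xa[OF assms] by simp

section \<open>The conjugation\<close>

text \<open>
  Along an edge of the cube the number of 1-resolved crossings grows by one and the number of circles
  grows or falls by one. So half of their sum, rounded down, grows by one along a split and stays the same along a merge.
\<close>

definition state_sign :: "nat set \<Rightarrow> 'r" where
  "state_sign v = (- 1) ^ ((card v + card (circles D v)) div 2)"

text \<open>
  The substitution \<open>X \<mapsto> c - X\<close> in all tensor factors, expanded in the basis, times \<open>state_sign\<close>.
\<close>

definition conjugate :: "'r chain \<Rightarrow> 'r chain" where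
  "conjugate x = (\<lambda>(v, T). if (v, T) \<in> generators D
     then \<Sum>S\<in>Pow (circles D v). if T \<subseteq> S then state_sign v * (- 1) ^ card T * c ^ (card S - card T) * x (v, S) else 0
     else 0)"

lemma linear_conjugate: "linear_map conjugate"
proof -
  have "(\<Sum>S\<in>Pow (circles D v). if T \<subseteq> S then state_sign v * (- 1) ^ card T * c ^ (card S - card T) * (r * x (v, S) + s * y (v, S)) else 0)
    = r * (\<Sum>S\<in>Pow (circles D v). if T \<subseteq> S then state_sign v * (- 1) ^ card T * c ^ (card S - card T) * x (v, S) else 0)
    + s * (\<Sum>S\<in>Pow (circles D v). if T \<subseteq> S then state_sign v * (- 1) ^ card T * c ^ (card S - card T) * y (v, S) else 0)"
    for v T r s and x y :: "'r chain"
    unfolding sum_distrib_left sum.distrib[symmetric]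
    by (intro sum.cong refl) (simp add: algebra_simps)
  then show ?thesis by (auto simp: linear_map_def conjugate_def fun_eq_iff)
qed

lemma conjugate_in_chains: "conjugate x \<in> chains D"
  by (auto simp: chains_iff conjugate_def)

lemma compatible_compl: "compatible v (- K) \<longleftrightarrow> compatible v K"
  unfolding compatible_def by blast

text \<open>
  Evaluating \<open>c - X\<close> at \<open>0\<close> or \<open>c\<close> amounts to evaluating \<open>X\<close> at \<open>c\<close> or \<open>0\<close>. In the basis, the alternating sum
  over the subsets of \<open>inside v K \<inter> S\<close> leaves only those \<open>S\<close> that avoid \<open>inside v K\<close>.
\<close>

lemma coord_conjugate:
  assumes v: "v \<subseteq> {..<n}" and K: "compatible v K"
  shows "coord (conjugate x) v K = state_sign v * coord x v (- K)"
proof -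
  let ?Q = "inside v K" and ?P = "circles D v"
  have gen: "(v, S) \<in> generators D" if "S \<subseteq> ?Q" for S
    using that v by (auto simp: generators_def inside_def)
  have fin: "finite S" if "S \<subseteq> ?P" for S using that finite_circles finite_subset by blast
  have "coord (conjugate x) v K = (\<Sum>T\<in>Pow ?Q. \<Sum>S\<in>Pow ?P. if T \<subseteq> S
      then state_sign v * (- 1) ^ card T * c ^ card S * x (v, S) else 0)"
    unfolding coord_def
  proof (intro sum.cong refl)
    fix T assume T: "T \<in> Pow ?Q"
    have "c ^ card T * (if T \<subseteq> S then state_sign v * (- 1) ^ card T * c ^ (card S - card T) * x (v, S) else 0) =
        (if T \<subseteq> S then state_sign v * (- 1) ^ card T * c ^ card S * x (v, S) else 0)" if "S \<in> Pow ?P" for S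
    proof (cases "T \<subseteq> S")
      case True
      then have "card T \<le> card S" using fin that by (intro card_mono) auto
      then have "c ^ card T * c ^ (card S - card T) = c ^ card S" by (simp flip: power_add)
      then show ?thesis using True by (simp add: mult_ac)
    qed simp
    then show "c ^ card T * conjugate x (v, T) = (\<Sum>S\<in>Pow ?P. if T \<subseteq> S
      then state_sign v * (- 1) ^ card T * c ^ card S * x (v, S) else 0)"
      using gen T by (simp add: conjugate_def sum_distrib_left)
  qed
  also have "\<dots> = (\<Sum>S\<in>Pow ?P. \<Sum>T\<in>Pow ?Q. if T \<subseteq> S
      then state_sign v * (- 1) ^ card T * c ^ card S * x (v, S) else 0)"
    by (rule sum.swap)
  also have "\<dots> = (\<Sum>S\<in>Pow ?P. if S \<in> Pow (inside v (- K)) then state_sign v * (c ^ card S * x (v, S)) else 0)"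
  proof (intro sum.cong refl)
    fix S assume S: "S \<in> Pow ?P"
    have "(\<Sum>T\<in>Pow ?Q. if T \<subseteq> S then state_sign v * (- 1) ^ card T * c ^ card S * x (v, S) else 0) =
        (\<Sum>T\<in>Pow ?Q \<inter> {T. T \<subseteq> S}. state_sign v * (- 1) ^ card T * c ^ card S * x (v, S))"
      by (simp add: sum.inter_restrict)
    also have "Pow ?Q \<inter> {T. T \<subseteq> S} = Pow (?Q \<inter> S)" by auto
    also have "(\<Sum>T\<in>Pow (?Q \<inter> S). state_sign v * (- 1) ^ card T * c ^ card S * x (v, S)) =
        state_sign v * (c ^ card S * x (v, S)) * (\<Sum>T\<in>Pow (?Q \<inter> S). (- 1) ^ card T)"
      by (simp add: sum_distrib_left mult_ac)
    also have "\<dots> = (if ?Q \<inter> S = {} then state_sign v * (c ^ card S * x (v, S)) else 0)"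
      by (subst sum_alternating_Pow) auto
    also have "?Q \<inter> S = {} \<longleftrightarrow> S \<in> Pow (inside v (- K))"
    proof -
      have "\<gamma> \<notin> ?Q \<longleftrightarrow> \<gamma> \<in> inside v (- K)" if "\<gamma> \<in> S" for \<gamma>
      proof -
        have g: "\<gamma> \<in> ?P" using that S by auto
        then have "\<gamma> \<noteq> {}" "\<gamma> \<subseteq> K \<or> \<gamma> \<inter> K = {}" using circle_nonempty K by (auto simp: compatible_def)
        then show ?thesis using g unfolding inside_def by auto
      qed
      then show ?thesis by auto
    qed
    finally show "(\<Sum>T\<in>Pow ?Q. if T \<subseteq> S then state_sign v * (- 1) ^ card T * c ^ card S * x (v, S) else 0) =
      (if S \<in> Pow (inside v (- K)) then state_sign v * (c ^ card S * x (v, S)) else 0)" .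
  qed
  also have "\<dots> = (\<Sum>S\<in>Pow ?P \<inter> Pow (inside v (- K)). state_sign v * (c ^ card S * x (v, S)))"
    by (simp add: sum.inter_restrict)
  also have "Pow ?P \<inter> Pow (inside v (- K)) = Pow (inside v (- K))" by (auto simp: inside_def)
  finally show ?thesis by (simp add: coord_def sum_distrib_left)
qed

lemma card_remove_Suc: "w \<subseteq> {..<n} \<Longrightarrow> i \<in> w \<Longrightarrow> card w = card (w - {i}) + 1"
  by (metis Suc_eq_plus1 card.remove finite_lessThan finite_subset)

text \<open>
  Exchanging the two colors changes the sign of the weight of a split and no other weight, and
  \<open>state_sign\<close> changes sign exactly along splits.
\<close>

lemma weight_compl:
  assumes w: "w \<subseteq> {..<n}" "i \<in> w"
  shows "state_sign w * weight (w - {i}) w (- K) = state_sign (w - {i}) * weight (w - {i}) w K"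
  using adjacent_states[OF w]
proof
  let ?v = "w - {i}"
  assume m: "merges_to (circles D ?v) (circles D w)"
  have cd: "card (circles D ?v) = card (circles D w) + 1" using merges_to_parts[OF m partition] by metis
  then have "card w + card (circles D w) = card ?v + card (circles D ?v)" using card_remove_Suc[OF w] by simp
  then show ?thesis using cd by (simp add: weight_def state_sign_def)
next
  let ?v = "w - {i}"
  assume m: "merges_to (circles D w) (circles D ?v)"
  have cd: "card (circles D w) = card (circles D ?v) + 1" using merges_to_parts[OF m partition] by metis
  then have "card w + card (circles D w) = card ?v + card (circles D ?v) + 2" using card_remove_Suc[OF w] by simp
  then have s: "state_sign w = - state_sign ?v" by (simp add: state_sign_def)
  obtain \<gamma> where "\<gamma> \<in> circles D w - circles D ?v"
  proof -
    have "\<not> circles D w \<subseteq> circles D ?v" using cd card_mono[OF finite_circles, of "circles D w" ?v] by auto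
    then show thesis using that by auto
  qed
  moreover from this have "\<gamma> \<noteq> {}" using circle_nonempty by auto
  ultimately have "\<not> ((\<forall>\<gamma>\<in>circles D w - circles D ?v. \<gamma> \<subseteq> K) \<and> (\<forall>\<gamma>\<in>circles D w - circles D ?v. \<gamma> \<inter> K = {}))"
    by blast
  moreover have "\<gamma> \<subseteq> - K \<longleftrightarrow> \<gamma> \<inter> K = {}" "\<gamma> \<inter> - K = {} \<longleftrightarrow> \<gamma> \<subseteq> K" for \<gamma> :: "nat set" by auto
  ultimately show ?thesis using cd s by (auto simp: weight_def)
qed

lemma conjugate_differential:
  assumes "x \<in> chains D"
  shows "conjugate (differential c D x) = differential c D (conjugate x)"
proof (rule chain_eqI[OF conjugate_in_chains differential_in_chains])
  fix w K assume w: "w \<subseteq> {..<n}" and K: "compatible w K"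
  have "state_sign w * (weight (w - {i}) w (- K) * coord x (w - {i}) (- K)) =
      weight (w - {i}) w K * coord (conjugate x) (w - {i}) K" if i: "i \<in> w" for i
  proof (cases "weight (w - {i}) w K = 0")
    case True
    then have "state_sign w * weight (w - {i}) w (- K) = 0" using weight_compl[OF w i, of K] by simp
    then show ?thesis using True by (metis mult.assoc mult_zero_left)
  next
    case False
    then have "compatible (w - {i}) K" using weight_compatible[OF adjacent_states[OF w i] K] by simp
    then have "coord (conjugate x) (w - {i}) K = state_sign (w - {i}) * coord x (w - {i}) (- K)"
      using coord_conjugate[of "w - {i}" K x] w by auto
    then show ?thesis using weight_compl[OF w i, of K] by (simp add: mult_ac)
  qed
  then have "(\<Sum>i\<in>w. (- 1) ^ card {j\<in>w. j < i} * (state_sign w * (weight (w - {i}) w (- K) * coord x (w - {i}) (- K)))) =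
     (\<Sum>i\<in>w. (- 1) ^ card {j\<in>w. j < i} * (weight (w - {i}) w K * coord (conjugate x) (w - {i}) K))"
    by (intro sum.cong refl) simp
  then show "coord (conjugate (differential c D x)) w K = coord (differential c D (conjugate x)) w K"
    unfolding coord_conjugate[OF w K] coord_differential[OF w K]
      coord_differential[OF w K[folded compatible_compl[of w K]]]
    by (simp add: sum_distrib_left mult.left_commute)
qed

section \<open>The Lee cycle\<close>

abbreviation seifert :: "nat set" where "seifert \<equiv> seifert_state D"

lemma seifert_subset: "seifert \<subseteq> {..<n}"
  by (auto simp: seifert_state_def)

lemma black_left_circle:
  assumes "\<gamma> \<in> circles D seifert" "e \<in> \<gamma>" "e' \<in> \<gamma>"
  shows "black_left D e = black_left D e'"
proof -
  let ?r = "resolutions D {..<n} seifert"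
  obtain u where u: "\<gamma> = conn ?r `` {u}" using assms(1) unfolding circles_conv by (rule componentsE)
  have step: "black_left D a = black_left D b" if ab_r: "(a, b) \<in> ?r" for a b
  proof -
    obtain i where i: "i < n" and ab: "(a, b) \<in> resolution (crossings D ! i) (i \<in> seifert)"
      using ab_r by (auto simp: resolutions_def)
    have "(a, b) \<in> {(in_left (crossings D ! i), out_left (crossings D ! i)),
        (in_right (crossings D ! i), out_right (crossings D ! i))}"
      using ab i by (cases "is_positive (crossings D ! i)") (auto simp: resolution_def seifert_state_def)
    then show ?thesis using black_left_crossing[OF knot nth_mem[OF i]] by auto
  qed
  have "black_left D e'' = black_left D u" if "e'' \<in> \<gamma>" for e''
    by (rule conn_invariant[of e'' u ?r]) (use that u step conn_sym in auto)
  then show ?thesis using assms(2,3) by metis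
qed

lemma colored_a_iff: "\<gamma> \<in> circles D seifert \<Longrightarrow> e \<in> \<gamma> \<Longrightarrow> colored_a D \<gamma> \<longleftrightarrow> black_left D e"
  using black_left_circle unfolding colored_a_def by metis

lemma lee_cycle_in_chains: "lee_cycle c D \<in> chains D"
  using seifert_subset by (auto simp: chains_iff lee_cycle_def generators_def)

text \<open>
  At each circle of color \<open>a\<close> the Lee cycle has the factor \<open>X\<close>, which vanishes at \<open>0\<close>, and at the others
  \<open>X - c\<close>, which vanishes at \<open>c\<close>. So it is concentrated on one single coloring, the checkerboard coloring
  of the Seifert circles.
\<close>

lemma coord_lee_cycle_nonzero:
  assumes K: "compatible v K" and nz: "coord (lee_cycle c D) v K \<noteq> 0" and e: "e \<in> edges D"
  shows "v = seifert" "e \<in> K \<longleftrightarrow> black_left D e"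
proof -
  show v: "v = seifert"
  proof (rule ccontr)
    assume "v \<noteq> seifert"
    then have "coord (lee_cycle c D) v K = 0" by (simp add: coord_def lee_cycle_def)
    then show False using nz by simp
  qed
  let ?P = "circles D seifert" and ?Q = "inside seifert K"
  let ?u = "\<lambda>\<gamma>. if colored_a D \<gamma> then 0 else - c"
  have Q: "?Q \<subseteq> ?P" by (auto simp: inside_def)
  have "coord (lee_cycle c D) seifert K = (\<Sum>S\<in>Pow ?Q. (\<Prod>\<gamma>\<in>?P - ?Q. ?u \<gamma>) * ((\<Prod>\<gamma>\<in>S. c) * (\<Prod>\<gamma>\<in>?Q - S. ?u \<gamma>)))"
    unfolding coord_def
  proof (intro sum.cong refl)
    fix S assume S: "S \<in> Pow ?Q"
    have "(\<Prod>\<gamma>\<in>?P. if \<gamma> \<in> S then 1 else ?u \<gamma>) = (\<Prod>\<gamma>\<in>?P - S. ?u \<gamma>)"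
      by (rule prod.mono_neutral_cong_right) (use S Q in auto)
    also have "?P - S = (?P - ?Q) \<union> (?Q - S)" using S Q by auto
    also have "(\<Prod>\<gamma>\<in>(?P - ?Q) \<union> (?Q - S). ?u \<gamma>) = (\<Prod>\<gamma>\<in>?P - ?Q. ?u \<gamma>) * (\<Prod>\<gamma>\<in>?Q - S. ?u \<gamma>)"
      by (rule prod.union_disjoint) auto
    finally show "c ^ card S * lee_cycle c D (seifert, S) =
        (\<Prod>\<gamma>\<in>?P - ?Q. ?u \<gamma>) * ((\<Prod>\<gamma>\<in>S. c) * (\<Prod>\<gamma>\<in>?Q - S. ?u \<gamma>))"
      using S Q by (auto simp: lee_cycle_def mult_ac)
  qed
  also have "\<dots> = (\<Prod>\<gamma>\<in>?P - ?Q. ?u \<gamma>) * (\<Prod>\<gamma>\<in>?Q. c + ?u \<gamma>)"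
    by (simp add: prod_add[OF finite_inside] sum_distrib_left)
  finally have prods: "(\<Prod>\<gamma>\<in>?P - ?Q. ?u \<gamma>) \<noteq> 0" "(\<Prod>\<gamma>\<in>?Q. c + ?u \<gamma>) \<noteq> 0" using nz v by auto
  let ?\<gamma> = "circle_of D seifert e"
  have "?\<gamma> \<in> ?Q \<longleftrightarrow> colored_a D ?\<gamma>"
  proof (cases "?\<gamma> \<in> ?Q")
    case True
    then have "c + ?u ?\<gamma> \<noteq> 0" using prods(2) prod_zero[OF finite_inside, of seifert K "\<lambda>\<gamma>. c + ?u \<gamma>"] by blast
    then show ?thesis using True by (auto split: if_splits)
  next
    case False
    then have "?\<gamma> \<in> ?P - ?Q" using circle_of(1)[OF e] by simp
    moreover have "finite (?P - ?Q)" by simp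
    ultimately have "?u ?\<gamma> \<noteq> 0" using prods(1) prod_zero[of "?P - ?Q" ?u] by blast
    then show ?thesis using False by (auto split: if_splits)
  qed
  then show "e \<in> K \<longleftrightarrow> black_left D e"
    using circle_of_inside[OF e] K v colored_a_iff[OF circle_of[OF e]] by simp
qed

text \<open>
  An edge of the cube leaving the Seifert state joins the two Seifert arcs at a crossing. They have
  different colors, so the only coloring on which the Lee cycle lives does not extend over the edge.
\<close>

lemma differential_lee_cycle: "differential c D (lee_cycle c D) = (\<lambda>_. 0)"
proof (rule chain_eqI[OF differential_in_chains])
  show "(\<lambda>_. 0) \<in> chains D" by (simp add: chains_iff)
  fix w K assume w: "w \<subseteq> {..<n}" and K: "compatible w K"
  have "weight (w - {i}) w K * coord (lee_cycle c D) (w - {i}) K = 0" if i: "i \<in> w" for i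
  proof (rule ccontr)
    assume nz: "\<not> ?thesis"
    then have "compatible (w - {i}) K" using weight_compatible[OF adjacent_states[OF w i] K] by auto
    note lee = coord_lee_cycle_nonzero[OF this]
    have iw: "i < n" using w i by auto
    let ?x = "crossings D ! i"
    note E = ends_in_edges[OF knot nth_mem[OF iw]]
    have "w - {i} = seifert" using lee(1)[OF _ E(1)] nz by auto
    then have "i \<notin> seifert" by auto
    then have pos: "is_positive ?x" using iw by (auto simp: seifert_state_def)
    have K': "in_left ?x \<in> K \<longleftrightarrow> black_left D (in_left ?x)" "in_right ?x \<in> K \<longleftrightarrow> black_left D (in_right ?x)"
      using lee(2)[OF _ E(1)] lee(2)[OF _ E(2)] nz by auto
    let ?\<gamma> = "conn (resolutions D {..<n} w) `` {in_left ?x}"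
    have "(in_left ?x, in_right ?x) \<in> resolutions D {..<n} w"
      unfolding resolutions_def using iw i pos by (auto simp: resolution_def intro!: bexI[of _ i])
    then have "in_left ?x \<in> ?\<gamma>" "in_right ?x \<in> ?\<gamma>" by (simp_all add: conn_base)
    moreover have "?\<gamma> \<in> circles D w" unfolding circles_conv by (rule componentsI[OF E(1)])
    ultimately have "in_left ?x \<in> K \<longleftrightarrow> in_right ?x \<in> K" using K unfolding compatible_def by blast
    then show False using K' black_left_crossing(2)[OF knot nth_mem[OF iw]] by simp
  qed
  then show "coord (differential c D (lee_cycle c D)) w K = coord (\<lambda>_. 0) w K"
    unfolding coord_differential[OF w K] coord_zero by (simp add: sum.neutral)
qed

section \<open>The reduced complex\<close>

definition project :: "nat \<Rightarrow> 'r chain \<Rightarrow> 'r chain" where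
  "project p = (if black_left D p then mult_Xa c D p else mult_Xb c D p)"

text \<open>
  The value of the factor \<open>X\<close> or \<open>X - c\<close> of the projection on the colorings that it does not annihilate.
\<close>

definition eigenvalue :: "nat \<Rightarrow> 'r" where
  "eigenvalue p = (if black_left D p then c else - c)"

lemma linear_project: "linear_map (project p)"
  by (simp add: project_def linear_mult_Xa linear_mult_Xb)

lemma project_in_chains: "x \<in> chains D \<Longrightarrow> project p x \<in> chains D"
  by (simp add: project_def mult_Xa_in_chains mult_Xb_in_chains)

lemma coord_project:
  assumes "p \<in> edges D" "v \<subseteq> {..<n}" "compatible v K"
  shows "coord (project p x) v K = (if p \<in> K \<longleftrightarrow> black_left D p then eigenvalue p * coord x v K else 0)"
  unfolding project_def eigenvalue_def using coord_mult_Xa[OF assms] coord_mult_Xb[OF assms] by simp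

lemma reduced_carrier:
  assumes "p \<in> edges D"
  shows "carrier (reduced_chain_module c D p) = project p ` chains D"
  using colored_a_iff[OF circle_of[OF assms]]
  by (simp add: reduced_chain_module_def project_def)

lemma project_differential:
  assumes p: "p \<in> edges D" and x: "x \<in> chains D"
  shows "project p (differential c D x) = differential c D (project p x)"
proof (rule chain_eqI[OF project_in_chains[OF differential_in_chains] differential_in_chains])
  fix w K assume w: "w \<subseteq> {..<n}" and K: "compatible w K"
  have "weight (w - {i}) w K * coord (project p x) (w - {i}) K =
      (if p \<in> K \<longleftrightarrow> black_left D p then eigenvalue p else 0) * (weight (w - {i}) w K * coord x (w - {i}) K)"
    if i: "i \<in> w" for i
  proof (cases "weight (w - {i}) w K = 0")
    case False
    then have "compatible (w - {i}) K" using weight_compatible[OF adjacent_states[OF w i] K] by simp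
    moreover have "w - {i} \<subseteq> {..<n}" using w by auto
    ultimately show ?thesis using coord_project[OF p, of "w - {i}" K x] by simp
  qed simp
  then have "(\<Sum>i\<in>w. (- 1) ^ card {j\<in>w. j < i} * (weight (w - {i}) w K * coord (project p x) (w - {i}) K)) =
    (\<Sum>i\<in>w. (- 1) ^ card {j\<in>w. j < i} * ((if p \<in> K \<longleftrightarrow> black_left D p then eigenvalue p else 0) * (weight (w - {i}) w K * coord x (w - {i}) K)))"
    by (intro sum.cong refl) simp
  then show "coord (project p (differential c D x)) w K = coord (differential c D (project p x)) w K"
    unfolding coord_project[OF p w K] coord_differential[OF w K]
    by (simp add: sum_distrib_left mult.left_commute)
qed

text \<open>
  The kernel of the other one of \<open>X\<close> and \<open>X - c\<close> is the image of \<open>project\<close>. A preimage is obtained by reading the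
  coefficients at the generators labelled \<open>X\<close> at the marked circle as coefficients at the corresponding
  generators labelled \<open>1\<close>.
\<close>

lemma mem_reducedI:
  assumes p: "p \<in> edges D" and x: "x \<in> chains D"
    and vanish: "\<And>v K. v \<subseteq> {..<n} \<Longrightarrow> compatible v K \<Longrightarrow> (p \<in> K) \<noteq> black_left D p \<Longrightarrow> coord x v K = 0"
  shows "x \<in> project p ` chains D"
proof -
  let ?g = "\<lambda>v. circle_of D v p"
  define y where "y = (\<lambda>(v, S). if ?g v \<in> S then 0 else x (v, insert (?g v) S))"
  have gen: "(v, insert (?g v) S) \<in> generators D \<longleftrightarrow> (v, S) \<in> generators D" for v S
    using circle_of(1)[OF p, of v] by (auto simp: generators_def)
  have y: "y \<in> chains D" using x gen by (auto simp: chains_iff y_def)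
  have zero: "(if black_left D p then mult_Xb c D p x else mult_Xa c D p x) = (\<lambda>_. 0)"
  proof (rule chain_eqI)
    show "(if black_left D p then mult_Xb c D p x else mult_Xa c D p x) \<in> chains D"
      using x by (simp add: mult_Xa_in_chains mult_Xb_in_chains)
    show "(\<lambda>_. 0) \<in> chains D" by (simp add: chains_iff)
    show "coord (if black_left D p then mult_Xb c D p x else mult_Xa c D p x) v K = coord (\<lambda>_. 0) v K"
      if "v \<subseteq> {..<n}" "compatible v K" for v K
      using vanish[OF that] coord_mult_Xa[OF p that] coord_mult_Xb[OF p that] by (auto simp: coord_zero)
  qed
  have out: "x (v, S) = 0" if "(v, S) \<notin> generators D" for v S using x that by (simp add: chains_iff)
  have "project p y (v, S) = x (v, S)" for v S
  proof (cases "(v, S) \<in> generators D")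
    case True
    show ?thesis
    proof (cases "black_left D p")
      case bl: True
      have "x (v, S) = 0" if "?g v \<notin> S"
        using fun_cong[OF zero, of "(v, S)"] bl True that c_nz by (simp add: mult_Xb_def mult_Xa_def)
      then show ?thesis using bl True
        by (auto simp: project_def mult_Xa_def y_def insert_absorb)
    next
      case bl: False
      have "x (v, S) = - c * x (v, insert (?g v) S)" if "?g v \<notin> S"
        using fun_cong[OF zero, of "(v, insert (?g v) S)"] bl True that gen
        by (simp add: mult_Xa_def eq_neg_iff_add_eq_0)
      then show ?thesis using bl True
        by (auto simp: project_def mult_Xb_def mult_Xa_def y_def insert_absorb)
    qed
  next
    case False
    then show ?thesis using out[OF False] project_in_chains[OF y, of p] by (simp add: chains_iff)
  qed
  then have "project p y = x" by auto
  then show ?thesis using y by (metis imageI)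
qed

lemma lee_cycle_reduced:
  assumes p: "p \<in> edges D"
  shows "lee_cycle c D \<in> project p ` chains D"
  using coord_lee_cycle_nonzero(2)[OF _ _ p]
  by (intro mem_reducedI[OF p lee_cycle_in_chains]) blast

lemma project_lee_cycle:
  assumes p: "p \<in> edges D"
  shows "project p (lee_cycle c D) = (\<lambda>g. eigenvalue p * lee_cycle c D g)"
proof (rule chain_eqI[OF project_in_chains[OF lee_cycle_in_chains] chains_scale[OF lee_cycle_in_chains]])
  fix v K assume vK: "v \<subseteq> {..<n}" "compatible v K"
  show "coord (project p (lee_cycle c D)) v K = coord (\<lambda>g. eigenvalue p * lee_cycle c D g) v K"
    unfolding coord_project[OF p vK] coord_scale using coord_lee_cycle_nonzero(2)[OF vK(2) _ p] by auto
qed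

lemma project_conjugate_lee_cycle:
  assumes p: "p \<in> edges D"
  shows "project p (conjugate (lee_cycle c D)) = (\<lambda>_. 0)"
proof (rule chain_eqI[OF project_in_chains[OF conjugate_in_chains]])
  show "(\<lambda>_. 0) \<in> chains D" by (simp add: chains_iff)
  fix v K assume vK: "v \<subseteq> {..<n}" "compatible v K"
  show "coord (project p (conjugate (lee_cycle c D))) v K = coord (\<lambda>_. 0) v K"
    unfolding coord_project[OF p vK] coord_conjugate[OF vK] coord_zero
    using coord_lee_cycle_nonzero(2)[OF vK(2)[folded compatible_compl[of v K]] _ p] by auto
qed

section \<open>From divisibility in the full complex to divisibility in the reduced complex\<close>

text \<open>
  Apply \<open>f = project p \<circ> (\<epsilon> J - 1)\<close>, where \<open>J\<close> is the conjugation, to the relation between \<open>\<alpha>\<close> and \<open>c\<^sup>k y\<close>. On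
  the Lee cycle \<open>f\<close> is \<open>\<mp>c\<close>, and on \<open>y\<close> it is divisible by \<open>c\<close>. The common factor \<open>c\<close> moves into the annihilator \<open>r\<close>.
\<close>

lemma divide_reduced:
  assumes p: "p \<in> edges D"
    and y: "y \<in> chains D" "differential c D y = (\<lambda>_. 0)"
    and z: "z \<in> chains D" and r: "r \<noteq> 0"
    and tors: "(\<lambda>g. r * (lee_cycle c D g - c ^ k * y g)) = differential c D z"
    and \<epsilon>: "\<And>g. c dvd \<epsilon> * conjugate y g - y g"
  shows "\<exists>y'\<in>project p ` chains D. differential c D y' = (\<lambda>_. 0) \<and> (\<exists>r'. r' \<noteq> 0 \<and>
    (\<exists>z'\<in>project p ` chains D. (\<lambda>g. r' * (lee_cycle c D g - c ^ k * y' g)) = differential c D z'))"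
proof -
  define f where "f x = project p (\<lambda>g. \<epsilon> * conjugate x g - x g)" for x
  have lin: "linear_map f"
    unfolding linear_map_def f_def
  proof (intro allI)
    fix r s and x y :: "'r chain"
    have "(\<lambda>g. \<epsilon> * conjugate (\<lambda>g. r * x g + s * y g) g - (r * x g + s * y g)) =
        (\<lambda>g. r * (\<epsilon> * conjugate x g - x g) + s * (\<epsilon> * conjugate y g - y g))"
      unfolding linear_mapD[OF linear_conjugate] by (simp add: algebra_simps)
    then show "project p (\<lambda>g. \<epsilon> * conjugate (\<lambda>g. r * x g + s * y g) g - (r * x g + s * y g)) =
      (\<lambda>g. r * project p (\<lambda>g. \<epsilon> * conjugate x g - x g) g + s * project p (\<lambda>g. \<epsilon> * conjugate y g - y g) g)"
      by (simp add: linear_mapD[OF linear_project])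
  qed
  have ch: "(\<lambda>g. \<epsilon> * conjugate x g - x g) \<in> chains D" if "x \<in> chains D" for x
    using that chains_combine[OF conjugate_in_chains that, where r = \<epsilon> and s = "- 1"] by simp
  have f_mem: "f x \<in> project p ` chains D" if "x \<in> chains D" for x
    using ch[OF that] by (simp add: f_def)
  have f_d: "f (differential c D x) = differential c D (f x)" if "x \<in> chains D" for x
  proof -
    have "(\<lambda>g. \<epsilon> * differential c D (conjugate x) g - differential c D x g) =
        differential c D (\<lambda>g. \<epsilon> * conjugate x g - x g)"
      using linear_mapD[OF linear_differential, of c D \<epsilon> "conjugate x" "- 1" x] by simp
    then show ?thesis
      unfolding f_def conjugate_differential[OF that] by (simp add: project_differential[OF p ch[OF that]])
  qed
  have "\<forall>g. \<exists>a. \<epsilon> * conjugate y g - y g = c * a" using \<epsilon> by (simp add: dvd_def)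
  then obtain w where w: "\<And>g. \<epsilon> * conjugate y g - y g = c * w g" by metis
  have "w \<in> chains D"
  proof -
    have "c * w g = 0" if "g \<notin> generators D" for g
      using ch[OF y(1)] that unfolding w chains_iff by metis
    then show ?thesis using c_nz unfolding chains_iff by simp
  qed
  define u where "u = project p w"
  have fy: "f y = (\<lambda>g. c * u g)"
    unfolding f_def w u_def by (rule linear_map_scale[OF linear_project])
  have f_lee: "f (lee_cycle c D) = (\<lambda>g. - eigenvalue p * lee_cycle c D g)"
    unfolding f_def
    using linear_mapD[OF linear_project, of p \<epsilon> "conjugate (lee_cycle c D)" "- 1" "lee_cycle c D"]
    by (simp add: project_conjugate_lee_cycle[OF p] project_lee_cycle[OF p])
  define \<sigma> :: 'r where "\<sigma> = (if black_left D p then 1 else - 1)"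
  have \<sigma>: "eigenvalue p = \<sigma> * c" "\<sigma> * \<sigma> = 1" by (auto simp: \<sigma>_def eigenvalue_def)
  have "f (differential c D z) = f (\<lambda>g. r * lee_cycle c D g + (- r * c ^ k) * y g)"
    unfolding tors[symmetric] by (rule arg_cong[where f = f]) (simp add: algebra_simps)
  also have "\<dots> = (\<lambda>g. - (r * \<sigma> * c * lee_cycle c D g) - r * c * c ^ k * u g)"
    unfolding linear_mapD[OF lin] fy f_lee \<sigma> by (simp add: algebra_simps)
  finally have fz: "differential c D (f z) = (\<lambda>g. - (r * \<sigma> * c * lee_cycle c D g) - r * c * c ^ k * u g)"
    using f_d[OF z] by simp
  \<comment> \<open>The sign makes the coefficient of the Lee cycle in the relation positive.\<close>
  define y' where "y' = (\<lambda>g. - \<sigma> * u g)"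
  define z' where "z' = (\<lambda>g. - \<sigma> * f z g)"
  have scaled: "(\<lambda>g. a * x g) \<in> project p ` chains D" if x: "x \<in> project p ` chains D" for a x
  proof -
    obtain x0 where x0: "x0 \<in> chains D" "x = project p x0" using x by (elim imageE) auto
    have "(\<lambda>g. a * x g) = project p (\<lambda>g. a * x0 g)" unfolding x0(2) linear_map_scale[OF linear_project] ..
    then show ?thesis using chains_scale[OF x0(1)] by simp
  qed
  have "y' \<in> project p ` chains D"
    unfolding y'_def u_def by (rule scaled) (use \<open>w \<in> chains D\<close> in simp)
  moreover have "z' \<in> project p ` chains D"
    unfolding z'_def by (rule scaled[OF f_mem[OF z]])
  moreover have "differential c D y' = (\<lambda>_. 0)"
  proof -
    have "(\<lambda>g. c * differential c D u g) = differential c D (f y)"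
      unfolding fy by (rule linear_map_scale[OF linear_differential, symmetric])
    also have "\<dots> = f (\<lambda>_. 0)" using f_d[OF y(1)] y(2) by simp
    also have "\<dots> = (\<lambda>_. 0)" by (rule linear_map_zero[OF lin])
    finally have "differential c D u g = 0" for g using c_nz by (metis mult_eq_0_iff)
    then show ?thesis unfolding y'_def linear_map_scale[OF linear_differential] by simp
  qed
  moreover have "(\<lambda>g. (r * c) * (lee_cycle c D g - c ^ k * y' g)) = differential c D z'"
  proof -
    have "r * c * (lee_cycle c D g - c ^ k * y' g) = - \<sigma> * (- (r * \<sigma> * c * lee_cycle c D g) - r * c * c ^ k * u g)" for g
    proof -
      have "- \<sigma> * (- (r * \<sigma> * c * lee_cycle c D g) - r * c * c ^ k * u g)
          = (\<sigma> * \<sigma>) * (r * c * lee_cycle c D g) + \<sigma> * (r * c * c ^ k * u g)" by (simp add: algebra_simps)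
      then show ?thesis unfolding \<sigma>(2) y'_def by (simp add: algebra_simps)
    qed
    then show ?thesis unfolding z'_def linear_map_scale[OF linear_differential] fz by simp
  qed
  moreover have "r * c \<noteq> 0" using r c_nz by simp
  ultimately show ?thesis by blast
qed

end

section \<open>Divisibility modulo torsion in terms of chains\<close>

text \<open>
  Chains are functions with pointwise operations, so homology modulo torsion can be unfolded into a
  statement on functions.
\<close>

definition submodule_set :: "('g \<Rightarrow> 'r::comm_ring_1) set \<Rightarrow> bool" where
  "submodule_set N \<longleftrightarrow> (\<lambda>_. 0) \<in> N \<and> (\<forall>r s. \<forall>x\<in>N. \<forall>y\<in>N. (\<lambda>g. r * x g + s * y g) \<in> N)"

lemma submodule_setD: "submodule_set N \<Longrightarrow> x \<in> N \<Longrightarrow> y \<in> N \<Longrightarrow> (\<lambda>g. r * x g + s * y g) \<in> N"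
  by (simp add: submodule_set_def)

lemma submodule_set_zero: "submodule_set N \<Longrightarrow> (\<lambda>_. 0) \<in> N"
  by (simp add: submodule_set_def)

lemma submodule_set_scale: "submodule_set N \<Longrightarrow> x \<in> N \<Longrightarrow> (\<lambda>g. r * x g) \<in> N"
  using submodule_setD[of N x x r 0] by simp

lemma submodule_set_add: "submodule_set N \<Longrightarrow> x \<in> N \<Longrightarrow> y \<in> N \<Longrightarrow> (\<lambda>g. x g + y g) \<in> N"
  using submodule_setD[of N x y 1 1] by simp

lemma submodule_set_diff: "submodule_set N \<Longrightarrow> x \<in> N \<Longrightarrow> y \<in> N \<Longrightarrow> (\<lambda>g. x g - y g) \<in> N"
  using submodule_setD[of N x y 1 "- 1"] by simp

lemma submodule_set_image:
  assumes B: "submodule_set B" and f: "linear_map f"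
  shows "submodule_set (f ` B)"
  unfolding submodule_set_def
proof (intro conjI allI ballI)
  show "(\<lambda>_. 0) \<in> f ` B"
    using linear_map_zero[OF f] submodule_set_zero[OF B] by (metis imageI)
  fix r s x y assume "x \<in> f ` B" "y \<in> f ` B"
  then obtain u v where uv: "u \<in> B" "x = f u" "v \<in> B" "y = f v" by (elim imageE) auto
  have "(\<lambda>g. r * x g + s * y g) = f (\<lambda>g. r * u g + s * v g)"
    unfolding uv(2,4) linear_mapD[OF f] ..
  then show "(\<lambda>g. r * x g + s * y g) \<in> f ` B"
    using submodule_setD[OF B uv(1,3)] by simp
qed

definition translate :: "('g \<Rightarrow> 'r::comm_ring_1) set \<Rightarrow> ('g \<Rightarrow> 'r) \<Rightarrow> ('g \<Rightarrow> 'r) set" where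
  "translate N a = (\<lambda>x g. x g + a g) ` N"

definition torsion_mod :: "('g \<Rightarrow> 'r::comm_ring_1) set \<Rightarrow> ('g \<Rightarrow> 'r) \<Rightarrow> bool" where
  "torsion_mod N a \<longleftrightarrow> (\<exists>r. r \<noteq> 0 \<and> (\<lambda>g. r * a g) \<in> N)"

lemma translateI: "x \<in> N \<Longrightarrow> y = (\<lambda>g. x g + a g) \<Longrightarrow> y \<in> translate N a"
  unfolding translate_def by blast

lemma translate_eq:
  assumes N: "submodule_set N"
  shows "translate N a = translate N b \<longleftrightarrow> (\<lambda>g. a g - b g) \<in> N"
proof
  have "a \<in> translate N a"
    unfolding translate_def by (rule image_eqI[OF _ submodule_set_zero[OF N]]) simp
  moreover assume "translate N a = translate N b"
  ultimately have "a \<in> translate N b" by simp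
  then obtain x where x: "x \<in> N" "a = (\<lambda>g. x g + b g)" unfolding translate_def by (elim imageE) auto
  then show "(\<lambda>g. a g - b g) \<in> N" by simp
next
  have sub: "translate N a \<subseteq> translate N b" if ab: "(\<lambda>g. a g - b g) \<in> N" for a b
  proof
    fix y assume "y \<in> translate N a"
    then obtain x where x: "x \<in> N" "y = (\<lambda>g. x g + a g)" unfolding translate_def by (elim imageE) auto
    have "y = (\<lambda>g. (x g + (a g - b g)) + b g)" unfolding x(2) by simp
    then show "y \<in> translate N b"
      by (rule translateI[OF submodule_set_add[OF N x(1) ab]])
  qed
  assume ab: "(\<lambda>g. a g - b g) \<in> N"
  have "(\<lambda>g. b g - a g) \<in> N" using submodule_set_scale[OF N ab, of "- 1"] by simp
  then show "translate N a = translate N b" using sub[OF ab] sub by blast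
qed

lemma torsion_mod_combine:
  fixes N :: "('g \<Rightarrow> 'r::idom) set"
  assumes N: "submodule_set N" and "torsion_mod N a" "torsion_mod N b"
  shows "torsion_mod N (\<lambda>g. r * a g + s * b g)"
proof -
  obtain p q where pq: "p \<noteq> 0" "(\<lambda>g. p * a g) \<in> N" "q \<noteq> 0" "(\<lambda>g. q * b g) \<in> N"
    using assms(2,3) unfolding torsion_mod_def by metis
  have "(\<lambda>g. (p * q) * (r * a g + s * b g)) = (\<lambda>g. (q * r) * (p * a g) + (p * s) * (q * b g))"
    by (simp add: algebra_simps)
  also have "\<dots> \<in> N" by (rule submodule_setD[OF N pq(2,4)])
  finally have "(\<lambda>g. (p * q) * (r * a g + s * b g)) \<in> N" .
  moreover have "p * q \<noteq> 0" using pq(1,3) by simp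
  ultimately show ?thesis unfolding torsion_mod_def by blast
qed

lemma torsion_mod_zero: "submodule_set N \<Longrightarrow> torsion_mod N (\<lambda>_. 0 :: 'r::idom)"
  unfolding torsion_mod_def using submodule_set_zero[of N] by (intro exI[of _ 1]) simp

context
  fixes D :: diagram and B :: "'r::idom chain set" and d :: "'r chain \<Rightarrow> 'r chain"
  assumes B: "submodule_set B" and d: "linear_map d"
begin

definition "cycles = {x \<in> B. d x = (\<lambda>_. 0)}"
definition "boundaries = d ` B"
definition "hom_module = homology ((chain_module D)\<lparr>carrier := B\<rparr>) d"

lemma submodule_boundaries: "submodule_set boundaries"
  unfolding boundaries_def by (rule submodule_set_image[OF B d])

lemma submodule_cycles: "submodule_set cycles"
  unfolding submodule_set_def cycles_def
  using submodule_set_zero[OF B] submodule_setD[OF B] linear_map_zero[OF d] linear_mapD[OF d]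
  by simp

abbreviation "cls \<equiv> translate boundaries"
abbreviation "tors \<equiv> torsion_mod boundaries"

lemma a_r_coset_chain: "a_r_coset (chain_module D\<lparr>carrier := C\<rparr>) N a = translate N a"
  by (auto simp: a_r_coset_def' translate_def chain_module_def)

lemma hom_carrier: "carrier hom_module = cls ` cycles"
  by (auto simp: hom_module_def homology_def quotient_module_def A_RCOSETS_def' a_r_coset_chain
      boundaries_def cycles_def chain_module_def a_r_coset_chain[unfolded chain_module_def, simplified])

lemma hom_zero: "ring.zero hom_module = boundaries"
  by (simp add: hom_module_def homology_def quotient_module_def boundaries_def)

lemma hom_add: "cls a \<oplus>\<^bsub>hom_module\<^esub> cls b = cls (\<lambda>g. a g + b g)"
proof -
  have "cls a \<oplus>\<^bsub>hom_module\<^esub> cls b = (\<Union>h\<in>cls a. \<Union>k\<in>cls b. {\<lambda>g. h g + k g})"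
    by (simp add: hom_module_def homology_def quotient_module_def set_add_def' chain_module_def)
  also have "\<dots> = cls (\<lambda>g. a g + b g)"
  proof (intro equalityI subsetI)
    fix x assume "x \<in> (\<Union>h\<in>cls a. \<Union>k\<in>cls b. {\<lambda>g. h g + k g})"
    then obtain m n where mn: "m \<in> boundaries" "n \<in> boundaries" "x = (\<lambda>g. (m g + a g) + (n g + b g))"
      unfolding translate_def by auto
    have "x = (\<lambda>g. (m g + n g) + (a g + b g))" unfolding mn(3) by (simp add: algebra_simps)
    then show "x \<in> cls (\<lambda>g. a g + b g)"
      by (rule translateI[OF submodule_set_add[OF submodule_boundaries mn(1,2)]])
  next
    fix x assume "x \<in> cls (\<lambda>g. a g + b g)"
    then obtain m where m: "m \<in> boundaries" "x = (\<lambda>g. m g + (a g + b g))"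
      unfolding translate_def by (elim imageE) auto
    have "x = (\<lambda>g. (m g + a g) + (0 + b g))" unfolding m(2) by (simp add: algebra_simps)
    moreover have "(\<lambda>g. m g + a g) \<in> cls a" "(\<lambda>g. 0 + b g) \<in> cls b"
      by (rule translateI[OF m(1) refl], rule translateI[OF submodule_set_zero[OF submodule_boundaries] refl])
    ultimately show "x \<in> (\<Union>h\<in>cls a. \<Union>k\<in>cls b. {\<lambda>g. h g + k g})" by blast
  qed
  finally show ?thesis .
qed

lemma hom_smult: "r \<odot>\<^bsub>hom_module\<^esub> cls a = cls (\<lambda>g. r * a g)"
proof -
  have "r \<odot>\<^bsub>hom_module\<^esub> cls a = (\<Union>x\<in>cls a. cls (\<lambda>g. r * x g))"
    by (simp add: hom_module_def homology_def quotient_module_def boundaries_def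
        chain_module_def a_r_coset_chain[unfolded chain_module_def, simplified])
  also have "\<dots> = (\<Union>x\<in>boundaries. cls (\<lambda>g. r * a g))"
    unfolding translate_def[of _ a] image_image UN_simps
  proof (rule SUP_cong[OF refl])
    fix x assume x: "x \<in> boundaries"
    have "(\<lambda>g. r * (x g + a g) - r * a g) = (\<lambda>g. r * x g)" by (simp add: algebra_simps)
    then show "cls (\<lambda>g. r * (x g + a g)) = cls (\<lambda>g. r * a g)"
      using translate_eq[OF submodule_boundaries] submodule_set_scale[OF submodule_boundaries x] by simp
  qed
  also have "\<dots> = cls (\<lambda>g. r * a g)" using submodule_set_zero[OF submodule_boundaries] by auto
  finally show ?thesis .
qed

lemma cls_zero: "cls (\<lambda>_. 0) = boundaries"
  by (simp add: translate_def)

lemma cls_eq_boundaries: "cls a = boundaries \<longleftrightarrow> a \<in> boundaries"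
  using translate_eq[OF submodule_boundaries, of a "\<lambda>_. 0"] by (simp add: cls_zero)

lemma hom_torsion: "torsion hom_module = cls ` {t \<in> cycles. tors t}"
proof -
  have "{x \<in> cls ` cycles. P x} = cls ` {t \<in> cycles. P (cls t)}" for P by auto
  then show ?thesis
    unfolding torsion_def hom_carrier hom_zero torsion_mod_def by (simp add: hom_smult cls_eq_boundaries)
qed

text \<open>
  The element of homology modulo torsion represented by \<open>a\<close>, as a coset of the torsion submodule.
\<close>

definition "free_cls a = (\<lambda>t. cls (\<lambda>g. t g + a g)) ` {t \<in> cycles. tors t}"

lemma coset_torsion: "a_r_coset hom_module (torsion hom_module) (cls a) = free_cls a"
  unfolding a_r_coset_def' hom_torsion free_cls_def by (auto simp: hom_add)

lemma free_cls_eq: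
  assumes "a \<in> cycles" "b \<in> cycles"
  shows "free_cls a = free_cls b \<longleftrightarrow> tors (\<lambda>g. a g - b g)"
proof
  let ?Z = "{t \<in> cycles. tors t}"
  have "(\<lambda>_. 0) \<in> ?Z"
    using submodule_set_zero[OF submodule_cycles] torsion_mod_zero[OF submodule_boundaries] by simp
  then have "cls a \<in> free_cls a"
    unfolding free_cls_def by (rule image_eqI[rotated]) simp
  moreover assume "free_cls a = free_cls b"
  ultimately have "cls a \<in> free_cls b" by simp
  then obtain t where t: "t \<in> ?Z" "cls a = cls (\<lambda>g. t g + b g)" unfolding free_cls_def by (elim imageE) auto
  obtain r where r: "r \<noteq> 0" "(\<lambda>g. r * t g) \<in> boundaries" using t(1) by (auto simp: torsion_mod_def)
  have n: "(\<lambda>g. a g - (t g + b g)) \<in> boundaries" using t(2) translate_eq[OF submodule_boundaries] by simp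
  have "(\<lambda>g. r * (a g - b g)) = (\<lambda>g. r * (a g - (t g + b g)) + 1 * (r * t g))" by (simp add: algebra_simps)
  also have "\<dots> \<in> boundaries" by (rule submodule_setD[OF submodule_boundaries n r(2)])
  finally show "tors (\<lambda>g. a g - b g)" unfolding torsion_mod_def using r(1) by blast
next
  let ?Z = "{t \<in> cycles. tors t}"
  have sub: "free_cls a \<subseteq> free_cls b"
    if ab: "a \<in> cycles" "b \<in> cycles" "tors (\<lambda>g. a g - b g)" for a b
  proof
    fix y assume "y \<in> free_cls a"
    then obtain t where t: "t \<in> ?Z" "y = cls (\<lambda>g. t g + a g)" unfolding free_cls_def by (elim imageE) auto
    define t' where "t' = (\<lambda>g. 1 * t g + 1 * (a g - b g))"
    have "tors t'" unfolding t'_def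
      by (rule torsion_mod_combine[OF submodule_boundaries _ ab(3)]) (use t(1) in simp)
    moreover have "t' \<in> cycles" unfolding t'_def
      by (rule submodule_setD[OF submodule_cycles _ submodule_set_diff[OF submodule_cycles ab(1,2)]]) (use t(1) in simp)
    moreover have "y = cls (\<lambda>g. t' g + b g)" unfolding t(2) t'_def by simp
    ultimately show "y \<in> free_cls b" unfolding free_cls_def by blast
  qed
  assume ab: "tors (\<lambda>g. a g - b g)"
  have "tors (\<lambda>g. b g - a g)"
    using torsion_mod_combine[OF submodule_boundaries ab ab, of "- 1" 0] by simp
  then show "free_cls a = free_cls b" using sub[OF assms ab] sub[OF assms(2,1)] by blast
qed

definition "free_module = quotient_module hom_module (torsion hom_module)"

lemma free_carrier: "carrier free_module = free_cls ` cycles"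
  by (auto simp: free_module_def quotient_module_def A_RCOSETS_def' hom_carrier coset_torsion)

lemma free_smult:
  assumes a: "a \<in> cycles"
  shows "r \<odot>\<^bsub>free_module\<^esub> free_cls a = free_cls (\<lambda>g. r * a g)"
proof -
  let ?Z = "{t \<in> cycles. tors t}"
  have "r \<odot>\<^bsub>free_module\<^esub> free_cls a =
      (\<Union>x\<in>free_cls a. a_r_coset hom_module (torsion hom_module) (r \<odot>\<^bsub>hom_module\<^esub> x))"
    by (simp add: free_module_def quotient_module_def)
  also have "\<dots> = (\<Union>t\<in>?Z. free_cls (\<lambda>g. r * (t g + a g)))"
    unfolding free_cls_def[of a] image_image UN_simps hom_smult coset_torsion ..
  also have "\<dots> = (\<Union>t\<in>?Z. free_cls (\<lambda>g. r * a g))"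
  proof (rule SUP_cong[OF refl])
    fix t assume t: "t \<in> ?Z"
    have ta: "(\<lambda>g. r * (t g + a g)) \<in> cycles"
      using t submodule_set_scale[OF submodule_cycles submodule_set_add[OF submodule_cycles _ a], of t r] by simp
    have ra: "(\<lambda>g. r * a g) \<in> cycles" by (rule submodule_set_scale[OF submodule_cycles a])
    have "(\<lambda>g. r * (t g + a g) - r * a g) = (\<lambda>g. r * t g + 0 * t g)" by (simp add: algebra_simps)
    moreover have "tors (\<lambda>g. r * t g + 0 * t g)" using t torsion_mod_combine[OF submodule_boundaries] by blast
    ultimately show "free_cls (\<lambda>g. r * (t g + a g)) = free_cls (\<lambda>g. r * a g)"
      using free_cls_eq[OF ta ra] by simp
  qed
  also have "\<dots> = free_cls (\<lambda>g. r * a g)"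
    using submodule_set_zero[OF submodule_cycles] torsion_mod_zero[OF submodule_boundaries] by auto
  finally show ?thesis .
qed

text \<open>
  The class of \<open>\<alpha>\<close> is \<open>c\<^sup>k\<close> times the class of a cycle \<open>y\<close> modulo torsion iff a nonzero multiple of
  \<open>\<alpha> - c\<^sup>k y\<close> is a boundary.
\<close>

lemma divisibility_mod_torsion_chain:
  assumes \<alpha>: "\<alpha> \<in> B" "d \<alpha> = (\<lambda>_. 0)"
  shows "divisibility_mod_torsion c (homology ((chain_module D)\<lparr>carrier := B\<rparr>) d)
      (homology_class ((chain_module D)\<lparr>carrier := B\<rparr>) d \<alpha>) =
    Max {k. \<exists>y\<in>B. d y = (\<lambda>_. 0) \<and> (\<exists>r. r \<noteq> 0 \<and> (\<exists>z\<in>B. (\<lambda>g. r * (\<alpha> g - c ^ k * y g)) = d z))}"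
proof -
  have a: "\<alpha> \<in> cycles" using \<alpha> by (simp add: cycles_def)
  have hc: "homology_class ((chain_module D)\<lparr>carrier := B\<rparr>) d \<alpha> = cls \<alpha>"
    by (simp add: homology_class_def a_r_coset_chain boundaries_def)
  have "free_cls \<alpha> \<in> (\<lambda>x. c ^ k \<odot>\<^bsub>free_module\<^esub> x) ` carrier free_module \<longleftrightarrow>
      (\<exists>y\<in>B. d y = (\<lambda>_. 0) \<and> (\<exists>r. r \<noteq> 0 \<and> (\<exists>z\<in>B. (\<lambda>g. r * (\<alpha> g - c ^ k * y g)) = d z)))" for k
  proof -
    have "free_cls \<alpha> \<in> (\<lambda>x. c ^ k \<odot>\<^bsub>free_module\<^esub> x) ` carrier free_module \<longleftrightarrow>
        (\<exists>y\<in>cycles. free_cls \<alpha> = free_cls (\<lambda>g. c ^ k * y g))"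
      unfolding free_carrier image_image by (auto simp: free_smult)
    also have "\<dots> \<longleftrightarrow> (\<exists>y\<in>cycles. tors (\<lambda>g. \<alpha> g - c ^ k * y g))"
      using free_cls_eq[OF a submodule_set_scale[OF submodule_cycles]] by blast
    also have "\<dots> \<longleftrightarrow> (\<exists>y\<in>B. d y = (\<lambda>_. 0) \<and> (\<exists>r. r \<noteq> 0 \<and> (\<exists>z\<in>B. (\<lambda>g. r * (\<alpha> g - c ^ k * y g)) = d z)))"
      unfolding torsion_mod_def boundaries_def cycles_def image_iff by blast
    finally show ?thesis .
  qed
  then show ?thesis
    unfolding divisibility_mod_torsion_def divisibility_def hc hom_module_def[symmetric]
      coset_torsion free_module_def[symmetric] by simp
qed

end

section \<open>The conjugation modulo \<open>c\<close>\<close>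

context knot_cube
begin

text \<open>
  The sign by which the conjugation acts on a generator modulo \<open>c\<close> is positive on the even generators.
\<close>

definition even_generator :: "nat set \<times> nat set set \<Rightarrow> bool" where
  "even_generator = (\<lambda>(v, S). even ((card v + card (circles D v)) div 2 + card S))"

text \<open>
  In the expansion of \<open>c - X\<close> at all circles, every term except \<open>(-1)\<^bsup>|S|\<^esup> X\<^sup>S\<close> contains a factor \<open>c\<close>.
\<close>

lemma conjugate_mod_c:
  assumes x: "x \<in> chains D"
  shows "c dvd conjugate x g - (if even_generator g then x g else - x g)"
proof (cases "g \<in> generators D")
  case False
  then have "x g = 0" "conjugate x g = 0"
    using x conjugate_in_chains[of x] unfolding chains_iff by metis+
  then show ?thesis by simp
next
  case True
  obtain v T where g: "g = (v, T)" by fastforce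
  let ?P = "circles D v"
  let ?t = "\<lambda>S. if T \<subseteq> S then state_sign v * (- 1) ^ card T * c ^ (card S - card T) * x (v, S) else 0"
  have T: "T \<in> Pow ?P" "finite (Pow ?P)" using True g by (auto simp: generators_def)
  have "conjugate x g = ?t T + (\<Sum>S\<in>Pow ?P - {T}. ?t S)"
    using True unfolding g by (simp add: conjugate_def sum.remove[OF T(2,1)])
  moreover have "?t T = (if even_generator g then x g else - x g)"
    unfolding g even_generator_def state_sign_def by (simp flip: power_add add: minus_one_power_iff)
  moreover have "c dvd (\<Sum>S\<in>Pow ?P - {T}. ?t S)"
  proof (rule dvd_sum)
    fix S assume S: "S \<in> Pow ?P - {T}"
    show "c dvd ?t S"
    proof (cases "T \<subseteq> S")
      case True
      have "finite S" using S finite_circles finite_subset by blast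
      then have "card T < card S" using True S by (intro psubset_card_mono) auto
      then have "c dvd c ^ (card S - card T)" by (simp add: dvd_power)
      then show ?thesis using True by simp
    qed simp
  qed
  ultimately show ?thesis by simp
qed

lemma conjugate_mod_divisor_of_2:
  assumes "c dvd 2" and x: "x \<in> chains D"
  shows "c dvd 1 * conjugate x g - x g"
proof -
  have "c dvd conjugate x g - (if even_generator g then x g else - x g)" by (rule conjugate_mod_c[OF x])
  moreover have "c dvd (if even_generator g then x g else - x g) - x g"
  proof -
    have "c dvd 2 * x g" using assms(1) by simp
    then have "c dvd - (2 * x g)" by (subst dvd_minus_iff)
    moreover have "(if even_generator g then x g else - x g) - x g = (if even_generator g then 0 else - (2 * x g))"
      by simp
    ultimately show ?thesis by simp
  qed
  ultimately have "c dvd (conjugate x g - (if even_generator g then x g else - x g))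
      + ((if even_generator g then x g else - x g) - x g)" by (rule dvd_add)
  then show ?thesis by simp
qed

definition divides_in :: "'r chain set \<Rightarrow> nat \<Rightarrow> 'r chain \<Rightarrow> bool" where
  "divides_in B k y \<longleftrightarrow> y \<in> B \<and> differential c D y = (\<lambda>_. 0) \<and>
     (\<exists>r. r \<noteq> 0 \<and> (\<exists>z\<in>B. (\<lambda>g. r * (lee_cycle c D g - c ^ k * y g)) = differential c D z))"

lemma submodule_chains: "submodule_set (chains D :: 'r chain set)"
  by (auto simp: submodule_set_def chains_iff)

lemma d_lee_conv: "d_lee c D = Max {k. \<exists>y. divides_in (chains D) k y}"
proof -
  have "(chain_module D)\<lparr>carrier := chains D\<rparr> = (chain_module D :: ('r, 'r chain) module)" by simp
  then show ?thesis
    using divisibility_mod_torsion_chain[OF submodule_chains linear_differential lee_cycle_in_chains differential_lee_cycle, of c D]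
    unfolding d_lee_def divides_in_def by (simp add: Bex_def)
qed

lemma d_lee_reduced_conv:
  assumes p: "p \<in> edges D"
  shows "d_lee_reduced c D p = Max {k. \<exists>y. divides_in (project p ` chains D) k y}"
proof -
  have "reduced_chain_module c D p = (chain_module D)\<lparr>carrier := project p ` chains D\<rparr>"
    using reduced_carrier[OF p] by (simp add: reduced_chain_module_def)
  then show ?thesis
    using divisibility_mod_torsion_chain[OF submodule_set_image[OF submodule_chains linear_project]
        linear_differential lee_cycle_reduced[OF p] differential_lee_cycle, of c D]
    unfolding d_lee_reduced_def divides_in_def by (simp add: Bex_def)
qed

text \<open>
  The maxima are taken over the same set: a reduced chain is a chain, and the converse is
  \<open>divide_reduced\<close>, provided that \<open>y\<close> can be chosen so that \<open>J\<close> acts on it as a constant modulo \<open>c\<close>.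
\<close>

lemma d_lee_reduced_eq:
  assumes p: "p \<in> edges D"
    and homogenize: "\<And>k y. divides_in (chains D) k y \<Longrightarrow>
      \<exists>y' \<epsilon>. divides_in (chains D) k y' \<and> (\<forall>g. c dvd \<epsilon> * conjugate y' g - y' g)"
  shows "d_lee_reduced c D p = d_lee c D"
proof -
  have "(\<exists>y. divides_in (project p ` chains D) k y) \<longleftrightarrow> (\<exists>y. divides_in (chains D) k y)" for k
  proof
    assume "\<exists>y. divides_in (project p ` chains D) k y"
    moreover have "project p ` chains D \<subseteq> chains D" using project_in_chains by blast
    ultimately show "\<exists>y. divides_in (chains D) k y" unfolding divides_in_def by blast
  next
    assume "\<exists>y. divides_in (chains D) k y"
    then obtain y \<epsilon> where y: "divides_in (chains D) k y" and \<epsilon>: "\<And>g. c dvd \<epsilon> * conjugate y g - y g"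
      using homogenize by metis
    then obtain r z where "r \<noteq> 0" "z \<in> chains D" "(\<lambda>g. r * (lee_cycle c D g - c ^ k * y g)) = differential c D z"
      and "y \<in> chains D" "differential c D y = (\<lambda>_. 0)"
      unfolding divides_in_def by blast
    from divide_reduced[OF p this(4,5,2,1,3) \<epsilon>]
    show "\<exists>y. divides_in (project p ` chains D) k y"
      unfolding divides_in_def by blast
  qed
  then show ?thesis unfolding d_lee_conv d_lee_reduced_conv[OF p] by simp
qed

lemma d_lee_reduced_eq_divisor_of_2:
  assumes p: "p \<in> edges D" and "c dvd 2"
  shows "d_lee_reduced c D p = d_lee c D"
proof (rule d_lee_reduced_eq[OF p])
  fix k y assume y: "divides_in (chains D) k y"
  then have "\<forall>g. c dvd 1 * conjugate y g - y g"
    using conjugate_mod_divisor_of_2[OF assms(2)] by (simp add: divides_in_def)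
  then show "\<exists>y' \<epsilon>. divides_in (chains D) k y' \<and> (\<forall>g. c dvd \<epsilon> * conjugate y' g - y' g)"
    using y by blast
qed

end

section \<open>Parity\<close>

text \<open>
  A splitting of the ring into an even part \<open>part True\<close> and an odd part \<open>part False\<close> that is compatible with
  the product, such that \<open>c\<close> is odd and generates an ideal containing all odd elements. The model is the
  polynomial ring \<open>F[c]\<close>, graded by the degree modulo 2.
\<close>

locale parity_grading =
  fixes part :: "bool \<Rightarrow> 'r::idom \<Rightarrow> 'r" and c :: 'r
  assumes part_add: "part b (x + y) = part b x + part b y"
    and part_total: "part True x + part False x = x"
    and part_part: "part b (part b' x) = (if b = b' then part b x else 0)"
    and part_mult: "part b (x * y) = part True x * part b y + part False x * part (\<not> b) y"
    and part_c: "part True c = 0"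
    and part_dvd: "c dvd part False x"
begin

lemma part_zero [simp]: "part b 0 = 0"
  using part_add[of b 0 0] by (metis add_0 add_cancel_right_right)

lemma part_minus: "part b (- x) = - part b x"
  using part_add[of b x "- x"] by (simp add: eq_neg_iff_add_eq_0 add.commute)

lemma part_diff: "part b (x - y) = part b x - part b y"
  using part_add[of b x "- y"] part_minus[of b y] by simp

lemma part_sum: "part b (\<Sum>i\<in>I. f i) = (\<Sum>i\<in>I. part b (f i))"
  by (induction I rule: infinite_finite_induct) (simp_all add: part_add)

lemma part_False_c: "part False c = c"
  using part_total[of c] part_c by simp

lemma part_c_mult: "part b (c * x) = c * part (\<not> b) x"
  using part_mult[of b c x] part_c part_False_c by simp

lemma part_sign: "part b ((- 1) ^ m * x) = (- 1) ^ m * part b x"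
  by (cases "even m") (simp_all add: part_minus)

lemma part_c_power_mult: "part b (c ^ k * x) = c ^ k * part (b = even k) x"
proof (induction k arbitrary: b)
  case (Suc k)
  have "part b (c ^ Suc k * x) = c * part (\<not> b) (c ^ k * x)" using part_c_mult[of b "c ^ k * x"] by (simp add: mult.assoc)
  also have "\<dots> = c ^ Suc k * part ((\<not> b) = even k) x" using Suc.IH by (simp add: mult.assoc)
  also have "((\<not> b) = even k) = (b = even (Suc k))" by auto
  finally show ?case .
qed simp

lemma part_True_1: "part True 1 = 1"
proof -
  have b: "part False c = part True c * part False 1 + part False c * part True 1" using part_mult[of False c 1] by simp
  show ?thesis
  proof (cases "c = 0")
    case True
    then have "part False 1 = 0" using part_dvd[of 1] by simp
    then show ?thesis using part_total[of 1] by simp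
  next
    case False
    then show ?thesis using b part_c part_False_c by simp
  qed
qed

lemma part_c_power: "part b ((- c) ^ m) = (if b = even m then (- c) ^ m else 0)"
proof -
  have "part False 1 = 0" using part_total[of 1] part_True_1 by simp
  then have "part (b = even m) 1 = (if b = even m then 1 else 0)" using part_True_1 by (cases "b = even m") simp_all
  then have "part b (c ^ m) = (if b = even m then c ^ m else 0)" using part_c_power_mult[of b m 1] by simp
  moreover have "(- c) ^ m = (- 1) ^ m * c ^ m" by (rule power_minus)
  ultimately show ?thesis using part_sign[of b m "c ^ m"] by simp
qed

text \<open>
  With \<open>r\<close> also its product with the conjugate \<open>part True r - part False r\<close> is nonzero. This product is even and
  therefore acts on each homogeneous component separately.
\<close>

lemma norm_nonzero:
  assumes "r \<noteq> 0"
  shows "part True r * part True r - part False r * part False r \<noteq> 0"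
proof -
  have "r = 0" if "part True r = part False r \<or> part True r = - part False r"
  proof -
    have "part True (part True r) = part True (part False r) \<or> part True (part True r) = part True (- part False r)"
      using that by metis
    then have "part True (part True r) = 0" by (simp add: part_part part_minus)
    then have "part True r = 0" by (simp add: part_part)
    then show ?thesis using that part_total[of r] by auto
  qed
  then have "(part True r - part False r) * (part True r + part False r) \<noteq> 0"
    using assms by (auto simp: eq_neg_iff_add_eq_0)
  then show ?thesis by (simp add: algebra_simps)
qed

end

locale graded_knot_cube = knot_cube c D + parity_grading part c
  for c :: "'r::idom" and D and part
begin

text \<open>
  The homogeneous components of a chain for the grading that adds the degree of a coefficient and the
  degree of its generator, with \<open>b = True\<close> for even chains.
\<close>

definition parity_component :: "bool \<Rightarrow> 'r chain \<Rightarrow> 'r chain" where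
  "parity_component b x = (\<lambda>g. part (even_generator g = b) (x g))"

text \<open>
  Where the coefficient is \<open>1\<close>, a merge preserves the number of factors \<open>X\<close>, and a split raises it by one,
  which compensates the sign change of the state. Where the coefficient is \<open>\<plusminus>c\<close>, there is one factor \<open>X\<close> less.
  As \<open>c\<close> is odd, the differential preserves the parity of chains.
\<close>

lemma edge_coeff_parity:
  assumes w: "w \<subseteq> {..<n}" "i \<in> w" and S: "S \<subseteq> circles D (w - {i})" and T: "T \<subseteq> circles D w"
  shows "edge_coeff c D (w - {i}, S) (w, T) = 0 \<or>
    edge_coeff c D (w - {i}, S) (w, T) = 1 \<and> even_generator (w, T) = even_generator (w - {i}, S) \<or>
    (edge_coeff c D (w - {i}, S) (w, T) = c \<or> edge_coeff c D (w - {i}, S) (w, T) = - c) \<and>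
      even_generator (w, T) \<noteq> even_generator (w - {i}, S)"
proof -
  let ?v = "w - {i}"
  define U where "U = circles D ?v \<inter> circles D w"
  have e: "edge_coeff c D (?v, S) (w, T) = (if S \<inter> U \<noteq> T \<inter> U then 0
      else if card (circles D w) < card (circles D ?v) then mult_coeff c (card (S - U)) (card (T - U))
      else comult_coeff c (card (S - U)) (card (T - U)))"
    by (simp add: edge_coeff_def Let_def U_def)
  show ?thesis
  proof (cases "S \<inter> U = T \<inter> U")
    case False
    then show ?thesis using e by simp
  next
    case True
    define a k l where "a = card (T \<inter> U)" "k = card (S - U)" "l = card (T - U)"
    have "finite S" "finite T" using S T finite_circles finite_subset by blast+
    then have cST: "card S = a + k" "card T = a + l"
      using card_Int_Diff[of S U] card_Int_Diff[of T U] True by (simp_all add: a_k_l_def)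
    have cw: "card w = card ?v + 1" by (rule card_remove_Suc[OF w])
    from adjacent_states[OF w] show ?thesis
    proof
      assume "merges_to (circles D ?v) (circles D w)"
      then have cd: "card (circles D ?v) = card (circles D w) + 1" using merges_to_parts[OF _ partition] by metis
      then have h: "card w + card (circles D w) = card ?v + card (circles D ?v)" using cw by simp
      have "edge_coeff c D (?v, S) (w, T) = mult_coeff c k l" using e True cd by (simp add: a_k_l_def)
      then show ?thesis
        unfolding even_generator_def using h cST by (auto simp: mult_coeff_def)
    next
      assume "merges_to (circles D w) (circles D ?v)"
      then have cd: "card (circles D w) = card (circles D ?v) + 1" using merges_to_parts[OF _ partition] by metis
      then have h: "(card w + card (circles D w)) div 2 = (card ?v + card (circles D ?v)) div 2 + 1" using cw by simp
      have "edge_coeff c D (?v, S) (w, T) = comult_coeff c k l" using e True cd by (simp add: a_k_l_def)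
      then show ?thesis
        unfolding even_generator_def using h cST by (auto simp: comult_coeff_def)
    qed
  qed
qed

lemma parity_component_differential: "parity_component b (differential c D x) = differential c D (parity_component b x)"
proof
  fix g :: "nat set \<times> nat set set"
  obtain w T where g: "g = (w, T)" by fastforce
  show "parity_component b (differential c D x) g = differential c D (parity_component b x) g"
  proof (cases "g \<in> generators D")
    case False
    then show ?thesis by (simp add: g parity_component_def differential_def)
  next
    case True
    then have w: "w \<subseteq> {..<n}" and T: "T \<subseteq> circles D w" by (auto simp: g generators_def)
    have "part (even_generator (w, T) = b) (edge_coeff c D (w - {i}, S) (w, T) * x (w - {i}, S)) =
        edge_coeff c D (w - {i}, S) (w, T) * parity_component b x (w - {i}, S)"
      if i: "i \<in> w" and S: "S \<in> Pow (circles D (w - {i}))" for i S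
    proof -
      let ?e = "edge_coeff c D (w - {i}, S) (w, T)" and ?a = "x (w - {i}, S)"
      have "S \<subseteq> circles D (w - {i})" using S by simp
      from edge_coeff_parity[OF w i this T] show ?thesis
      proof (elim disjE conjE)
        assume e: "?e = c" and "even_generator (w, T) \<noteq> even_generator (w - {i}, S)"
        then have "(\<not> (even_generator (w, T) = b)) = (even_generator (w - {i}, S) = b)" by auto
        then show ?thesis unfolding e parity_component_def part_c_mult by simp
      next
        assume e: "?e = - c" and "even_generator (w, T) \<noteq> even_generator (w - {i}, S)"
        then have "(\<not> (even_generator (w, T) = b)) = (even_generator (w - {i}, S) = b)" by auto
        then show ?thesis unfolding e parity_component_def mult_minus_left part_minus part_c_mult by simp
      qed (simp_all add: parity_component_def)
    qed
    then show ?thesis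
      using True unfolding g parity_component_def[of b "differential c D x"]
      by (simp add: differential_def part_sum part_sign)
  qed
qed

lemma parity_component_in_chains: "x \<in> chains D \<Longrightarrow> parity_component b x \<in> chains D"
  by (simp add: chains_iff parity_component_def)

lemma parity_component_lee_cycle: "\<exists>b. parity_component b (lee_cycle c D) = lee_cycle c D"
proof -
  let ?P = "circles D seifert"
  let ?h = "(card seifert + card ?P) div 2"
  have "part (even_generator g = even (?h + card ?P)) (lee_cycle c D g) = lee_cycle c D g" for g
  proof -
    obtain v S where g: "g = (v, S)" by fastforce
    show ?thesis
    proof (cases "v = seifert \<and> S \<subseteq> ?P")
      case False
      then have "lee_cycle c D g = 0" by (auto simp: g lee_cycle_def)
      then show ?thesis by simp
    next
      case True
      have fS: "finite S" using True finite_circles finite_subset by blast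
      have lee: "lee_cycle c D g = (\<Prod>\<gamma>\<in>?P - S. if colored_a D \<gamma> then 0 else - c)"
        unfolding g lee_cycle_def using True
        by (simp, intro prod.mono_neutral_cong_right) auto
      then consider "lee_cycle c D g = 0" | "lee_cycle c D g = (- c) ^ card (?P - S)"
      proof (cases "\<exists>\<gamma>\<in>?P - S. colored_a D \<gamma>")
        case True
        then have "\<exists>\<gamma>\<in>?P - S. (if colored_a D \<gamma> then 0 else - c) = 0" by auto
        then have "lee_cycle c D g = 0" unfolding lee using prod_zero[of "?P - S"] by simp
        then show ?thesis using that(1) by simp
      next
        case False
        then have "(\<Prod>\<gamma>\<in>?P - S. if colored_a D \<gamma> then 0 else - c) = (\<Prod>\<gamma>\<in>?P - S. - c)"
          by (intro prod.cong) auto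
        then show ?thesis using that(2) lee by simp
      qed
      then show ?thesis
      proof cases
        case 2
        have "card ?P = card (?P - S) + card S"
          using True fS card_Diff_subset[of S ?P] card_mono[of ?P S] by simp
        then have "(even_generator g = even (?h + card ?P)) = even (card (?P - S))"
          using True by (auto simp: g even_generator_def)
        then show ?thesis unfolding 2 by (simp add: part_c_power)
      qed simp
    qed
  qed
  then show ?thesis unfolding parity_component_def by blast
qed

lemma parity_component_mult:
  "parity_component b (\<lambda>g. r * x g) = (\<lambda>g. part True r * parity_component b x g + part False r * parity_component (\<not> b) x g)"
proof
  fix g
  have "(\<not> (even_generator g = b)) = (even_generator g = (\<not> b))" by auto
  then show "parity_component b (\<lambda>g. r * x g) g = part True r * parity_component b x g + part False r * parity_component (\<not> b) x g"
    unfolding parity_component_def using part_mult[of "even_generator g = b" r "x g"] by simp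
qed

text \<open>
  On a homogeneous chain a coefficient at a generator of the wrong sign is odd, hence vanishes modulo
  \<open>c\<close>. So the signs by which the conjugation acts modulo \<open>c\<close> are constant.
\<close>

lemma parity_component_conjugate:
  assumes y: "y \<in> chains D" and b: "parity_component b y = y"
  shows "c dvd (if b then 1 else - 1) * conjugate y g - y g"
proof -
  let ?s = "if even_generator g then y g else - y g"
  have dv: "c dvd conjugate y g - ?s" by (rule conjugate_mod_c[OF y])
  show ?thesis
  proof (cases "even_generator g = b")
    case True
    show ?thesis
    proof (cases b)
      case bt: True
      then show ?thesis using dv True by simp
    next
      case bf: False
      then have "c dvd - (conjugate y g - ?s)" using dv by (subst dvd_minus_iff)
      then show ?thesis using True bf by simp
    qed
  next
    case False
    have "y g = part (even_generator g = b) (y g)" using fun_cong[OF b, of g] by (simp add: parity_component_def)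
    then have "c dvd y g" using False part_dvd[of "y g"] by simp
    then have s: "c dvd ?s" by simp
    have "c dvd (conjugate y g - ?s) + ?s" using dv s by (rule dvd_add)
    then have "c dvd conjugate y g" by simp
    then show ?thesis using \<open>c dvd y g\<close> by (intro dvd_diff dvd_mult)
  qed
qed

text \<open>
  Take \<open>y'\<close> to be the component of \<open>y\<close> for which \<open>c\<^sup>k y'\<close> has the parity \<open>b\<close> of the Lee cycle. For \<open>r\<close> and
  \<open>x = \<alpha> - c\<^sup>k y\<close> with parts \<open>r\<^sub>0, r\<^sub>1\<close> and components \<open>x\<^sub>0, x\<^sub>1\<close>, both \<open>r\<^sub>0 x\<^sub>0 + r\<^sub>1 x\<^sub>1\<close> and
  \<open>r\<^sub>0 x\<^sub>1 + r\<^sub>1 x\<^sub>0\<close> are boundaries. Eliminating \<open>x\<^sub>1\<close> makes \<open>(r\<^sub>0\<^sup>2 - r\<^sub>1\<^sup>2) x\<^sub>0\<close> a boundary.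
\<close>

lemma homogenize:
  assumes "divides_in (chains D) k y"
  shows "\<exists>y' \<epsilon>. divides_in (chains D) k y' \<and> (\<forall>g. c dvd \<epsilon> * conjugate y' g - y' g)"
proof -
  obtain b where b: "parity_component b (lee_cycle c D) = lee_cycle c D" using parity_component_lee_cycle by blast
  obtain r z where y: "y \<in> chains D" "differential c D y = (\<lambda>_. 0)" and r: "r \<noteq> 0" and z: "z \<in> chains D"
    and eq: "(\<lambda>g. r * (lee_cycle c D g - c ^ k * y g)) = differential c D z"
    using assms unfolding divides_in_def by blast
  \<comment> \<open>The factor \<open>c\<^sup>k\<close> changes the parity iff \<open>k\<close> is odd.\<close>
  define b' where "b' = (b = even k)"
  define y' where "y' = parity_component b' y"
  define x where "x = (\<lambda>g. lee_cycle c D g - c ^ k * y g)"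
  have xb: "parity_component b x = (\<lambda>g. lee_cycle c D g - c ^ k * y' g)"
  proof
    fix g
    have "part (even_generator g = b) (lee_cycle c D g) = lee_cycle c D g"
      using fun_cong[OF b, of g] by (simp add: parity_component_def)
    moreover have "((even_generator g = b) = even k) = (even_generator g = b')" by (auto simp: b'_def)
    ultimately show "parity_component b x g = lee_cycle c D g - c ^ k * y' g"
      by (simp add: parity_component_def x_def y'_def part_diff part_c_power_mult)
  qed
  have dz: "(\<lambda>g. part True r * parity_component a x g + part False r * parity_component (\<not> a) x g) = differential c D (parity_component a z)" for a
    using arg_cong[OF eq, of "parity_component a"] parity_component_mult[of a r x]
    by (simp add: x_def parity_component_differential)
  define r' where "r' = part True r * part True r - part False r * part False r"
  define z' where "z' = (\<lambda>g. part True r * parity_component b z g + (- part False r) * parity_component (\<not> b) z g)"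
  have "differential c D z' = (\<lambda>g. part True r * differential c D (parity_component b z) g + (- part False r) * differential c D (parity_component (\<not> b) z) g)"
    unfolding z'_def by (rule linear_mapD[OF linear_differential])
  also have "\<dots> = (\<lambda>g. r' * (lee_cycle c D g - c ^ k * y' g))"
    unfolding dz[symmetric] fun_cong[OF xb, symmetric] r'_def by (simp add: algebra_simps)
  finally have "(\<lambda>g. r' * (lee_cycle c D g - c ^ k * y' g)) = differential c D z'" ..
  moreover have "z' \<in> chains D" unfolding z'_def by (intro chains_combine parity_component_in_chains z)
  moreover have "r' \<noteq> 0" unfolding r'_def by (rule norm_nonzero[OF r])
  moreover have "y' \<in> chains D" unfolding y'_def by (rule parity_component_in_chains[OF y(1)])
  moreover have "differential c D y' = (\<lambda>_. 0)"
    unfolding y'_def parity_component_differential[symmetric] y(2) by (simp add: parity_component_def)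
  ultimately have "divides_in (chains D) k y'" unfolding divides_in_def by blast
  moreover have "parity_component b' y' = y'" unfolding y'_def parity_component_def by (simp add: part_part)
  ultimately show ?thesis using parity_component_conjugate[of y' b'] unfolding divides_in_def by blast
qed

lemma d_lee_reduced_eq_graded: "p \<in> edges D \<Longrightarrow> d_lee_reduced c D p = d_lee c D"
  using d_lee_reduced_eq homogenize by blast

end

section \<open>Polynomial rings\<close>

definition parity_part :: "bool \<Rightarrow> 'f::field poly \<Rightarrow> 'f poly" where
  "parity_part b p = Abs_poly (\<lambda>i. if even i = b then coeff p i else 0)"

lemma coeff_parity_part: "coeff (parity_part b p) i = (if even i = b then coeff p i else 0)"
  unfolding parity_part_def by (subst coeff_Abs_poly[of "degree p"]) (simp_all add: coeff_eq_0)

lemma sum_if_const: "(\<Sum>i\<in>I. if P then f i else 0) = (if P then \<Sum>i\<in>I. f i else 0)"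
  by simp

lemma parity_part_mult:
  "parity_part b (p * p') = parity_part True p * parity_part b p' + parity_part False p * parity_part (\<not> b) p'"
proof (rule poly_eqI)
  fix m
  have "(if even m = b then coeff p i * coeff p' (m - i) else 0) =
      (if even i = True then coeff p i else 0) * (if even (m - i) = b then coeff p' (m - i) else 0) +
      (if even i = False then coeff p i else 0) * (if even (m - i) = (\<not> b) then coeff p' (m - i) else 0)"
    if "i \<in> {..m}" for i
    using that by auto
  then have "(\<Sum>i\<le>m. if even m = b then coeff p i * coeff p' (m - i) else 0) =
      (\<Sum>i\<le>m. (if even i = True then coeff p i else 0) * (if even (m - i) = b then coeff p' (m - i) else 0) +
      (if even i = False then coeff p i else 0) * (if even (m - i) = (\<not> b) then coeff p' (m - i) else 0))"
    by (rule sum.cong[OF refl])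
  moreover have "coeff (parity_part b (p * p')) m = (\<Sum>i\<le>m. if even m = b then coeff p i * coeff p' (m - i) else 0)"
    unfolding coeff_parity_part coeff_mult by (rule sum_if_const[symmetric])
  ultimately show "coeff (parity_part b (p * p')) m =
      coeff (parity_part True p * parity_part b p' + parity_part False p * parity_part (\<not> b) p') m"
    by (simp only: coeff_add coeff_mult coeff_parity_part sum.distrib)
qed

lemma parity_grading_poly:
  assumes \<phi>: "\<phi> \<in> ring_iso (ring_of_type_algebra :: 'f::field poly ring) (ring_of_type_algebra :: 'r::idom ring)"
    and c: "\<phi> [:0, 1:] = c"
  shows "\<exists>part. parity_grading part c"
proof -
  have hom: "\<phi> (p + p') = \<phi> p + \<phi> p'" "\<phi> (p * p') = \<phi> p * \<phi> p'" for p p'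
    using \<phi> by (auto simp: ring_iso_def ring_hom_def ring_of_type_algebra_def)
  have bij: "bij \<phi>" using \<phi> by (auto simp: ring_iso_def ring_of_type_algebra_def)
  define \<psi> where "\<psi> = inv_into UNIV \<phi>"
  have inv: "\<phi> (\<psi> x) = x" "\<psi> (\<phi> p) = p" for x p
    using bij by (simp_all add: \<psi>_def bij_is_surj surj_f_inv_f bij_is_inj)
  have inv_hom: "\<psi> (x + y) = \<psi> x + \<psi> y" "\<psi> (x * y) = \<psi> x * \<psi> y" for x y
    by (metis hom inv)+
  have zero: "\<phi> 0 = 0" using hom(1)[of 0 0] by (metis add_0 add_cancel_right_right)
  have "parity_grading (\<lambda>b x. \<phi> (parity_part b (\<psi> x))) c"
  proof
    fix b b' x y
    have "parity_part b (p + p') = parity_part b p + parity_part b p'" for p p' :: "'f poly"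
      by (rule poly_eqI) (simp add: coeff_parity_part)
    then show "\<phi> (parity_part b (\<psi> (x + y))) = \<phi> (parity_part b (\<psi> x)) + \<phi> (parity_part b (\<psi> y))"
      by (simp add: inv_hom hom)
    have "parity_part True p + parity_part False p = p" for p :: "'f poly"
      by (rule poly_eqI) (simp add: coeff_parity_part)
    then show "\<phi> (parity_part True (\<psi> x)) + \<phi> (parity_part False (\<psi> x)) = x"
      by (simp add: hom(1)[symmetric] inv)
    have "parity_part b (parity_part b' p) = (if b = b' then parity_part b p else 0)" for p :: "'f poly"
      by (rule poly_eqI) (auto simp: coeff_parity_part)
    then show "\<phi> (parity_part b (\<psi> (\<phi> (parity_part b' (\<psi> x))))) = (if b = b' then \<phi> (parity_part b (\<psi> x)) else 0)"
      by (simp add: inv zero)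
    show "\<phi> (parity_part b (\<psi> (x * y))) = \<phi> (parity_part True (\<psi> x)) * \<phi> (parity_part b (\<psi> y)) +
        \<phi> (parity_part False (\<psi> x)) * \<phi> (parity_part (\<not> b) (\<psi> y))"
      by (simp add: inv_hom parity_part_mult hom)
    have "parity_part True [:0, 1 :: 'f:] = 0"
      by (rule poly_eqI) (auto simp: coeff_parity_part coeff_pCons split: nat.splits)
    then show "\<phi> (parity_part True (\<psi> c)) = 0" by (simp add: c[symmetric] inv zero)
    have "poly (parity_part False (\<psi> x)) 0 = 0" by (simp add: poly_0_coeff_0 coeff_parity_part)
    then have "[:0, 1:] dvd parity_part False (\<psi> x)" using poly_eq_0_iff_dvd[of "parity_part False (\<psi> x)" 0] by (simp only: minus_zero)
    then obtain p where "parity_part False (\<psi> x) = [:0, 1:] * p" by (rule dvdE)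
    then show "c dvd \<phi> (parity_part False (\<psi> x))" by (simp only: hom c dvd_triv_left)
  qed
  then show ?thesis by blast
qed

section \<open>Equality of the two invariants\<close>

theorem proposition5p7:
  fixes c :: "'r::idom"
  assumes "principal_domain (ring_of_type_algebra :: 'r ring)"
    and "prime_elem c"
    and "(\<exists>\<phi> \<in> ring_iso (ring_of_type_algebra :: ('f::field) poly ring) (ring_of_type_algebra :: 'r ring).
            \<phi> [:0, 1:] = c)
         \<or> (c = 2 \<and> (2::'r) \<noteq> 0)
         \<or> (2::'r) = 0"
  shows "\<forall>D p. knot_diagram D \<and> p \<in> edges D \<longrightarrow> ss_reduced c D p = ss c D"
proof (intro allI impI, elim conjE)
  fix D p assume D: "knot_diagram D" and p: "p \<in> edges D"
  interpret knot_cube c D using assms(2) D by unfold_locales auto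
  have "d_lee_reduced c D p = d_lee c D"
  proof (cases "c dvd 2")
    case True
    then show ?thesis by (rule d_lee_reduced_eq_divisor_of_2[OF p])
  next
    case False
    then obtain \<phi> where "\<phi> \<in> ring_iso (ring_of_type_algebra :: 'f poly ring) (ring_of_type_algebra :: 'r ring)"
        "\<phi> [:0, 1:] = c"
      using assms(3) by auto
    then obtain part where "parity_grading part c" using parity_grading_poly by metis
    then interpret graded_knot_cube c D part by (intro graded_knot_cube.intro knot_cube_axioms)
    show ?thesis by (rule d_lee_reduced_eq_graded[OF p])
  qed
  then show "ss_reduced c D p = ss c D" by (simp add: ss_reduced_def ss_def)
qed

end
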